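(* Let $d \in \mathbb{N}$, $\lambda=(d-1)/2$, and let $f \in \mathcal{P}(\mathbb{S}^d\times\mathbb{R})$ be absolutely continuous in its first variable. For each choice of sign $\pm$: if $\mathcal{D}^\lambda_{\pm} f$ is continuous (on $[-1,1]\times\mathbb{R}$), then $\mathcal{D}^\lambda_{\pm} f \in \mathcal{P}(\mathbb{S}^{d+1}\times\mathbb{R})$.
   Context: $\mathbb{S}^d$ is the unit sphere in $\mathbb{R}^{d+1}$, with geodesic distance $d(\xi,\eta)=\arccos\langle \xi,\eta\rangle$. For $d \in \mathbb{N}=\{1,2,\dots\}$, $\mathcal{P}(\mathbb{S}^d\times\mathbb{R})$ denotes the class of continuous functions $f:[-1,1]\times\mathbb{R}\to\mathbb{R}$ such that the kernel $((\xi,s),(\eta,t)) \mapsto f(\cos d(\xi,\eta),\, s-t)$ is positive definite on $\mathbb{S}^d\times\mathbb{R}$, i.e. $\sum_{i,j} c_i \overline{c_j} f(\langle \xi_i,\xi_j\rangle, t_i-t_j)\ge 0$ for all finite families of points $(\xi_i,t_i)\in\mathbb{S}^d\times\mathbb{R}$ and scalars $c_i \in \mathbb{C}$. For $\lambda\ge 0$ and $f:[-1,1]\times\mathbb{R}\to\mathbb{R}$ absolutely continuous in its first variable, the half-step derivative operators (order $\alpha=1/2$) are $$D^\lambda_+ f(x,t) := (1+x)\frac{\partial}{\partial x}\left((1+x)^{-\lambda}\int_{-1}^x (x-u)^{-\frac12}(1+u)^{\lambda-\frac12} f(u,t)\,\mathrm{d}u\right),$$ $$D^\lambda_- f(x,t)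 := (1-x)\frac{\partial}{\partial x}\left((1-x)^{-\lambda}\int_{x}^1 (u-x)^{-\frac12}(1-u)^{\lambda-\frac12} f(u,t)\,\mathrm{d}u\right),$$ and $\mathcal{D}^\lambda_{\pm} f := D^\lambda_+ f \pm D^\lambda_- f$. Values at points $x$ (such as the endpoints $x=\pm1$) where the defining expression is not directly defined are understood by continuous extension. *)

theory Defs
  imports "HOL-Analysis.Analysis"
begin

section \<open>Positive definite functions on sphere times line\<close>

text \<open>The condition \<open>\<in> \<real>\<^sub>\<ge>\<^sub>0\<close> on a complex number says that it is real and nonnegative.\<close>

definition positive_definite_on :: "'a set \<Rightarrow> ('a \<Rightarrow> 'a \<Rightarrow> real) \<Rightarrow> bool" where
  "positive_definite_on S K \<longleftrightarrow>
     (\<forall>(n::nat) (p :: nat \<Rightarrow> 'a) (c :: nat \<Rightarrow> complex).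
        (\<forall>i<n. p i \<in> S) \<longrightarrow>
        (\<Sum>i<n. \<Sum>j<n. c i * cnj (c j) * of_real (K (p i) (p j))) \<in> \<real>\<^sub>\<ge>\<^sub>0)"

text \<open>
  The unit sphere of \<open>(d+1)\<close>-dimensional space is \<open>topspace (nsphere d)\<close>: its points are functions
  \<open>nat \<Rightarrow> real\<close> vanishing beyond index \<open>d\<close>, so that all dimensions share one type.
\<close>

definition sphere_inner :: "nat \<Rightarrow> (nat \<Rightarrow> real) \<Rightarrow> (nat \<Rightarrow> real) \<Rightarrow> real" where
  "sphere_inner d \<xi> \<eta> = (\<Sum>i\<le>d. \<xi> i * \<eta> i)"

definition sphere_dist :: "nat \<Rightarrow> (nat \<Rightarrow> real) \<Rightarrow> (nat \<Rightarrow> real) \<Rightarrow> real" where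
  "sphere_dist d \<xi> \<eta> = arccos (sphere_inner d \<xi> \<eta>)"

text \<open>Only the values of \<open>f\<close> on \<open>{-1..1} \<times> UNIV\<close> matter for membership.\<close>

definition sphere_line_pd :: "nat \<Rightarrow> (real \<Rightarrow> real \<Rightarrow> real) set" where
  "sphere_line_pd d =
     {f. continuous_on ({-1..1} \<times> UNIV) (\<lambda>(x, t). f x t) \<and>
         positive_definite_on (topspace (nsphere d) \<times> UNIV)
           (\<lambda>(\<xi>, s) (\<eta>, t). f (cos (sphere_dist d \<xi> \<eta>)) (s - t))}"

section \<open>Absolute continuity\<close>

definition absolutely_continuous_on_interval :: "real \<Rightarrow> real \<Rightarrow> (real \<Rightarrow> real) \<Rightarrow> bool" where
  "absolutely_continuous_on_interval A B f \<longleftrightarrow>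
     (\<forall>\<epsilon>>0. \<exists>\<delta>>0. \<forall>(n::nat) (a :: nat \<Rightarrow> real) (b :: nat \<Rightarrow> real).
        (\<forall>i<n. A \<le> a i \<and> a i \<le> b i \<and> b i \<le> B) \<longrightarrow>
        disjoint_family_on (\<lambda>i. {a i<..<b i}) {..<n} \<longrightarrow>
        (\<Sum>i<n. b i - a i) < \<delta> \<longrightarrow>
        (\<Sum>i<n. \<bar>f (b i) - f (a i)\<bar>) < \<epsilon>)"

section \<open>Half-step operators\<close>

definition half_int_plus :: "real \<Rightarrow> (real \<Rightarrow> real \<Rightarrow> real) \<Rightarrow> real \<Rightarrow> real \<Rightarrow> real" where
  "half_int_plus lam f x t =
     (1 + x) powr (-lam) *
     (LBINT u:{-1..x}. (x - u) powr (-1/2) * (1 + u) powr (lam - 1/2) * f u t)"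

definition half_int_minus :: "real \<Rightarrow> (real \<Rightarrow> real \<Rightarrow> real) \<Rightarrow> real \<Rightarrow> real \<Rightarrow> real" where
  "half_int_minus lam f x t =
     (1 - x) powr (-lam) *
     (LBINT u:{x..1}. (u - x) powr (-1/2) * (1 - u) powr (lam - 1/2) * f u t)"

definition half_step_plus :: "real \<Rightarrow> (real \<Rightarrow> real \<Rightarrow> real) \<Rightarrow> real \<Rightarrow> real \<Rightarrow> real" where
  "half_step_plus lam f x t = (1 + x) * deriv (\<lambda>y. half_int_plus lam f y t) x"

definition half_step_minus :: "real \<Rightarrow> (real \<Rightarrow> real \<Rightarrow> real) \<Rightarrow> real \<Rightarrow> real \<Rightarrow> real" where
  "half_step_minus lam f x t = (1 - x) * deriv (\<lambda>y. half_int_minus lam f y t) x"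

text \<open>
  The points at which both derivatives exist, so that the expressions above are meaningful. For
  \<open>f\<close> absolutely continuous in its first variable and \<open>lam \<ge> 0\<close>, these are almost all points of the
  interval. At each of the endpoints one of the two expressions is undefined.
\<close>

definition half_step_dom :: "real \<Rightarrow> (real \<Rightarrow> real \<Rightarrow> real) \<Rightarrow> real \<Rightarrow> real set" where
  "half_step_dom lam f t =
     {x \<in> {-1<..<1}. (\<lambda>y. half_int_plus lam f y t) field_differentiable (at x) \<and>
                     (\<lambda>y. half_int_minus lam f y t) field_differentiable (at x)}"

text \<open>
  The operator with sign \<open>\<sigma> \<in> {1, -1}\<close>. Outside \<open>half_step_dom\<close> its value is the limit along
  \<open>half_step_dom\<close>. Where that limit does not exist, \<open>Lim\<close> is arbitrary, but since
  \<open>half_step_dom\<close> is dense the resulting function is then not continuous on \<open>{-1..1} \<times> UNIV\<close>,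
  whatever the arbitrary value. Hence it is continuous there iff its restriction to the points
  where it is directly defined has a continuous extension, and it then is that extension.
\<close>

definition half_step :: "real \<Rightarrow> real \<Rightarrow> (real \<Rightarrow> real \<Rightarrow> real) \<Rightarrow> real \<Rightarrow> real \<Rightarrow> real" where
  "half_step \<sigma> lam f x t =
     (let g = (\<lambda>y. half_step_plus lam f y t + \<sigma> * half_step_minus lam f y t)
      in if x \<in> half_step_dom lam f t then g x
         else Lim (at x within half_step_dom lam f t) g)"

end

theory Submission
  imports Defs
begin

text \<open>
Let \<open>W\<^sub>n\<close> be the Gegenbauer polynomials of index \<open>lam = (d - 1) / 2\<close>, normalised by \<open>W\<^sub>n(1) = 1\<close>, and
\<open>V\<^sub>n\<close> those of index \<open>lam + 1/2\<close>. They are the zonal harmonics of \<open>S\<^sup>d\<close> and of \<open>S\<^sup>d\<^sup>+\<^sup>1\<close>. By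
Schoenberg's principle a continuous function of \<open>\<langle>\<xi>,\<eta>\<rangle>\<close> and \<open>s - t\<close> is positive definite on
sphere times line iff each of its Gegenbauer coefficients is a positive definite function of \<open>t\<close>.
The two half-step operators are combined so that they are diagonal in these bases: the sum sends
\<open>W\<^sub>n\<close> to a nonnegative multiple of \<open>V\<^sub>n\<^sub>-\<^sub>1\<close> and the difference sends \<open>W\<^sub>n\<close> to a nonnegative multiple
of \<open>V\<^sub>n\<close>. Every \<open>V\<close>-coefficient of the derivative of \<open>f\<close> is then a nonnegative multiple of one
\<open>W\<close>-coefficient of \<open>f\<close>, which gives the theorem. Three facts carry this.

\<^item> The coefficients of a positive definite function are positive definite (\<open>coefficient_psd\<close>).
  Instead of integrating over the sphere, the proof peels off one coordinate at a time: a point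
  of \<open>S\<^sup>d\<^sup>+\<^sup>1\<close> is \<open>(x, sqrt (1 - x\<^sup>2) \<zeta>)\<close> with \<open>\<zeta>\<close> on \<open>S\<^sup>d\<close>, the mean over \<open>\<zeta>\<close> is positive semidefinite
  by induction, and the product formula for Gegenbauer polynomials evaluates the remaining double
  integral over the two heights.

\<^item> The coefficients of the half-step derivatives are as described
  (\<open>half_step_gegenbauer_coefficient\<close>). After integration by parts, a coefficient of the
  derivative of \<open>f\<close> depends on \<open>f\<close> continuously in the uniform norm, so by Weierstrass it is
  enough to take powers of \<open>1 + x\<close>, where all integrals are Beta integrals. Absolute continuity
  is what makes the integration by parts possible: it writes \<open>f\<close> as a difference of monotone
  continuous functions, hence the half-order integral of \<open>f\<close> as a superposition of explicit
  kernels against Stieltjes measures, and this superposition can be differentiated at almost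
  every point.

\<^item> A continuous function whose coefficients are positive definite in \<open>t\<close> is positive definite
  (\<open>gegenbauer_inversion\<close>). Nonnegative coefficients of a bounded function are summable after
  normalisation (\<open>nonneg_coefficients_summable\<close>), so the Gegenbauer series converges uniformly and
  represents the function, and each term is a product of two positive semidefinite kernels.

Both the product formula and the positive semidefiniteness of the zonal harmonics come from the
addition theorem \<open>gegenbauer_addition\<close>, which is proved by induction on the degree from
three-term recurrences.
\<close>

section \<open>Gegenbauer polynomials\<close>

text \<open>
The index \<open>l = 0\<close> gives the Chebyshev polynomials, which the usual normalisation of Gegenbauer
polynomials loses: all of them take the value 1 at 1.
\<close>

fun gegenbauer :: "real \<Rightarrow> nat \<Rightarrow> real \<Rightarrow> real" where
  "gegenbauer l 0 x = 1"
| "gegenbauer l (Suc 0) x = x"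
| "gegenbauer l (Suc (Suc n)) x =
     (2 * (real n + 1 + l) * x * gegenbauer l (Suc n) x - (real n + 1) * gegenbauer l n x) / (real n + 1 + 2 * l)"

lemma gegenbauer_recurrence:
  assumes "l \<ge> 0"
  shows "(real n + 2 * l) * gegenbauer l (Suc n) x =
      2 * (real n + l) * x * gegenbauer l n x - real n * gegenbauer l (n - 1) x"
proof (cases n)
  case 0 then show ?thesis by simp
next
  case (Suc m)
  have "real m + 1 + 2 * l \<noteq> 0" using assms by linarith
  then have "(real m + 1 + 2 * l) * gegenbauer l (Suc (Suc m)) x =
      2 * (real m + 1 + l) * x * gegenbauer l (Suc m) x - (real m + 1) * gegenbauer l m x"
    by simp
  then show ?thesis unfolding Suc by (simp only: of_nat_Suc diff_Suc_1 add.commute[of 1])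
qed

text \<open>
The contiguous relations \<open>gegenbauer_lower_index_mixed\<close>, \<open>gegenbauer_raise\<close> and \<open>gegenbauer_lower\<close> follow
by algebra from this one and \<open>gegenbauer_recurrence\<close>.
\<close>

lemma gegenbauer_raise_index:
  assumes "l \<ge> 0"
  shows "(2 * l + 1) * gegenbauer l n x = (real n + 2 * l + 1) * gegenbauer (l + 1) n x - real n * x *
      gegenbauer (l + 1) (n - 1) x"
  using assms
proof (induction l n x rule: gegenbauer.induct)
  case (3 l n x)
  define G where "G = gegenbauer l"
  define U where "U = gegenbauer (l + 1)"
  have r0: "real n * U (n - 1) x = 2 * (real n + (l + 1)) * x * U n x - (real n + 2 * (l + 1)) * U (Suc n) x"
    using gegenbauer_recurrence[of "l + 1" n x] 3 by (simp add: U_def)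
  have r1: "(real n + 1 + 2 * (l + 1)) * U (Suc (Suc n)) x =
      2 * (real n + 1 + (l + 1)) * x * U (Suc n) x - (real n + 1) * U n x"
    using gegenbauer_recurrence[of "l + 1" "Suc n" x] 3 by (simp add: U_def algebra_simps)
  have g: "(real n + 1 + 2 * l) * G (Suc (Suc n)) x =
      2 * (real n + 1 + l) * x * G (Suc n) x - (real n + 1) * G n x"
    using gegenbauer_recurrence[of "l" "Suc n" x] 3 by (simp add: G_def algebra_simps)
  have i1: "(2 * l + 1) * G (Suc n) x = (real n + 2 * l + 2) * U (Suc n) x - (real n + 1) * x * U n x"
    using 3 by (simp add: G_def U_def algebra_simps)
  have i0: "(2 * l + 1) * G n x = (real n + 2 * l + 1) * U n x - real n * U (n - 1) x * x"
    using 3 by (simp add: G_def U_def algebra_simps)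
  have "(real n + 1 + 2 * l) * ((2 * l + 1) * G (Suc (Suc n)) x) =
      2 * (real n + 1 + l) * x * ((2 * l + 1) * G (Suc n) x) - (real n + 1) * ((2 * l + 1) * G n x)"
    using g by algebra
  also have "\<dots> = (real n + 1 + 2 * l) * ((real n + 1 + 2 * (l + 1)) * U (Suc (Suc n)) x - (real n + 2) * x *
      U (Suc n) x)"
    unfolding i1 i0 r0 r1 by algebra
  finally have "(2 * l + 1) * G (Suc (Suc n)) x =
      (real n + 1 + 2 * (l + 1)) * U (Suc (Suc n)) x - (real n + 2) * x * U (Suc n) x"
    using 3(3) by simp
  moreover have "real (Suc (Suc n)) + 2 * l + 1 = real n + 1 + 2 * (l + 1)" "real (Suc (Suc n)) = real n + 2"
    by simp_all
  ultimately show ?case unfolding G_def U_def by (simp only: diff_Suc_1)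
qed (simp_all add: algebra_simps)

lemma gegenbauer_lower_index_mixed:
  assumes "l \<ge> 0"
  shows "real n * (1 - x\<^sup>2) * gegenbauer (l + 1) (n - 1) x =
      (2 * l + 1) * (x * gegenbauer l n x - gegenbauer l (Suc n) x)"
proof -
  have 1: "(2 * l + 1) * gegenbauer l n x = (real n + 2 * l + 1) * gegenbauer (l + 1) n x - real n * x *
      gegenbauer (l + 1) (n - 1) x"
    and 2: "(2 * l + 1) * gegenbauer l (Suc n) x =
        (real n + 2 * l + 2) * gegenbauer (l + 1) (Suc n) x - (real n + 1) * x * gegenbauer (l + 1) n x"
    using gegenbauer_raise_index[OF assms, of n x] gegenbauer_raise_index[OF assms, of "Suc n" x]
        by (simp_all add: algebra_simps)
  have 3: "(real n + 2 * l + 2) * gegenbauer (l + 1) (Suc n) x =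
      2 * (real n + (l + 1)) * x * gegenbauer (l + 1) n x - real n * gegenbauer (l + 1) (n - 1) x"
    using gegenbauer_recurrence[of "l + 1" n x] assms by (simp add: algebra_simps)
  show ?thesis using 1 2 3 by algebra
qed

text \<open>
In terms of the functions \<open>assoc_gegenbauer\<close>, this relation multiplies by \<open>sqrt (1 - x\<^sup>2)\<close> while the
order goes up, and \<open>gegenbauer_lower\<close> does so while the order goes down.
\<close>

lemma gegenbauer_raise:
  assumes "l \<ge> 0"
  shows "2 * (real n + l) * (2 * l + 1) * gegenbauer l n x =
    (real n + 2 * l) * (real n + 2 * l + 1) * gegenbauer (l + 1) n x - real n * (real n - 1) * gegenbauer (l +
        1) (n - 2) x"
proof (cases n)
  case (Suc m)
  have 3: "(real m + 2 * l + 2) * gegenbauer (l + 1) n x =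
      2 * (real m + (l + 1)) * x * gegenbauer (l + 1) m x - real m * gegenbauer (l + 1) (m - 1) x"
    using gegenbauer_recurrence[of "l + 1" m x] assms Suc by (simp add: algebra_simps)
  have 1: "(2 * l + 1) * gegenbauer l n x = (real m + 2 * l + 2) * gegenbauer (l + 1) n x - (real m + 1) * x *
      gegenbauer (l + 1) m x"
    using gegenbauer_raise_index[OF assms, of n x] Suc by (simp add: algebra_simps)
  have 4: "real n = real m + 1" "n - 2 = m - 1" using Suc by auto
  show ?thesis unfolding 4 using 1 3 by algebra
qed (use assms in simp)

lemma gegenbauer_lower:
  assumes "l \<ge> 0"
  shows "2 * (real n + l + 1) * ((1 - x\<^sup>2) * gegenbauer (l + 1) n x) =
      (2 * l + 1) * (gegenbauer l n x - gegenbauer l (Suc (Suc n)) x)"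
proof -
  have 1: "(real n + 1) * ((1 - x\<^sup>2) * gegenbauer (l + 1) n x) =
      (2 * l + 1) * (x * gegenbauer l (Suc n) x - gegenbauer l (Suc (Suc n)) x)"
    using gegenbauer_lower_index_mixed[OF assms, of "Suc n" x] by (simp add: algebra_simps)
  have 2: "(real n + 1 + 2 * l) * gegenbauer l (Suc (Suc n)) x =
      2 * (real n + 1 + l) * x * gegenbauer l (Suc n) x - (real n + 1) * gegenbauer l n x"
    using gegenbauer_recurrence[of l "Suc n" x] assms by (simp add: algebra_simps)
  have "(real n + 1) * (2 * (real n + l + 1) * ((1 - x\<^sup>2) * gegenbauer (l + 1) n x)) =
     (real n + 1) * ((2 * l + 1) * (gegenbauer l n x - gegenbauer l (Suc (Suc n)) x))"
    using 1 2 by algebra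
  then show ?thesis by simp
qed

lemma gegenbauer_has_derivative:
  assumes "l \<ge> 0"
  shows "(gegenbauer l n has_field_derivative (real n * (real n + 2 * l) / (2 * l + 1) * gegenbauer (l + 1) (n -
      1) x)) (at x)"
  using assms
proof (induction l n x rule: gegenbauer.induct)
  case (1 l x)
  have "gegenbauer l 0 = (\<lambda>x. 1)" by (rule ext) simp
  then show ?case by simp
next
  case (2 l x)
  have [simp]: "gegenbauer l (Suc 0) = (\<lambda>x. x)" by (rule ext) simp
  have "2 * l + 1 \<noteq> 0" using 2 by linarith
  then show ?case by (auto intro!: derivative_eq_intros simp: field_simps)
next
  case (3 l n x)
  have ne: "2 * l + 1 \<noteq> 0" "real n + 1 + 2 * l \<noteq> 0" using 3 by linarith+
  define U where "U = gegenbauer (l + 1)"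
  define D1 where "D1 = real (Suc n) * (real (Suc n) + 2 * l) / (2 * l + 1) * gegenbauer (l + 1) (Suc n - 1) x"
  define D0 where "D0 = real n * (real n + 2 * l) / (2 * l + 1) * gegenbauer (l + 1) (n - 1) x"
  define D2 where "D2 = real (Suc (Suc n)) * (real (Suc (Suc n)) + 2 * l) / (2 * l + 1) * gegenbauer (l +
      1) (Suc (Suc n) - 1) x"
  have d1: "(2 * l + 1) * D1 = (real n + 1) * (real n + 1 + 2 * l) * U n x"
    and d0: "(2 * l + 1) * D0 = real n * (real n + 2 * l) * U (n - 1) x"
    and d2: "(2 * l + 1) * D2 = (real n + 2) * (real n + 2 + 2 * l) * U (Suc n) x"
    unfolding D1_def D0_def D2_def U_def using ne by (simp_all add: add_ac)
  have g: "2 * (real n + 1 + l) * (2 * l + 1) * gegenbauer l (Suc n) x =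
    (real n + 1 + 2 * l) * (real n + 1 + 2 * l + 1) * U (Suc n) x - (real n + 1) * real n * U (n - 1) x"
    using gegenbauer_raise[OF 3(3), of "Suc n" x] by (simp add: U_def algebra_simps)
  have r: "(real n + 2 * l + 2) * U (Suc n) x = 2 * (real n + (l + 1)) * x * U n x - real n * U (n - 1) x"
    using gegenbauer_recurrence[of "l + 1" n x] 3(3) by (simp add: algebra_simps U_def)
  have "((2 * l + 1) * (real n + 1 + 2 * l)) * D2 =
      2 * (real n + 1 + l) * ((2 * l + 1) * gegenbauer l (Suc n) x + x * ((2 * l + 1) * D1)) - (real n + 1) * ((2 *
          l + 1) * D0)"
    using g r d1 d0 d2 by algebra
  also have "\<dots> = (2 * l + 1) * (2 * (real n + 1 + l) * (gegenbauer l (Suc n) x + x * D1) - (real n + 1) * D0)"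
    by algebra
  finally have "(real n + 1 + 2 * l) * D2 =
      (2 * (real n + 1 + l) * (gegenbauer l (Suc n) x + x * D1) - (real n + 1) * D0)"
    using ne by simp
  then have eq: "D2 = (2 * (real n + 1 + l) * (gegenbauer l (Suc n) x + x * D1) - (real n + 1) * D0) / (real n +
      1 + 2 * l)"
    using ne by (simp add: field_simps)
  have [derivative_intros]: "(gegenbauer l (Suc n) has_field_derivative D1) (at x)" "(gegenbauer l n
      has_field_derivative D0) (at x)"
    unfolding D1_def D0_def by (fact "3.IH"[OF "3.prems"])+
  have "((\<lambda>x. 2 * (real n + 1 + l) * x * gegenbauer l (Suc n) x - (real n + 1) *
      gegenbauer l n x) has_field_derivative
      2 * (real n + 1 + l) * (gegenbauer l (Suc n) x + x * D1) - (real n + 1) * D0) (at x)"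
    by (auto intro!: derivative_eq_intros simp: algebra_simps)
  from DERIV_cdivide[OF this, of "real n + 1 + 2 * l"]
  have "((\<lambda>x. gegenbauer l (Suc (Suc n)) x) has_field_derivative
      (2 * (real n + 1 + l) * (gegenbauer l (Suc n) x + x * D1) - (real n + 1) * D0) / (real n + 1 + 2 *
          l)) (at x)"
    by simp
  then show ?case using eq unfolding D2_def by simp
qed

lemma gegenbauer_at_1: "l \<ge> 0 \<Longrightarrow> gegenbauer l n 1 = 1"
  by (induction l n "1::real" rule: gegenbauer.induct) (auto simp: divide_simps)

lemma gegenbauer_minus: "gegenbauer l n (- x) = (-1) ^ n * gegenbauer l n x"
  by (induction l n x rule: gegenbauer.induct) (auto simp: algebra_simps diff_divide_distrib add_divide_distrib)

lemma continuous_on_gegenbauer [continuous_intros]: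
  "continuous_on S f \<Longrightarrow> continuous_on S (\<lambda>x. gegenbauer l n (f x))"
proof (induction l n "0::real" rule: gegenbauer.induct)
  case (3 l n)
  then show ?case by (auto intro!: continuous_intros simp: divide_inverse)
qed auto

section \<open>The addition theorem\<close>

text \<open>
The numbers \<open>addition_up a k\<close> and \<open>addition_down a k\<close> are the coefficients in the expansion of
\<open>z W\<^sub>k(z)\<close> by \<open>W\<^sub>k\<^sub>+\<^sub>1(z)\<close> and \<open>W\<^sub>k\<^sub>-\<^sub>1(z)\<close> for Gegenbauer polynomials of index \<open>a / 2\<close>. The values at
\<open>k = 0\<close> are given separately because the quotient is undefined there for \<open>a = 0\<close>.
\<close>

fun addition_up :: "real \<Rightarrow> nat \<Rightarrow> real" where
  "addition_up a k = (if k = 0 then 1 else (real k + a) / (2 * real k + a))"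

fun addition_down :: "real \<Rightarrow> nat \<Rightarrow> real" where
  "addition_down a k = (if k = 0 then 0 else real k / (2 * real k + a))"

declare addition_up.simps [simp del] addition_down.simps [simp del]

fun addition_scale :: "real \<Rightarrow> nat \<Rightarrow> real" where
  "addition_scale a 0 = 1"
| "addition_scale a (Suc k) = addition_scale a k * addition_up a k / (2 * real k + a + 2)"

text \<open>
The coefficients of the addition theorem. That they are nonnegative is what makes zonal harmonics
positive semidefinite.
\<close>

definition addition_coeff :: "real \<Rightarrow> nat \<Rightarrow> nat \<Rightarrow> real" where
  "addition_coeff l n k = real (n choose k) * pochhammer (real n + 2 * l) k * addition_scale (2 * l - 1) k"

text \<open>
Up to a factor, the associated Legendre function of degree \<open>n\<close> and order \<open>k\<close>: the dependence on
the height \<open>x\<close> of a spherical harmonic. It is meant for \<open>k \<le> n\<close>; otherwise it is always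
multiplied by \<open>addition_coeff l n k = 0\<close>.
\<close>

definition assoc_gegenbauer :: "real \<Rightarrow> nat \<Rightarrow> nat \<Rightarrow> real \<Rightarrow> real" where
  "assoc_gegenbauer l n k x = sqrt (1 - x\<^sup>2) ^ k * gegenbauer (l + real k) (n - k) x"

lemma addition_scale_nonneg:
  assumes "a \<ge> -1"
  shows "addition_scale a k \<ge> 0"
proof (induction k)
  case (Suc k)
  have "addition_up a k \<ge> 0" using assms by (cases "k = 0") (auto simp: addition_up.simps
      intro!: divide_nonneg_nonneg)
  then show ?case using Suc assms by (auto intro!: divide_nonneg_nonneg mult_nonneg_nonneg)
qed simp

lemma addition_coeff_nonneg:
  assumes "l \<ge> 0"
  shows "addition_coeff l n k \<ge> 0"
  unfolding addition_coeff_def pochhammer_prod using assms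
  by (intro mult_nonneg_nonneg addition_scale_nonneg prod_nonneg) auto

lemma addition_coeff_eq_0: "k > n \<Longrightarrow> addition_coeff l n k = 0"
  by (simp add: addition_coeff_def)

lemma addition_coeff_0 [simp]: "addition_coeff l n 0 = 1"
  by (simp add: addition_coeff_def)

lemma addition_coeff_Suc_right:
  assumes "l \<ge> 0"
  shows "addition_coeff l n (Suc k) * (real k + 1) * (2 * l + 2 * real k + 1) =
    addition_coeff l n k * (real n - real k) * (real n + 2 * l + real k) * addition_up (2 * l - 1) k"
proof -
  have ch: "real (n choose Suc k) * (real k + 1) = real (n choose k) * (real n - real k)"
  proof (cases "k \<le> n")
    case True
    have "Suc k * (n choose Suc k) = (n - k) * (n choose k)"
      using binomial_absorb_comp[of n k] binomial_absorption[of k n] by (cases n) auto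
    then have "real (Suc k * (n choose Suc k)) = real ((n - k) * (n choose k))" by simp
    then show ?thesis using True by (simp add: of_nat_diff algebra_simps)
  qed (simp add: binomial_eq_0)
  have d: "2 * l + 2 * real k + 1 \<noteq> 0" using assms by linarith
  have d': "2 * real k + (2 * l - 1) + 2 = 2 * l + 2 * real k + 1" by simp
  have e: "addition_scale (2 * l - 1) (Suc k) * (2 * l + 2 * real k + 1) =
      addition_scale (2 * l - 1) k * addition_up (2 * l - 1) k"
    unfolding addition_scale.simps d' using d by simp
  show ?thesis unfolding addition_coeff_def pochhammer_Suc using ch e by algebra
qed

lemma addition_coeff_Suc_left:
  assumes "l \<ge> 0"
  shows "addition_coeff l (Suc n) k * (real n + 1 - real k) * (real n + 2 * l) =
    addition_coeff l n k * (real n + 1) * (real n + 2 * l + real k)"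
proof -
  have ch: "real (Suc n choose k) * (real n + 1 - real k) = real (n choose k) * (real n + 1)"
  proof (cases "k \<le> Suc n")
    case True
    have "(Suc n - k) * (Suc n choose k) = Suc n * (n choose k)"
      by (metis binomial_absorb_comp diff_Suc_1)
    then have "real ((Suc n - k) * (Suc n choose k)) = real (Suc n * (n choose k))" by simp
    then show ?thesis using True by (simp only: of_nat_mult of_nat_diff of_nat_Suc) (simp add: algebra_simps)
  qed (simp add: binomial_eq_0)
  have "pochhammer (real n + 2 * l) (Suc k) = (real n + 2 * l) * pochhammer (real n + 2 * l + 1) k"
    by (rule pochhammer_rec)
  then have p: "pochhammer (real (Suc n) + 2 * l) k * (real n + 2 * l) =
      pochhammer (real n + 2 * l) k * (real n + 2 * l + real k)"
    by (simp add: pochhammer_Suc algebra_simps)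
  show ?thesis unfolding addition_coeff_def using ch p by algebra
qed

lemma assoc_gegenbauer_mult_x:
  assumes "l \<ge> 0" "k \<le> n"
  shows "2 * (real n + l) * (x * assoc_gegenbauer l n k x) =
    (real n + real k + 2 * l) * assoc_gegenbauer l (Suc n) k x + (real n - real k) * assoc_gegenbauer l (n -
        1) k x"
proof -
  have 1: "(real (n - k) + 2 * (l + k)) * gegenbauer (l + k) (Suc (n - k)) x =
     2 * (real (n - k) + (l + k)) * x * gegenbauer (l + k) (n - k) x - real (n - k) * gegenbauer (l + k) (n - k -
         1) x"
    by (rule gegenbauer_recurrence) (use assms in auto)
  have 2: "Suc n - k = Suc (n - k)" "n - 1 - k = n - k - 1" "real (n - k) = real n - real k"
    using assms by (auto simp: of_nat_diff)
  define S where "S = sqrt (1 - x\<^sup>2) ^ k"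
  show ?thesis using 1 unfolding assoc_gegenbauer_def 2 S_def[symmetric] by algebra
qed

lemma assoc_gegenbauer_raise:
  assumes "l \<ge> 0" "k \<le> n"
  shows "2 * (real n + l) * (2 * l + 2 * real k + 1) * (sqrt (1 - x\<^sup>2) * assoc_gegenbauer l n k x) =
    (real n + real k + 2 * l) * (real n + real k + 2 * l + 1) * assoc_gegenbauer l (Suc n) (Suc k) x
     - (real n - real k) * (real n - real k - 1) * assoc_gegenbauer l (n - 1) (Suc k) x"
proof -
  have 1: "2 * (real (n - k) + (l + k)) * (2 * (l + k) + 1) * gegenbauer (l + k) (n - k) x =
     (real (n - k) + 2 * (l + k)) * (real (n - k) + 2 * (l + k) + 1) * gegenbauer (l + k + 1) (n - k) x
      - real (n - k) * (real (n - k) - 1) * gegenbauer (l + k + 1) (n - k - 2) x"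
    by (rule gegenbauer_raise) (use assms in auto)
  have 2: "Suc n - Suc k = n - k" "n - 1 - Suc k = n - k - 2" "real (n - k) = real n - real k" "l + real (Suc k) =
      l + k + 1"
    using assms by (auto simp: of_nat_diff)
  define r where "r = sqrt (1 - x\<^sup>2)"
  define S where "S = r ^ k"
  show ?thesis using 1 unfolding assoc_gegenbauer_def 2 power_Suc r_def[symmetric] S_def[symmetric] by algebra
qed

lemma assoc_gegenbauer_lower:
  assumes "l \<ge> 0" "Suc k \<le> n" "\<bar>x\<bar> \<le> 1"
  shows "2 * (real n + l) * (sqrt (1 - x\<^sup>2) * assoc_gegenbauer l n (Suc k) x) =
    (2 * l + 2 * real k + 1) * (assoc_gegenbauer l (n - 1) k x - assoc_gegenbauer l (Suc n) k x)"
proof -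
  obtain j where n: "n = Suc (j + k)" using assms(2) by (metis add.commute le_iff_add add_Suc)
  have 1: "2 * (real j + (l + k) + 1) * ((1 - x\<^sup>2) * gegenbauer (l + k + 1) j x) =
     (2 * (l + k) + 1) * (gegenbauer (l + k) j x - gegenbauer (l + k) (Suc (Suc j)) x)"
    by (rule gegenbauer_lower) (use assms in auto)
  have 2: "n - Suc k = j" "n - 1 - k = j" "Suc n - k = Suc (Suc j)" "l + real (Suc k) = l + k + 1" "real n =
      real j + real k + 1"
    using n by auto
  have s: "sqrt (1 - x\<^sup>2) * sqrt (1 - x\<^sup>2) = 1 - x\<^sup>2"
    using assms(3) by (simp add: abs_square_le_1)
  define r where "r = sqrt (1 - x\<^sup>2)"
  define S where "S = r ^ k"
  show ?thesis using 1 s unfolding assoc_gegenbauer_def 2 power_Suc r_def[symmetric] S_def[symmetric] by algebra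
qed

text \<open>
The induction step of the addition theorem, one coefficient at a time: the products
\<open>assoc_gegenbauer l n k x * assoc_gegenbauer l n k y\<close>, weighted by the addition coefficients,
satisfy the same three-term recurrence in \<open>n\<close> as the Gegenbauer polynomials at
\<open>x y + s t \<zeta>\<close>. Multiplication by \<open>x y\<close> keeps the order \<open>k\<close>; multiplication by \<open>s t \<zeta>\<close> moves it by
one, upwards with factor \<open>u\<close> and downwards with factor \<open>v\<close>. Everything is expanded in the four
products of degrees \<open>n + 1\<close> and \<open>n - 1\<close> in \<open>x\<close> and \<open>y\<close>; the two mixed products cancel.
\<close>

lemma assoc_gegenbauer_product_step:
  fixes l x y :: real and n :: nat
  defines "F \<equiv> \<lambda>n k. addition_coeff l n k * assoc_gegenbauer l n k x * assoc_gegenbauer l n k y"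
  defines "s \<equiv> sqrt (1 - x\<^sup>2)" and "t \<equiv> sqrt (1 - y\<^sup>2)"
  defines "u \<equiv> addition_up (2 * l - 1)" and "v \<equiv> addition_down (2 * l - 1)"
  assumes l: "l \<ge> 0" and x: "\<bar>x\<bar> \<le> 1" and y: "\<bar>y\<bar> \<le> 1" and n: "n \<ge> 1"
  shows "2 * (real n + l) * (x * y * F n k + s * t * ((if k =
      0 then 0 else F n (k - 1) * u (k - 1)) + F n (Suc k) * v (Suc k)))
     = (real n + 2 * l) * F (Suc n) k + real n * F (n - 1) k"
proof -
  define M where "M = 2 * (real n + l)"
  have M: "M > 0" using l n by (simp add: M_def)
  define C where "C = addition_coeff l n k"
  \<comment> \<open>the basis in which all terms are expanded\<close>
  define p1 p0 q1 q0 where "p1 = assoc_gegenbauer l (Suc n) k x" and "p0 = assoc_gegenbauer l (n - 1) k x"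
    and "q1 = assoc_gegenbauer l (Suc n) k y" and "q0 = assoc_gegenbauer l (n - 1) k y"
  define A where "A = M\<^sup>2 * (x * y * F n k)"
  define B where "B = M\<^sup>2 * (s * t * (if k = 0 then 0 else F n (k - 1) * u (k - 1)))"
  define D where "D = M\<^sup>2 * (s * t * (F n (Suc k) * v (Suc k)))"
  define E where "E = M * ((real n + 2 * l) * F (Suc n) k + real n * F (n - 1) k)"
  have A: "A = C * (((real n + real k + 2 * l) * p1 + (real n - real k) * p0) *
                    ((real n + real k + 2 * l) * q1 + (real n - real k) * q0))" if "k \<le> n"
  proof -
    have "A = C * ((M * (x * assoc_gegenbauer l n k x)) * (M * (y * assoc_gegenbauer l n k y)))"
      by (simp add: A_def F_def C_def power2_eq_square)
    then show ?thesis
      using assoc_gegenbauer_mult_x[OF l that, of x] assoc_gegenbauer_mult_x[OF l that, of y]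
      by (simp add: M_def p1_def p0_def q1_def q0_def)
  qed
  have A0: "A = 0" if "k > n" using that by (simp add: A_def F_def addition_coeff_eq_0)
  have D: "D = C * (real n - real k) * (real n + 2 * l + real k) * u k * ((p0 - p1) * (q0 - q1))" if "k \<le> n"
  proof (cases "k = n")
    case True then show ?thesis by (simp add: D_def F_def addition_coeff_eq_0)
  next
    case False
    then have k: "Suc k \<le> n" using that by simp
    have ne: "2 * l + 2 * real k + 1 \<noteq> 0" using l by linarith
    have v: "v (Suc k) * (2 * l + 2 * real k + 1) = real k + 1"
      using ne by (simp add: v_def addition_down.simps field_simps)
    have c: "addition_coeff l n (Suc k) * (real k + 1) * (2 * l + 2 * real k + 1) =
      C * (real n - real k) * (real n + 2 * l + real k) * u k"
      unfolding C_def u_def by (rule addition_coeff_Suc_right[OF l])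
    have "D = addition_coeff l n (Suc k) * v (Suc k) * ((M * (s * assoc_gegenbauer l n (Suc k) x)) * (M * (t *
        assoc_gegenbauer l n (Suc k) y)))"
      by (simp add: D_def F_def power2_eq_square)
    also have "\<dots> = addition_coeff l n (Suc k) * v (Suc k) * (2 * l + 2 * real k + 1)\<^sup>2 * ((p0 - p1) * (q0 - q1))"
      using assoc_gegenbauer_lower[OF l k x] assoc_gegenbauer_lower[OF l k y]
      by (simp add: M_def s_def t_def p1_def p0_def q1_def q0_def power2_eq_square)
    also have "\<dots> = C * (real n - real k) * (real n + 2 * l + real k) * u k * ((p0 - p1) * (q0 - q1))"
      using v c by algebra
    finally show ?thesis .
  qed
  have B: "(2 * l + 2 * real k - 1)\<^sup>2 * B = addition_coeff l n (k - 1) * u (k - 1) *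
       (((real n + real k - 1 + 2 * l) * (real n + real k + 2 * l) * p1 - (real n - real k + 1) * (real n -
           real k) * p0) *
        ((real n + real k - 1 + 2 * l) * (real n + real k + 2 * l) * q1 - (real n - real k + 1) * (real n -
            real k) * q0))"
    if k: "k \<ge> 1" "k \<le> Suc n"
  proof -
    obtain j where j: "k = Suc j" using k by (metis Suc_le_D One_nat_def)
    have jn: "j \<le> n" using k j by simp
    have "(2 * l + 2 * real k - 1)\<^sup>2 * B = addition_coeff l n j * u j *
       ((M * (2 * l + 2 * real j + 1) * (s * assoc_gegenbauer l n j x)) * (M * (2 * l + 2 * real j + 1) * (t *
           assoc_gegenbauer l n j y)))"
      unfolding B_def j F_def by simp algebra
    moreover have "M * (2 * l + 2 * real j + 1) * (s * assoc_gegenbauer l n j x) =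
        (real n + real j + 2 * l) * (real n + real j + 2 * l + 1) * p1 - (real n - real j) * (real n - real j -
            1) * p0"
      using assoc_gegenbauer_raise[OF l jn, of x] by (simp only: M_def s_def p1_def p0_def j)
    moreover have "M * (2 * l + 2 * real j + 1) * (t * assoc_gegenbauer l n j y) =
        (real n + real j + 2 * l) * (real n + real j + 2 * l + 1) * q1 - (real n - real j) * (real n - real j -
            1) * q0"
      using assoc_gegenbauer_raise[OF l jn, of y] by (simp only: M_def t_def q1_def q0_def j)
    moreover have "real n + real k - 1 + 2 * l = real n + real j + 2 * l"
      "real n + real k + 2 * l = real n + real j + 2 * l + 1"
      "real n - real k + 1 = real n - real j" "real n - real k = real n - real j - 1" "k - 1 = j"
      by (simp_all add: j)
    ultimately show ?thesis by (simp only:)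
  qed
  have E: "E = M * ((real n + 2 * l) * (addition_coeff l (Suc n) k * p1 * q1) + real n * (addition_coeff l (n -
      1) k * p0 * q0))"
    by (simp add: E_def F_def p1_def p0_def q1_def q0_def)
  have e1: "addition_coeff l (Suc n) k * (real n + 1 - real k) * (real n + 2 * l) =
      C * (real n + 1) * (real n + 2 * l + real k)"
    unfolding C_def by (rule addition_coeff_Suc_left[OF l])
  have e0: "C * (real n - real k) * (real n - 1 + 2 * l) =
      addition_coeff l (n - 1) k * real n * (real n - 1 + 2 * l + real k)"
    using addition_coeff_Suc_left[OF l, of "n - 1" k] n by (simp add: C_def of_nat_diff)
  \<comment> \<open>at the two ends of the range some of the neighbouring terms are missing\<close>
  consider "k = 0" | "1 \<le> k" "k \<le> n" | "k = Suc n" | "k > Suc n" by linarith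
  then have main: "A + B + D = E"
  proof cases
    case 1
    have "B = 0" using 1 by (simp add: B_def)
    moreover have "C = 1" "u k = 1" "addition_coeff l (Suc n) k = 1" "addition_coeff l (n - 1) k = 1"
      using 1 by (simp_all add: C_def u_def addition_up.simps)
    moreover have "((real n + 2 * l) * p1 + real n * p0) * ((real n + 2 * l) * q1 + real n * q0) +
        real n * (real n + 2 * l) * ((p0 - p1) * (q0 - q1)) =
        (2 * real n + 2 * l) * ((real n + 2 * l) * (p1 * q1) + real n * (p0 * q0))"
      by algebra
    ultimately show ?thesis using A D 1 unfolding E M_def by simp
  next
    case 2
    define w g h where "w = 2 * l + 2 * real k - 1" and "g = real n + 2 * l + real k - 1"
        and "h = real n - real k + 1"
    have pos: "w > 0" "g > 0" "h > 0" using 2 l by (auto simp: w_def g_def h_def)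
    define c1 where "c1 = addition_coeff l n (k - 1) * u (k - 1)"
    have c1: "C * real k * w = c1 * h * g"
      using addition_coeff_Suc_right[OF l, of n "k - 1"] 2
      by (simp add: C_def c1_def u_def w_def h_def g_def of_nat_diff algebra_simps)
    have ww: "2 * l + 2 * real k - 1 = w" by (simp add: w_def)
    have gg: "real n + real k - 1 + 2 * l = g" "real n + real k + 2 * l = g + 1" "real n + 2 * l + real k = g + 1"
      "real n - 1 + 2 * l + real k = g" by (simp_all add: g_def)
    have hh: "real n - real k = h - 1" "real n + 1 - real k = h" by (simp_all add: h_def)
    have u: "w * u k = real k + 2 * l - 1"
      using pos 2 by (simp add: u_def addition_up.simps w_def field_simps)
    have b: "w\<^sup>2 * B = c1 * ((g * (g + 1) * p1 - h * (h - 1) * p0) * (g * (g + 1) * q1 - h * (h - 1) * q0))"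
      using B 2 unfolding ww gg hh c1_def by simp
    have "w * (w * h * g * B) = h * g * (w\<^sup>2 * B)" by (simp add: power2_eq_square)
    also have "\<dots> = w * (C * real k * ((g * (g + 1) * p1 - h * (h - 1) * p0) * (g * (g + 1) * q1 - h * (h - 1) *
        q0)))"
      unfolding b using c1 by algebra
    finally have b': "w * h * g * B = C * real k * ((g * (g + 1) * p1 - h * (h - 1) * p0) * (g * (g + 1) * q1 - h *
        (h - 1) * q0))"
      using pos by simp
    have d': "w * h * g * D = h * g * C * (h - 1) * (g + 1) * (real k + 2 * l - 1) * ((p0 - p1) * (q0 - q1))"
      using D 2 u unfolding gg hh by algebra
    have e1': "addition_coeff l (Suc n) k * h * (real n + 2 * l) = C * (real n + 1) * (g + 1)"
      and e0': "C * (h - 1) * (real n - 1 + 2 * l) = addition_coeff l (n - 1) k * real n * g"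
      using e1 e0 unfolding gg hh by auto
    have e': "w * h * g * E = M * C * (w * g * (real n + 1) * (g + 1) * (p1 * q1) + w * h * (h - 1) * (real n - 1 +
        2 * l) * (p0 * q0))"
      unfolding E using e1' e0' by algebra
    have i11: "w * h * (g + 1) + real k * g * (g + 1) + h * (h - 1) * (real k + 2 * l - 1) = M * w * (real n + 1)"
      unfolding w_def h_def g_def M_def by algebra
    have i00: "w * g * (h - 1) + real k * h * (h - 1) + g * (g + 1) * (real k + 2 * l - 1) =
        M * w * (real n - 1 + 2 * l)"
      unfolding w_def h_def g_def M_def by algebra
    have i10: "w = real k + (real k + 2 * l - 1)" by (simp add: w_def)
    have a': "A = C * (((g + 1) * p1 + (h - 1) * p0) * ((g + 1) * q1 + (h - 1) * q0))"
      using A 2 unfolding gg hh by simp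
    have "w * h * g * (A + B + D) = w * h * g * E"
    proof -
      have "w * h * g * (A + B + D) = w * h * g * A + w * h * g * B + w * h * g * D" by algebra
      also have "\<dots> = C * g * (g + 1) * (w * h * (g + 1) + real k * g * (g + 1) + h * (h - 1) * (real k + 2 * l -
          1)) * (p1 * q1)
          + C * h * (h - 1) * (w * g * (h - 1) + real k * h * (h - 1) + g * (g + 1) * (real k + 2 * l - 1)) * (p0 *
              q0)
          + C * h * g * (g + 1) * (h - 1) * (w - (real k + (real k + 2 * l - 1))) * (p1 * q0 + p0 * q1)"
        unfolding a' b' d' by algebra
      also have "\<dots> = w * h * g * E"
        unfolding i11 i00 e' using i10 by algebra
      finally show ?thesis .
    qed
    then show ?thesis using pos by simp
  next
    case 3
    have A': "A = 0" using 3 A0 by simp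
    have D': "D = 0" using 3 by (simp add: D_def F_def addition_coeff_eq_0)
    have c0: "addition_coeff l (n - 1) k = 0" using 3 by (simp add: addition_coeff_eq_0)
    have rk: "real k = real n + 1" using 3 by simp
    have w: "2 * l + 2 * real n + 1 > 0" using l by linarith
    have "(2 * l + 2 * real n + 1)\<^sup>2 * B = addition_coeff l n n * u n * ((M * (2 * l + 2 * real n + 1) * p1) * (M *
        (2 * l + 2 * real n + 1) * q1))"
      using B 3 unfolding rk by (simp add: M_def algebra_simps)
    also have "\<dots> = (2 * l + 2 * real n + 1)\<^sup>2 * (addition_coeff l n n * u n * M\<^sup>2 * (p1 * q1))"
      by algebra
    finally have B': "B = addition_coeff l n n * u n * M\<^sup>2 * (p1 * q1)"
      using w by simp
    have "(2 * l + 2 * real n + 1) * (addition_coeff l (Suc n) k * (real n + 1)) =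
        (2 * l + 2 * real n + 1) * (addition_coeff l (Suc n) n * u n)"
      using addition_coeff_Suc_right[OF l, of "Suc n" n] unfolding 3 u_def by (simp add: algebra_simps)
    then have 1: "addition_coeff l (Suc n) k * (real n + 1) = addition_coeff l (Suc n) n * u n"
      using w by simp
    have 2: "addition_coeff l (Suc n) n * (real n + 2 * l) = addition_coeff l n n * (real n + 1) * M"
      using addition_coeff_Suc_left[OF l, of n n] by (simp add: M_def algebra_simps)
    have "(real n + 1) * (M * addition_coeff l n n * u n) =
        (real n + 1) * ((real n + 2 * l) * addition_coeff l (Suc n) k)"
      using 1 2 by algebra
    then have "M * addition_coeff l n n * u n = (real n + 2 * l) * addition_coeff l (Suc n) k"
      by simp
    then show ?thesis unfolding A' D' B' E c0 by algebra
  next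
    case 4
    then show ?thesis
      using A0 by (auto simp: B_def D_def E_def F_def addition_coeff_eq_0)
  qed
  have "M * (M * (x * y * F n k + s * t * ((if k =
      0 then 0 else F n (k - 1) * u (k - 1)) + F n (Suc k) * v (Suc k)))) = A + B + D"
    unfolding A_def B_def D_def by (simp add: algebra_simps power2_eq_square)
  then have "M * (M * (x * y * F n k + s * t * ((if k =
      0 then 0 else F n (k - 1) * u (k - 1)) + F n (Suc k) * v (Suc k)))) =
     M * ((real n + 2 * l) * F (Suc n) k + real n * F (n - 1) k)"
    using main by (simp add: E_def)
  then show ?thesis using M unfolding M_def by (metis less_irrefl mult_left_cancel)
qed

text \<open>
Gegenbauer's addition theorem. The functions on the last factor enter only through the recurrence
for multiplication by \<open>\<zeta>\<close>, and only for the orders with a nonzero coefficient. This admits the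
Gegenbauer polynomials of index \<open>l - 1/2\<close>, and also, for \<open>l = 0\<close>, the powers of \<open>\<zeta> = 1\<close> or
\<open>\<zeta> = -1\<close>: the circle is then built from the sphere with two points.
\<close>

theorem gegenbauer_addition:
  fixes l x y \<zeta> :: real and z :: "nat \<Rightarrow> real"
  assumes l: "l \<ge> 0" and x: "\<bar>x\<bar> \<le> 1" and y: "\<bar>y\<bar> \<le> 1"
    and z0: "z 0 = 1"
    and z: "\<And>k. addition_scale (2 * l - 1) k \<noteq> 0 \<Longrightarrow>
       \<zeta> * z k = addition_up (2 * l - 1) k * z (Suc k) + addition_down (2 * l - 1) k * z (k - 1)"
  shows "gegenbauer l n (x * y + sqrt (1 - x\<^sup>2) * sqrt (1 - y\<^sup>2) * \<zeta>) =
    (\<Sum>k\<le>n. addition_coeff l n k * assoc_gegenbauer l n k x * assoc_gegenbauer l n k y * z k)"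
proof -
  define F where "F = (\<lambda>n k. addition_coeff l n k * assoc_gegenbauer l n k x * assoc_gegenbauer l n k y)"
  define u v where "u = addition_up (2 * l - 1)" and "v = addition_down (2 * l - 1)"
  define s t where "s = sqrt (1 - x\<^sup>2)" and "t = sqrt (1 - y\<^sup>2)"
  define X where "X = x * y + s * t * \<zeta>"
  have Fz: "F n k * (\<zeta> * z k) = F n k * (u k * z (Suc k) + v k * z (k - 1))" for n k
    using z[of k] by (cases "addition_scale (2 * l - 1) k = 0") (auto simp: F_def addition_coeff_def u_def v_def)
  have F0: "F n k = 0" if "k > n" for n k using that by (simp add: F_def addition_coeff_eq_0)
  have ext: "(\<Sum>k\<le>n. F n k * z k) = (\<Sum>k\<le>N. F n k * z k)" if "n \<le> N" for n N
    by (rule sum.mono_neutral_left) (use that F0 in auto)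
  have z1: "z 1 = \<zeta>" using z[of 0] z0 by (simp add: addition_up.simps addition_down.simps)
  have "gegenbauer l n X = (\<Sum>k\<le>n. F n k * z k)"
  proof (induction n rule: induct_nat_012)
    case 0 then show ?case by (simp add: F_def assoc_gegenbauer_def z0)
  next
    case 1
    have "addition_coeff l 1 1 = 1" using l by (simp add: addition_coeff_def addition_up.simps)
    then show ?case by (simp add: F_def assoc_gegenbauer_def z0 z1[simplified] X_def s_def t_def)
  next
    case (ge2 m)
    define n where "n = Suc m"
    define N where "N = Suc (Suc n)"
    have n: "n \<ge> 1" "Suc m = n" "n - 1 = m" by (simp_all add: n_def)
    have pt: "2 * (real n + l) * (x * y * F n k + s * t * ((if k =
        0 then 0 else F n (k - 1) * u (k - 1)) + F n (Suc k) * v (Suc k)))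
        = (real n + 2 * l) * F (Suc n) k + real n * F (n - 1) k" for k
      unfolding F_def s_def t_def u_def v_def by (rule assoc_gegenbauer_product_step[OF l x y n(1)])
    have gX: "gegenbauer l n X = (\<Sum>k\<le>N. F n k * z k)"
      using ge2.IH(2) ext[of n N] by (simp only: n N_def)
    have up: "(\<Sum>k\<le>N. F n k * u k * z (Suc k)) = (\<Sum>k\<le>N. (if k = 0 then 0 else F n (k - 1) * u (k - 1)) * z k)"
    proof -
      have "(\<Sum>k\<le>N. (if k = 0 then 0 else F n (k - 1) * u (k - 1)) * z k) = (\<Sum>k\<le>Suc n. F n k * u k * z (Suc k))"
        unfolding N_def by (subst sum.atMost_Suc_shift) (simp del: sum.atMost_Suc)
      then show ?thesis by (simp add: N_def F0)
    qed
    have down: "(\<Sum>k\<le>N. F n k * v k * z (k - 1)) = (\<Sum>k\<le>N. F n (Suc k) * v (Suc k) * z k)"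
    proof -
      have "(\<Sum>k\<le>N. F n k * v k * z (k - 1)) = (\<Sum>k\<le>Suc n. F n (Suc k) * v (Suc k) * z k)"
        unfolding N_def by (subst sum.atMost_Suc_shift) (simp add: v_def addition_down.simps[of _ 0] del:
            sum.atMost_Suc)
      then show ?thesis by (simp add: N_def F0)
    qed
    have "\<zeta> * gegenbauer l n X = (\<Sum>k\<le>N. F n k * (\<zeta> * z k))"
      unfolding gX by (simp add: sum_distrib_left mult_ac del: sum.atMost_Suc)
    also have "\<dots> = (\<Sum>k\<le>N. F n k * u k * z (Suc k)) + (\<Sum>k\<le>N. F n k * v k * z (k - 1))"
      by (simp only: Fz) (simp add: sum.distrib[symmetric] algebra_simps)
    finally have zG: "\<zeta> * gegenbauer l n X = (\<Sum>k\<le>N. (if k = 0 then 0 else F n (k - 1) * u (k - 1)) * z k) +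
        (\<Sum>k\<le>N. F n (Suc k) * v (Suc k) * z k)"
      unfolding up down .
    have "X * gegenbauer l n X = x * y * gegenbauer l n X + s * t * (\<zeta> * gegenbauer l n X)"
      by (subst X_def) algebra
    also have "\<dots> = x * y * (\<Sum>k\<le>N. F n k * z k) + s * t *
        ((\<Sum>k\<le>N. (if k = 0 then 0 else F n (k - 1) * u (k - 1)) * z k) + (\<Sum>k\<le>N. F n (Suc k) * v (Suc k) * z k))"
      unfolding zG by (simp only: gX)
    also have "\<dots> = (\<Sum>k\<le>N. (x * y * F n k + s * t * ((if k =
        0 then 0 else F n (k - 1) * u (k - 1)) + F n (Suc k) * v (Suc k))) * z k)"
      by (simp add: sum_distrib_left distrib_right sum.distrib mult.assoc ring_distribs(1) del: sum.atMost_Suc)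
    finally have XG: "X * gegenbauer l n X = (\<Sum>k\<le>N. (x * y * F n k + s * t * ((if k =
        0 then 0 else F n (k - 1) * u (k - 1)) + F n (Suc k) * v (Suc k))) * z k)" .
    have "2 * (real n + l) * X * gegenbauer l n X = 2 * (real n + l) * (X * gegenbauer l n X)" by simp
    also have "\<dots> = (\<Sum>k\<le>N. ((real n + 2 * l) * F (Suc n) k + real n * F (n - 1) k) * z k)"
      unfolding XG sum_distrib_left by (intro sum.cong refl) (metis pt mult.assoc)
    also have "\<dots> = (real n + 2 * l) * (\<Sum>k\<le>N. F (Suc n) k * z k) + real n * (\<Sum>k\<le>N. F m k * z k)"
      unfolding n(3) sum_distrib_left sum.distrib[symmetric] by (intro sum.cong refl) algebra
    finally have 1: "2 * (real n + l) * X * gegenbauer l n X =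
       (real n + 2 * l) * (\<Sum>k\<le>N. F (Suc n) k * z k) + real n * (\<Sum>k\<le>N. F m k * z k)" .
    have 2: "(\<Sum>k\<le>N. F m k * z k) = gegenbauer l m X"
      by (rule trans[OF ext[symmetric] ge2.IH(1)[symmetric]]) (simp add: N_def n_def)
    have 3: "(\<Sum>k\<le>N. F (Suc n) k * z k) = (\<Sum>k\<le>Suc n. F (Suc n) k * z k)"
      by (rule ext[symmetric]) (simp add: N_def)
    have "(real n + 2 * l) * gegenbauer l (Suc n) X =
        2 * (real n + l) * X * gegenbauer l n X - real n * gegenbauer l m X"
      using gegenbauer_recurrence[OF l, of n X] unfolding n(3) .
    then have "(real n + 2 * l) * gegenbauer l (Suc n) X = (real n + 2 * l) * (\<Sum>k\<le>Suc n. F (Suc n) k * z k)"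
      by (simp only: 1 2 3 add_diff_cancel_right')
    moreover have "real n + 2 * l > 0" using n l by simp
    ultimately have "gegenbauer l (Suc n) X = (\<Sum>k\<le>Suc n. F (Suc n) k * z k)"
      by (metis less_irrefl mult_left_cancel)
    then show ?case by (simp only: n_def)
  qed
  then show ?thesis by (simp only: F_def X_def s_def t_def)
qed

section \<open>Orthogonality and moments\<close>

text \<open>
Substitute \<open>t = (1 + x) / 2\<close> in the Beta integral.
\<close>

lemma Beta_integral_symmetric:
  fixes a b :: real
  assumes "a > 0" "b > 0"
  shows "integrable lborel (\<lambda>x. indicator {-1..1} x * ((1 + x) powr (a - 1) * (1 - x) powr (b -
      1)))" (is "integrable _ ?g")
    and "(LBINT x. indicator {-1..1} x * ((1 + x) powr (a - 1) * (1 - x) powr (b - 1))) =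
        2 powr (a + b - 1) * Beta a b"
proof -
  define f where "f = (\<lambda>t::real. indicator {0..1} t * (t powr (a - 1) * (1 - t) powr (b - 1)))"
  have f: "integrable lborel f"
    using integrable_Beta[OF assms] by (simp add: set_integrable_def f_def)
  have "(LBINT t:{0..1}. t powr (a - 1) * (1 - t) powr (b - 1)) = Beta a b"
    using set_borel_integral_eq_integral(2)[OF integrable_Beta[OF assms]] has_integral_Beta_real[OF assms]
    by (simp add: integral_unique)
  then have fB: "(LBINT t. f t) = Beta a b"
    by (simp add: set_lebesgue_integral_def f_def)
  have eq: "f (1/2 + (1/2) * x) = 2 powr (2 - a - b) * ?g x" for x
  proof (cases "x \<in> {-1..1}")
    case True
    have "(1/2 + (1/2) * x) = (1 + x) / 2" "1 - (1/2 + (1/2) * x) = (1 - x) / 2" by (simp_all add: field_simps)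
    then show ?thesis using True
      by (simp add: f_def powr_divide powr_diff powr_add field_simps)
  qed (auto simp: f_def indicator_def)
  have "integrable lborel (\<lambda>x. f (1/2 + (1/2) * x))"
    by (rule lborel_integrable_real_affine[OF f]) simp
  then show "integrable lborel ?g" unfolding eq by simp
  have "Beta a b = (1/2) * (LBINT x. f (1/2 + (1/2) * x))"
    using lborel_integral_real_affine[of "1/2" f "1/2"] fB by simp
  also have "\<dots> = (1/2) * 2 powr (2 - a - b) * (LBINT x. ?g x)"
    unfolding eq by simp
  also have "(1/2) * 2 powr (2 - a - b) = inverse (2 powr (a + b - 1))"
    by (simp add: powr_minus[symmetric] powr_diff powr_add field_simps)
  finally show "(LBINT x. ?g x) = 2 powr (a + b - 1) * Beta a b" by (simp add: field_simps)
qed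

definition gegenbauer_weight :: "real \<Rightarrow> real \<Rightarrow> real" where
  "gegenbauer_weight l x = indicator {-1..1} x * (1 - x\<^sup>2) powr (l - 1/2)"

definition gegenbauer_measure :: "real \<Rightarrow> real measure" where
  "gegenbauer_measure l = density lborel (\<lambda>x. ennreal (gegenbauer_weight l x))"

lemma gegenbauer_weight_nonneg [simp]: "gegenbauer_weight l x \<ge> 0"
  by (simp add: gegenbauer_weight_def)

lemma gegenbauer_weight_measurable [measurable]: "gegenbauer_weight l \<in> borel_measurable borel"
  unfolding gegenbauer_weight_def by measurable

lemma gegenbauer_weight_eq_product:
  "gegenbauer_weight l x = indicator {-1..1} x * ((1 + x) powr (l - 1/2) * (1 - x) powr (l - 1/2))"
proof (cases "x \<in> {-1..1}")
  case True
  have "1 - x\<^sup>2 = (1 + x) * (1 - x)" by (simp add: power2_eq_square algebra_simps)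
  then show ?thesis using True by (simp add: gegenbauer_weight_def powr_mult)
qed (simp add: gegenbauer_weight_def)

lemma sets_gegenbauer_measure [simp, measurable_cong]: "sets (gegenbauer_measure l) = sets borel"
  by (simp add: gegenbauer_measure_def)

lemma space_gegenbauer_measure [simp]: "space (gegenbauer_measure l) = UNIV"
  by (simp add: gegenbauer_measure_def)

lemma integrable_gegenbauer_weight: "l \<ge> 0 \<Longrightarrow> integrable lborel (gegenbauer_weight l)"
  using Beta_integral_symmetric(1)[of "l + 1/2" "l + 1/2"] by (simp add: gegenbauer_weight_eq_product[abs_def])

lemma finite_measure_gegenbauer:
  assumes "l \<ge> 0"
  shows "finite_measure (gegenbauer_measure l)"
proof
  have "emeasure (gegenbauer_measure l) (space (gegenbauer_measure l)) =
      (\<integral>\<^sup>+ x. ennreal (gegenbauer_weight l x) \<partial>lborel)"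
    by (simp add: gegenbauer_measure_def emeasure_density)
  also have "\<dots> = ennreal (LBINT x. gegenbauer_weight l x)"
    by (rule nn_integral_eq_integral[OF integrable_gegenbauer_weight[OF assms]]) simp
  finally show "emeasure (gegenbauer_measure l) (space (gegenbauer_measure l)) \<noteq> \<infinity>" by simp
qed

lemma AE_gegenbauer_measure: "AE x in gegenbauer_measure l. x \<in> {-1<..<1}"
proof -
  have "AE x in lborel. x \<noteq> (1::real) \<and> x \<noteq> -1"
    by (intro AE_conjI AE_lborel_singleton)
  then have "AE x in lborel. 0 < ennreal (gegenbauer_weight l x) \<longrightarrow> x \<in> {-1<..<1}"
    by (rule eventually_mono) (auto simp: gegenbauer_weight_def indicator_def split: if_splits)
  then show ?thesis unfolding gegenbauer_measure_def by (subst AE_density) auto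
qed

lemma AE_gegenbauer_measure_closed: "AE x in gegenbauer_measure l. x \<in> {-1..1}"
  using AE_gegenbauer_measure by (rule eventually_mono) auto

lemma integral_gegenbauer_measure: "f \<in> borel_measurable borel \<Longrightarrow>
    (\<integral>x. f x \<partial>gegenbauer_measure l) = (LBINT x. gegenbauer_weight l x * f x)"
  unfolding gegenbauer_measure_def by (rule integral_real_density) auto

lemma integrable_gegenbauer_measure_iff: "f \<in> borel_measurable borel \<Longrightarrow> integrable (gegenbauer_measure l) f \<longleftrightarrow>
    integrable lborel (\<lambda>x. gegenbauer_weight l x * f x)"
  unfolding gegenbauer_measure_def by (rule integrable_real_density) auto

text \<open>
The Gegenbauer measures, the two-point measure on \<open>S\<^sup>0\<close> and the measures of the half-order means
are treated together.
\<close>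

locale finite_interval_measure = finite_measure \<nu> for \<nu> :: "real measure" +
  assumes sets_eq [simp, measurable_cong]: "sets \<nu> = sets borel"
    and AE_interval: "AE x in \<nu>. x \<in> {-1..1}"
begin

lemma space_eq [simp]: "space \<nu> = UNIV"
  using sets_eq_imp_space_eq[OF sets_eq] by simp

lemma integrable_bounded_on:
  fixes f :: "real \<Rightarrow> real"
  assumes "f \<in> borel_measurable borel" "\<And>x. x \<in> {-1..1} \<Longrightarrow> \<bar>f x\<bar> \<le> B"
  shows "integrable \<nu> f"
proof -
  have "AE x in \<nu>. norm (f x) \<le> B"
    using AE_interval by (rule eventually_mono) (use assms(2) in simp)
  then show ?thesis by (rule integrable_const_bound) (use assms(1) in simp)
qed

lemma integrable_continuous:
  fixes f :: "real \<Rightarrow> real"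
  assumes "continuous_on UNIV f"
  shows "integrable \<nu> f"
proof -
  have "compact (f ` {-1..1})"
    by (intro compact_continuous_image continuous_on_subset[OF assms]) auto
  then obtain B where "\<And>x. x \<in> {-1..1} \<Longrightarrow> \<bar>f x\<bar> \<le> B"
    using compact_imp_bounded bounded_iff by (metis imageI real_norm_def)
  then show ?thesis
    by (intro integrable_bounded_on) (use borel_measurable_continuous_onI[OF assms] in auto)
qed

lemma abs_integral_le:
  fixes f :: "real \<Rightarrow> real"
  assumes "continuous_on UNIV f" "\<And>x. x \<in> {-1..1} \<Longrightarrow> \<bar>f x\<bar> \<le> B"
  shows "\<bar>\<integral>x. f x \<partial>\<nu>\<bar> \<le> measure \<nu> UNIV * B"
proof -
  have "\<bar>\<integral>x. f x \<partial>\<nu>\<bar> \<le> (\<integral>x. \<bar>f x\<bar> \<partial>\<nu>)" by (rule integral_abs_bound)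
  also have "\<dots> \<le> (\<integral>x. B \<partial>\<nu>)"
  proof (rule integral_mono_AE)
    show "AE x in \<nu>. \<bar>f x\<bar> \<le> B" using AE_interval by (rule eventually_mono) (rule assms(2))
    show "integrable \<nu> (\<lambda>x. \<bar>f x\<bar>)" using assms(1) by (intro integrable_continuous continuous_intros)
  qed simp
  finally show ?thesis by (simp add: mult.commute)
qed

end

lemma finite_interval_measure_gegenbauer: "l \<ge> 0 \<Longrightarrow> finite_interval_measure (gegenbauer_measure l)"
  by (intro finite_interval_measure.intro finite_measure_gegenbauer finite_interval_measure_axioms.intro
      sets_gegenbauer_measure AE_gegenbauer_measure_closed)

lemma integrable_gegenbauer_measure_continuous [intro]:
  fixes f :: "real \<Rightarrow> real"
  assumes "l \<ge> 0" "continuous_on UNIV f"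
  shows "integrable (gegenbauer_measure l) f"
  by (rule finite_interval_measure.integrable_continuous[OF finite_interval_measure_gegenbauer[OF assms(1)]
      assms(2)])

lemma integral_gegenbauer_measure_cong:
  fixes f g :: "real \<Rightarrow> real"
  assumes "\<And>x. x \<in> {-1..1} \<Longrightarrow> f x = g x" "f \<in> borel_measurable borel" "g \<in> borel_measurable borel"
  shows "(\<integral>x. f x \<partial>gegenbauer_measure l) = (\<integral>x. g x \<partial>gegenbauer_measure l)"
proof (rule integral_cong_AE)
  show "AE x in gegenbauer_measure l. f x = g x"
    using AE_gegenbauer_measure_closed[of l] by (rule eventually_mono) (rule assms(1))
qed (use assms in simp_all)

lemma continuous_on_gegenbauer' : "continuous_on UNIV (gegenbauer l n)"
  using continuous_on_gegenbauer[of UNIV "\<lambda>x. x"] by simp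

text \<open>
The zero set of \<open>D\<close> has full measure in the interval, so it is dense, and it is closed.
\<close>

lemma continuous_eq_0_if_square_integral_0:
  fixes D :: "real \<Rightarrow> real"
  assumes l: "l \<ge> 0" and D: "continuous_on UNIV D" and 0: "(\<integral>x. (D x)\<^sup>2 \<partial>gegenbauer_measure l) = 0"
      and x: "x \<in> {-1..1}"
  shows "D x = 0"
proof -
  have "integrable (gegenbauer_measure l) (\<lambda>x. (D x)\<^sup>2)"
    using l D by (intro integrable_gegenbauer_measure_continuous continuous_intros)
  then have "AE x in gegenbauer_measure l. (D x)\<^sup>2 = 0"
    using 0 by (subst (asm) integral_nonneg_eq_0_iff_AE) auto
  then have "AE x in lborel. 0 < gegenbauer_weight l x \<longrightarrow> D x = 0"
    unfolding gegenbauer_measure_def by (subst (asm) AE_density) auto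
  then have "AE x in lborel. x \<notin> {-1<..<1} \<inter> {x. D x \<noteq> 0}"
  proof (rule eventually_mono)
    fix x :: real assume *: "0 < gegenbauer_weight l x \<longrightarrow> D x = 0"
    have "gegenbauer_weight l x > 0" if "x \<in> {-1<..<1}"
    proof -
      have "1 - x\<^sup>2 > 0" using that by (simp add: abs_square_less_1 abs_less_iff)
      then show ?thesis using that by (simp add: gegenbauer_weight_def)
    qed
    then show "x \<notin> {-1<..<1} \<inter> {x. D x \<noteq> 0}" using * by auto
  qed
  moreover have op: "open ({-1<..<1} \<inter> {x. D x \<noteq> 0})"
    using D by (intro open_Int open_Collect_neq) auto
  ultimately have "{-1<..<1} \<inter> {x. D x \<noteq> 0} \<in> null_sets lborel"
    by (subst AE_iff_null_sets) (auto intro: borel_open)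
  then have "negligible ({-1<..<1} \<inter> {x. D x \<noteq> 0})"
    using negligible_iff_null_sets null_sets_completionI by blast
  then have "{-1<..<1} \<inter> {x. D x \<noteq> 0} = {}"
    using open_not_negligible[OF op] by blast
  then have "{-1<..<1} \<subseteq> {x. D x = 0}" by auto
  moreover have "closed {x. D x = 0}" using D by (intro closed_Collect_eq) auto
  ultimately have "closure {-1<..<1} \<subseteq> {x. D x = 0}" by (rule closure_minimal)
  then show ?thesis using x by auto
qed

text \<open>
Integration by parts moves one degree from the polynomial to the weight:
\<open>(1 - x\<^sup>2) powr (l + 1/2) * gegenbauer (l + 1) n x\<close> vanishes at both endpoints and has derivative
\<open>- (2 * l + 1) * gegenbauer_weight l x * gegenbauer l (Suc n) x\<close>. Iterating this is Rodrigues' formula.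
\<close>

lemma gegenbauer_Rodrigues:
  assumes l: "l \<ge> 0"
    and p: "\<And>x. (p has_field_derivative p' x) (at x)" and p': "continuous_on UNIV p'"
  shows "(2 * l + 1) * (\<integral>x. gegenbauer l (Suc n) x * p x \<partial>gegenbauer_measure l) =
      (\<integral>x. gegenbauer (l + 1) n x * p' x \<partial>gegenbauer_measure (l + 1))"
proof -
  define \<phi> where "\<phi> = (\<lambda>x. (1 - x\<^sup>2) powr (l + 1/2) * gegenbauer (l + 1) n x * p x)"
  have pc: "continuous_on UNIV p"
    using p by (meson DERIV_isCont continuous_at_imp_continuous_on)
  have U': "(1 - x\<^sup>2) * (real n * (real n + 2 * (l + 1)) / (2 * (l + 1) + 1) * gegenbauer (l + 1 + 1) (n - 1) x) -
      (2 * l + 1) * x * gegenbauer (l + 1) n x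
      = - (2 * l + 1) * gegenbauer l (Suc n) x" for x
  proof -
    have 1: "real n * (1 - x\<^sup>2) * gegenbauer (l + 1 + 1) (n - 1) x =
        (2 * (l + 1) + 1) * (x * gegenbauer (l + 1) n x - gegenbauer (l + 1) (Suc n) x)"
      by (rule gegenbauer_lower_index_mixed) (use l in simp)
    have 2: "(2 * l + 1) * gegenbauer l (Suc n) x =
        (real n + 2 * l + 2) * gegenbauer (l + 1) (Suc n) x - (real n + 1) * x * gegenbauer (l + 1) n x"
      using gegenbauer_raise_index[OF l, of "Suc n" x] by (simp add: algebra_simps)
    have ne: "2 * (l + 1) + 1 > 0" using l by simp
    have "(1 - x\<^sup>2) * (real n * (real n + 2 * (l + 1)) / (2 * (l + 1) + 1) * gegenbauer (l + 1 + 1) (n - 1) x) =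
       (real n + 2 * (l + 1)) * (real n * (1 - x\<^sup>2) * gegenbauer (l + 1 + 1) (n - 1) x) / (2 * (l + 1) + 1)"
      by simp
    also have "\<dots> = (real n + 2 * (l + 1)) * (x * gegenbauer (l + 1) n x - gegenbauer (l + 1) (Suc n) x)"
      unfolding 1 using ne by simp
    finally show ?thesis using 2 by (simp add: algebra_simps)
  qed
  have d: "(\<phi> has_vector_derivative
      (- (2 * l + 1) * (gegenbauer_weight l x * (gegenbauer l (Suc n) x * p x)) + gegenbauer_weight (l + 1) x *
          (gegenbauer (l + 1) n x * p' x))) (at x)"
    if x: "x \<in> {-1<..<1}" for x
  proof -
    have pos: "1 - x\<^sup>2 > 0" using x by (simp add: abs_square_less_1 abs_less_iff)
    define w where "w = (1 - x\<^sup>2) powr (l - 1/2)"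
    have w1: "(1 - x\<^sup>2) powr (l + 1/2) = (1 - x\<^sup>2) * w"
      using pos by (simp add: w_def powr_mult_base add.commute)
    define U where "U = (real n * (real n + 2 * (l + 1)) / (2 * (l + 1) + 1) * gegenbauer (l + 1 + 1) (n - 1) x)"
    have gd: "(gegenbauer (l + 1) n has_field_derivative U) (at x)"
      unfolding U_def by (rule gegenbauer_has_derivative) (use l in simp)
    have wd: "((\<lambda>x. (1 - x\<^sup>2) powr (l + 1/2)) has_field_derivative (l + 1/2) * w * (- 2 * x)) (at x)"
      using pos unfolding w_def by (auto intro!: derivative_eq_intros simp: field_simps)
    have "(\<phi> has_field_derivative
        (((l + 1/2) * w * (- 2 * x)) * gegenbauer (l + 1) n x + (1 - x\<^sup>2) powr (l + 1/2) * U) * p x +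
        (1 - x\<^sup>2) powr (l + 1/2) * gegenbauer (l + 1) n x * p' x) (at x)"
      unfolding \<phi>_def by (rule DERIV_cong[OF DERIV_mult[OF DERIV_mult[OF wd gd] p]]) (simp add: algebra_simps)
    moreover have "(((l + 1/2) * w * (- 2 * x)) * gegenbauer (l + 1) n x + (1 - x\<^sup>2) powr (l + 1/2) * U)
       = w * ((1 - x\<^sup>2) * U - (2 * l + 1) * x * gegenbauer (l + 1) n x)"
      unfolding w1 by (simp add: algebra_simps)
    moreover have "\<dots> = - (2 * l + 1) * w * gegenbauer l (Suc n) x"
      unfolding U_def U' by simp
    ultimately have "(\<phi> has_field_derivative
        (- (2 * l + 1) * w * gegenbauer l (Suc n) x) * p x + (1 - x\<^sup>2) powr (l + 1/2) * gegenbauer (l + 1) n x *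
            p' x) (at x)"
      by simp
    moreover have "gegenbauer_weight l x = w" "gegenbauer_weight (l + 1) x = (1 - x\<^sup>2) powr (l + 1/2)"
      using x by (simp_all add: gegenbauer_weight_def w_def add.commute)
    ultimately show ?thesis
      by (simp add: has_real_derivative_iff_has_vector_derivative mult.assoc)
  qed
  let ?f1 = "\<lambda>x. gegenbauer_weight l x * (gegenbauer l (Suc n) x * p x)"
      and ?f2 = "\<lambda>x. gegenbauer_weight (l + 1) x * (gegenbauer (l + 1) n x * p' x)"
  have c1: "continuous_on UNIV (\<lambda>x. gegenbauer l (Suc n) x * p x)"
    and c2: "continuous_on UNIV (\<lambda>x. gegenbauer (l + 1) n x * p' x)"
    by (intro continuous_intros pc p' continuous_on_gegenbauer')+
  note m1 = borel_measurable_continuous_onI[OF c1] and m2 = borel_measurable_continuous_onI[OF c2]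
  have i1: "integrable lborel ?f1" and i2: "integrable lborel ?f2"
    using integrable_gegenbauer_measure_continuous[OF l c1] integrable_gegenbauer_measure_continuous[OF _ c2,
        of "l + 1"] l
    by (simp_all add: integrable_gegenbauer_measure_iff m1 m2)
  let ?F = "\<lambda>x. - (2 * l + 1) * ?f1 x + ?f2 x"
  have i: "integrable lborel ?F" using i1 i2 by simp
  have "continuous_on {-1..1} \<phi>"
    unfolding \<phi>_def using l
    by (intro continuous_intros continuous_on_powr' continuous_on_subset[OF pc] continuous_on_gegenbauer) 
       (auto simp: abs_square_le_1 abs_le_iff)
  then have "(?F has_integral (\<phi> 1 - \<phi> (-1))) {-1..1}"
    using d by (intro fundamental_theorem_of_calculus_interior) auto
  then have "(?F has_integral 0) {-1..1}" by (simp add: \<phi>_def)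
  moreover have "?F x = (if x \<in> {-1..1} then ?F x else 0)" for x
    by (auto simp: gegenbauer_weight_def)
  ultimately have "(?F has_integral 0) UNIV"
    using has_integral_restrict_UNIV[of "{-1..1}" ?F 0] by presburger
  then have "(LBINT x. ?F x) = 0"
    using has_integral_integral_lborel[OF i] has_integral_unique by blast
  then have "- (2 * l + 1) * (LBINT x. ?f1 x) + (LBINT x. ?f2 x) = 0"
    using i1 i2 by simp
  then have "(2 * l + 1) * (LBINT x. ?f1 x) = (LBINT x. ?f2 x)" by argo
  then show ?thesis by (simp only: integral_gegenbauer_measure m1 m2)
qed

definition falling :: "nat \<Rightarrow> nat \<Rightarrow> real" where
  "falling j n = (\<Prod>i<n. real j - real i)"

lemma falling_Suc: "falling j (Suc n) = real j * falling (j - 1) n"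
proof (cases j)
  case 0 then show ?thesis by (simp add: falling_def prod.lessThan_Suc_shift del: prod.lessThan_Suc)
next
  case (Suc k)
  then show ?thesis by (simp add: falling_def prod.lessThan_Suc_shift del: prod.lessThan_Suc)
qed

text \<open>
By \<open>gegenbauer_Rodrigues\<close> the moment reduces to degree 0, where it is a Beta integral. The factor
\<open>falling j n\<close> is nonnegative and vanishes for \<open>j < n\<close>.
\<close>

theorem gegenbauer_moment:
  assumes "l \<ge> 0"
  shows "(\<integral>x. (1 + x) ^ j * gegenbauer l n x \<partial>gegenbauer_measure l) =
    2 powr (2 * l) * Gamma (l + 1/2) * 2 ^ j * falling j n * Gamma (real j + l + 1/2) / Gamma (real j + real n +
        2 * l + 1)"
  using assms
proof (induction n arbitrary: l j)
  case 0
  have "(\<integral>x. (1 + x) ^ j * gegenbauer l 0 x \<partial>gegenbauer_measure l) =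
      (LBINT x. gegenbauer_weight l x * (1 + x) ^ j)"
    by (simp add: integral_gegenbauer_measure)
  also have "\<dots> = (LBINT x. indicator {-1..1} x * ((1 + x) powr ((real j + l + 1/2) - 1) * (1 - x) powr ((l + 1/2) -
      1)))"
  proof (rule integral_cong_AE)
    have "AE x in lborel. x \<noteq> (-1::real)" by (rule AE_lborel_singleton)
    then show "AE x in lborel. gegenbauer_weight l x * (1 + x) ^ j =
        indicator {-1..1} x * ((1 + x) powr ((real j + l + 1/2) - 1) * (1 - x) powr ((l + 1/2) - 1))"
    proof (rule eventually_mono)
      fix x :: real assume "x \<noteq> -1"
      then show "gegenbauer_weight l x * (1 + x) ^ j =
        indicator {-1..1} x * ((1 + x) powr ((real j + l + 1/2) - 1) * (1 - x) powr ((l + 1/2) - 1))"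
        by (auto simp: gegenbauer_weight_eq_product indicator_def powr_realpow[symmetric] powr_add[symmetric]
            algebra_simps)
    qed
  qed simp_all
  also have "\<dots> = 2 powr ((real j + l + 1/2) + (l + 1/2) - 1) * Beta (real j + l + 1/2) (l + 1/2)"
    by (rule Beta_integral_symmetric) (use 0 in auto)
  also have "2 powr ((real j + l + 1/2) + (l + 1/2) - 1) = 2 powr (2 * l) * 2 ^ j"
    by (simp add: powr_realpow[symmetric] powr_add[symmetric] algebra_simps)
  finally show ?case by (simp add: Beta_def falling_def algebra_simps)
next
  case (Suc n)
  have d: "((\<lambda>x. (1 + x) ^ j) has_field_derivative (real j * (1 + x) ^ (j - 1))) (at x)" for x :: real
    by (auto intro!: derivative_eq_intros)
  have ne: "2 * l + 1 \<noteq> 0" "l + 1/2 \<noteq> 0" using Suc.prems by linarith+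
  have ni: "l + 1/2 \<notin> \<int>\<^sub>\<le>\<^sub>0" using Suc.prems by (auto elim!: nonpos_Ints_cases)
  have "(2 * l + 1) * (\<integral>x. (1 + x) ^ j * gegenbauer l (Suc n) x \<partial>gegenbauer_measure l) =
      (\<integral>x. gegenbauer (l + 1) n x * (real j * (1 + x) ^ (j - 1)) \<partial>gegenbauer_measure (l + 1))"
    using gegenbauer_Rodrigues[OF Suc.prems d, of n] by (simp add: continuous_intros mult.commute)
  also have "\<dots> = real j * (\<integral>x. (1 + x) ^ (j - 1) * gegenbauer (l + 1) n x \<partial>gegenbauer_measure (l + 1))"
    by (subst integral_mult_right_zero[symmetric]) (simp add: mult_ac)
  also have "\<dots> = real j * (2 powr (2 * (l + 1)) * Gamma (l + 1 + 1/2) * 2 ^ (j - 1) * falling (j - 1) n *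
      Gamma (real (j - 1) + (l + 1) + 1/2) / Gamma (real (j - 1) + real n + 2 * (l + 1) + 1))"
    using Suc.IH[of "l + 1" "j - 1"] Suc.prems by simp
  also have "\<dots> = (2 * l + 1) * (2 powr (2 * l) * Gamma (l + 1/2) * 2 ^ j * falling j (Suc n) * Gamma (real j + l +
      1/2) / Gamma (real j + real (Suc n) + 2 * l + 1))"
  proof (cases j)
    case 0 then show ?thesis by (simp add: falling_Suc)
  next
    case j: (Suc i)
    have "Gamma (l + 1 + 1/2) = (l + 1/2) * Gamma (l + 1/2)"
      using Gamma_plus1[OF ni] by (simp add: add_ac)
    moreover have "2 powr (2 * (l + 1)) = 4 * 2 powr (2 * l)"
      by (simp add: powr_add distrib_left)
    moreover have "real (j - 1) + (l + 1) + 1/2 = real j + l + 1/2"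
      "real (j - 1) + real n + 2 * (l + 1) + 1 = real j + real (Suc n) + 2 * l + 1"
      using j by simp_all
    moreover have "(2::real) ^ j = 2 * 2 ^ (j - 1)" using j by simp
    ultimately show ?thesis unfolding falling_Suc
        by (simp only:) (simp only: times_divide_eq_right, simp add: j algebra_simps)
  qed
  finally show ?case by (rule mult_left_cancel[THEN iffD1, OF ne(1)])
qed

lemma integral_gegenbauer_measure_mult_eq_0:
  assumes l: "l \<ge> 0" and "degree q < n"
  shows "(\<integral>x. gegenbauer l n x * poly q x \<partial>gegenbauer_measure l) = 0"
  using assms
proof (induction n arbitrary: l q)
  case (Suc n)
  have ne: "2 * l + 1 \<noteq> 0" using Suc.prems by linarith
  have "(2 * l + 1) * (\<integral>x. gegenbauer l (Suc n) x * poly q x \<partial>gegenbauer_measure l) =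
      (\<integral>x. gegenbauer (l + 1) n x * poly (pderiv q) x \<partial>gegenbauer_measure (l + 1))"
    using Suc.prems by (intro gegenbauer_Rodrigues poly_DERIV continuous_intros) 
  also have "\<dots> = 0"
  proof (cases "pderiv q = 0")
    case False
    then have "degree (pderiv q) < n"
      using Suc.prems by (simp add: degree_pderiv pderiv_eq_0_iff)
    then show ?thesis using Suc by simp
  qed simp
  finally show ?case using ne by simp
qed simp

lemma gegenbauer_is_poly: "\<exists>q. degree q \<le> n \<and> gegenbauer l n = poly q"
proof (induction n rule: induct_nat_012)
  case 0 have "gegenbauer l 0 = poly 1" by (rule ext) simp
  then show ?case by (intro exI[of _ 1]) simp
next
  case 1 have "gegenbauer l (Suc 0) = poly [:0, 1:]" by (rule ext) simp
  then show ?case by (intro exI[of _ "[:0, 1:]"]) simp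
next
  case (ge2 n)
  then obtain q r where q: "degree q \<le> n" "gegenbauer l n = poly q"
      and r: "degree r \<le> Suc n" "gegenbauer l (Suc n) = poly r" by auto
  define s where "s = smult (1 / (real n + 1 + 2 * l)) (smult (2 * (real n + 1 + l)) (pCons 0 r) - smult (real n +
      1) q)"
  have "degree s \<le> Suc (Suc n)"
    unfolding s_def using q r
    by (intro order.trans[OF degree_smult_le] degree_diff_le order.trans[OF degree_pCons_le]) auto
  moreover have "gegenbauer l (Suc (Suc n)) = poly s"
    by (rule ext) (simp add: s_def q r mult_ac)
  ultimately show ?case by blast
qed

theorem gegenbauer_orthogonal:
  assumes "l \<ge> 0" "m \<noteq> n"
  shows "(\<integral>x. gegenbauer l m x * gegenbauer l n x \<partial>gegenbauer_measure l) = 0"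
proof -
  have *: "(\<integral>x. gegenbauer l m x * gegenbauer l n x \<partial>gegenbauer_measure l) = 0" if "n < m" for m n
    using gegenbauer_is_poly[of n l] integral_gegenbauer_measure_mult_eq_0[OF assms(1), of _ m] that by fastforce
  show ?thesis
    using assms *[of n m] *[of m n] by (cases "n < m") (auto simp: mult.commute)
qed

definition gegenbauer_norm :: "real \<Rightarrow> nat \<Rightarrow> real" where
  "gegenbauer_norm l n = (\<integral>x. (gegenbauer l n x)\<^sup>2 \<partial>gegenbauer_measure l)"

lemma gegenbauer_norm_pos:
  assumes "l \<ge> 0"
  shows "gegenbauer_norm l n > 0"
proof -
  have "gegenbauer_norm l n \<noteq> 0"
  proof
    assume "gegenbauer_norm l n = 0"
    then have "gegenbauer l n 1 = 0"
      by (intro continuous_eq_0_if_square_integral_0[OF assms continuous_on_gegenbauer']) (simp_all add: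
          gegenbauer_norm_def)
    then show False using gegenbauer_at_1[OF assms] by simp
  qed
  moreover have "gegenbauer_norm l n \<ge> 0" unfolding gegenbauer_norm_def by simp
  ultimately show ?thesis by linarith
qed

text \<open>
The addition theorem at \<open>y = x\<close>, \<open>\<zeta> = 1\<close> with the constant sequence 1.
\<close>

lemma gegenbauer_addition_at_1:
  assumes l: "l \<ge> 0" and x: "\<bar>x\<bar> \<le> 1"
  shows "(\<Sum>k\<le>n. addition_coeff l n k * (assoc_gegenbauer l n k x)\<^sup>2) = 1"
proof -
  have "gegenbauer l n (x * x + sqrt (1 - x\<^sup>2) * sqrt (1 - x\<^sup>2) * 1) =
    (\<Sum>k\<le>n. addition_coeff l n k * assoc_gegenbauer l n k x * assoc_gegenbauer l n k x * 1)"
  proof (rule gegenbauer_addition[OF l x x])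
    fix k
    show "1 * 1 = addition_up (2 * l - 1) k * 1 + addition_down (2 * l - 1) k * 1"
    proof (cases "k = 0")
      case False
      then have "real k \<ge> 1" by simp
      then have "2 * real k + (2 * l - 1) \<noteq> 0" using l by linarith
      then show ?thesis using False by (simp add: addition_up.simps addition_down.simps
          add_divide_distrib[symmetric])
    qed (simp add: addition_up.simps addition_down.simps)
  qed simp
  moreover have "x * x + sqrt (1 - x\<^sup>2) * sqrt (1 - x\<^sup>2) * 1 = 1"
    using x by (simp add: abs_square_le_1 power2_eq_square[symmetric])
  ultimately show ?thesis by (simp add: gegenbauer_at_1[OF l] power2_eq_square mult.assoc)
qed

text \<open>
The square is the first of the nonnegative terms in \<open>gegenbauer_addition_at_1\<close>.
\<close>

lemma abs_gegenbauer_le_1: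
  assumes l: "l \<ge> 0" and x: "\<bar>x\<bar> \<le> 1"
  shows "\<bar>gegenbauer l n x\<bar> \<le> 1"
proof -
  have "(gegenbauer l n x)\<^sup>2 = addition_coeff l n 0 * (assoc_gegenbauer l n 0 x)\<^sup>2"
    by (simp add: assoc_gegenbauer_def)
  also have "\<dots> \<le> (\<Sum>k\<le>n. addition_coeff l n k * (assoc_gegenbauer l n k x)\<^sup>2)"
    by (rule member_le_sum[of 0]) (auto intro!: mult_nonneg_nonneg addition_coeff_nonneg[OF l])
  also have "\<dots> = 1" by (rule gegenbauer_addition_at_1[OF l x])
  finally show ?thesis by (simp add: abs_square_le_1)
qed

text \<open>
Combinations of the first Gegenbauer polynomials with nonnegative coefficients. Since \<open>x\<close> times a
Gegenbauer polynomial is a nonnegative combination of its two neighbours, multiplication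
    by \<open>a + x\<close> with \<open>a \<ge> 0\<close> preserves them; so
they contain the powers of \<open>x\<close>, which shows that Gegenbauer polynomials span all polynomials, and
the powers of \<open>1 + x\<close>.
\<close>

definition gegenbauer_cone :: "real \<Rightarrow> nat \<Rightarrow> (real \<Rightarrow> real) \<Rightarrow> bool" where
  "gegenbauer_cone l N F \<longleftrightarrow> (\<exists>c. (\<forall>k. 0 \<le> c k) \<and> (\<forall>x. F x = (\<Sum>k\<le>N. c k * gegenbauer l k x)))"

lemma gegenbauer_cone_self: "k \<le> N \<Longrightarrow> gegenbauer_cone l N (gegenbauer l k)"
  unfolding gegenbauer_cone_def by (intro exI[of _ "\<lambda>j. if j =
      k then 1 else 0"]) (simp add: if_distrib[of "\<lambda>a. a * _"] cong: if_cong)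

lemma gegenbauer_cone_add: "gegenbauer_cone l N F \<Longrightarrow> gegenbauer_cone l N G \<Longrightarrow> gegenbauer_cone l N (\<lambda>x. F x + G x)"
  unfolding gegenbauer_cone_def
proof (elim exE conjE)
  fix c d assume "\<forall>k. 0 \<le> c k" "\<forall>k. 0 \<le> d k" "\<forall>x. F x = (\<Sum>k\<le>N. c k * gegenbauer l k x)" "\<forall>x. G x =
      (\<Sum>k\<le>N. d k * gegenbauer l k x)"
  then show "\<exists>c. (\<forall>k. 0 \<le> c k) \<and> (\<forall>x. F x + G x = (\<Sum>k\<le>N. c k * gegenbauer l k x))"
    by (intro exI[of _ "\<lambda>k. c k + d k"]) (simp add: sum.distrib distrib_right)
qed

lemma gegenbauer_cone_scale: "gegenbauer_cone l N F \<Longrightarrow> a \<ge> 0 \<Longrightarrow> gegenbauer_cone l N (\<lambda>x. a * F x)"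
  unfolding gegenbauer_cone_def
proof (elim exE conjE)
  fix c assume "a \<ge> 0" "\<forall>k. 0 \<le> c k" "\<forall>x. F x = (\<Sum>k\<le>N. c k * gegenbauer l k x)"
  then show "\<exists>c. (\<forall>k. 0 \<le> c k) \<and> (\<forall>x. a * F x = (\<Sum>k\<le>N. c k * gegenbauer l k x))"
    by (intro exI[of _ "\<lambda>k. a * c k"]) (simp add: sum_distrib_left mult.assoc)
qed

lemma gegenbauer_cone_sum: "finite A \<Longrightarrow> (\<And>i. i \<in> A \<Longrightarrow> gegenbauer_cone l N (F i)) \<Longrightarrow>
    gegenbauer_cone l N (\<lambda>x. \<Sum>i\<in>A. F i x)"
proof (induction A rule: finite_induct)
  case empty
  show ?case unfolding gegenbauer_cone_def by (intro exI[of _ "\<lambda>_. 0"]) simp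
qed (auto intro: gegenbauer_cone_add)

lemma gegenbauer_cone_mult_x_self:
  assumes "l \<ge> 0" "k \<le> N"
  shows "gegenbauer_cone l (Suc N) (\<lambda>x. x * gegenbauer l k x)"
proof (cases "k = 0")
  case True
  moreover have "gegenbauer l 1 = (\<lambda>x. x)" by (rule ext) simp
  ultimately show ?thesis using gegenbauer_cone_self[of 1 "Suc N" l] by simp
next
  case False
  have "x * gegenbauer l k x = (real k + 2 * l) / (2 * (real k + l)) * gegenbauer l (Suc k) x + real k / (2 *
      (real k + l)) * gegenbauer l (k - 1) x" for x
  proof -
    have "real k + l \<noteq> 0" using False assms by simp
    then have "x * gegenbauer l k x = (2 * (real k + l) * x * gegenbauer l k x) / (2 * (real k + l))" by simp
    also have "2 * (real k + l) * x * gegenbauer l k x =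
        (real k + 2 * l) * gegenbauer l (Suc k) x + real k * gegenbauer l (k - 1) x"
      using gegenbauer_recurrence[OF assms(1), of k x] by simp
    finally show ?thesis by (simp only: add_divide_distrib[of "(real k + 2 * l) *
        gegenbauer l (Suc k) x"] times_divide_eq_left)
  qed
  then have eq: "(\<lambda>x. x * gegenbauer l k x) = (\<lambda>x. (real k + 2 * l) / (2 * (real k + l)) * gegenbauer l (Suc k) x +
      real k / (2 * (real k + l)) * gegenbauer l (k - 1) x)"
    by (rule ext)
  show ?thesis unfolding eq
    using assms by (intro gegenbauer_cone_add gegenbauer_cone_scale gegenbauer_cone_self) auto
qed

lemma gegenbauer_cone_mult:
  assumes "l \<ge> 0" "gegenbauer_cone l N F" "a \<ge> 0"
  shows "gegenbauer_cone l (Suc N) (\<lambda>x. (a + x) * F x)"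
proof -
  obtain c where c: "\<And>k. 0 \<le> c k" "\<And>x. F x = (\<Sum>k\<le>N. c k * gegenbauer l k x)"
    using assms(2) by (auto simp: gegenbauer_cone_def)
  have "gegenbauer_cone l (Suc N) (\<lambda>x. \<Sum>k\<le>N. c k * (a * gegenbauer l k x + x * gegenbauer l k x))"
    using assms c by (intro gegenbauer_cone_sum gegenbauer_cone_scale gegenbauer_cone_add
        gegenbauer_cone_mult_x_self gegenbauer_cone_self) auto
  moreover have "(a + x) * F x = (\<Sum>k\<le>N. c k * (a * gegenbauer l k x + x * gegenbauer l k x))" for x
    unfolding c sum_distrib_left by (intro sum.cong) (auto simp: algebra_simps)
  ultimately show ?thesis by simp
qed

lemma gegenbauer_cone_power:
  assumes "l \<ge> 0" "a \<ge> 0"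
  shows "gegenbauer_cone l N (\<lambda>x. (a + x) ^ N)"
proof (induction N)
  case 0 
  have "gegenbauer l 0 = (\<lambda>x. 1)" by (rule ext) simp
  then show ?case using gegenbauer_cone_self[of 0 0 l] by simp
qed (use gegenbauer_cone_mult[OF assms(1) _ assms(2)] in simp)

text \<open>
\<open>D\<close> is orthogonal to all polynomials, hence by Weierstrass to itself.
\<close>

lemma continuous_eq_0_if_coefficients_0:
  fixes D :: "real \<Rightarrow> real"
  assumes l: "l \<ge> 0" and D: "continuous_on UNIV D"
      and 0: "\<And>n. (\<integral>x. D x * gegenbauer l n x \<partial>gegenbauer_measure l) = 0" and x: "x \<in> {-1..1}"
  shows "D x = 0"
proof (rule continuous_eq_0_if_square_integral_0[OF l D _ x])
  have pw: "(\<integral>x. D x * x ^ N \<partial>gegenbauer_measure l) = 0" for N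
  proof -
    obtain c where c: "\<And>x. x ^ N = (\<Sum>k\<le>N. c k * gegenbauer l k x)"
      using gegenbauer_cone_power[OF l, of 0 N] by (auto simp: gegenbauer_cone_def)
    have "(\<integral>x. D x * x ^ N \<partial>gegenbauer_measure l) =
        (\<integral>x. (\<Sum>k\<le>N. c k * (D x * gegenbauer l k x)) \<partial>gegenbauer_measure l)"
      unfolding c sum_distrib_left by (simp add: mult_ac)
    also have "\<dots> = (\<Sum>k\<le>N. \<integral>x. c k * (D x * gegenbauer l k x) \<partial>gegenbauer_measure l)"
      using l D by (intro Bochner_Integration.integral_sum integrable_gegenbauer_measure_continuous
          continuous_intros continuous_on_gegenbauer') auto
    finally show ?thesis using 0 by simp
  qed
  have poly: "(\<integral>x. D x * g x \<partial>gegenbauer_measure l) = 0" if g: "real_polynomial_function g" for g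
  proof -
    obtain a N where a: "g = (\<lambda>x. \<Sum>i\<le>N. a i * x ^ i)"
      using real_polynomial_function_imp_sum[OF g] by auto
    have "(\<integral>x. D x * g x \<partial>gegenbauer_measure l) = (\<integral>x. (\<Sum>i\<le>N. a i * (D x * x ^ i)) \<partial>gegenbauer_measure l)"
      unfolding a sum_distrib_left by (simp add: mult_ac)
    also have "\<dots> = (\<Sum>i\<le>N. \<integral>x. a i * (D x * x ^ i) \<partial>gegenbauer_measure l)"
      using l D by (intro Bochner_Integration.integral_sum integrable_gegenbauer_measure_continuous
          continuous_intros) auto
    finally show ?thesis using pw by simp
  qed
  have iD: "integrable (gegenbauer_measure l) (\<lambda>x. \<bar>D x\<bar>)"
    using l D by (intro integrable_gegenbauer_measure_continuous continuous_intros)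
  define C where "C = (\<integral>x. \<bar>D x\<bar> \<partial>gegenbauer_measure l)"
  have C: "C \<ge> 0" by (simp add: C_def)
  have le: "(\<integral>x. (D x)\<^sup>2 \<partial>gegenbauer_measure l) \<le> e * C" if e: "e > 0" for e
  proof -
    obtain g where g: "real_polynomial_function g" "\<And>x. x \<in> {-1..1} \<Longrightarrow> \<bar>D x - g x\<bar> < e"
      using Stone_Weierstrass_real_polynomial_function[of "{-1..1::real}" D e] e continuous_on_subset[OF D]
      by (metis compact_Icc subset_UNIV)
    have gc: "continuous_on UNIV g"
      using g(1) by (simp add: continuous_on_polymonial_function real_polynomial_function_eq)
    have "(\<integral>x. (D x)\<^sup>2 \<partial>gegenbauer_measure l) = (\<integral>x. (D x)\<^sup>2 \<partial>gegenbauer_measure l) - (\<integral>x. D x *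
        g x \<partial>gegenbauer_measure l)"
      using poly[OF g(1)] by simp
    also have "\<dots> = (\<integral>x. (D x)\<^sup>2 - D x * g x \<partial>gegenbauer_measure l)"
      using l D gc by (intro Bochner_Integration.integral_diff[symmetric] integrable_gegenbauer_measure_continuous
          continuous_intros)
    also have "\<dots> \<le> (\<integral>x. e * \<bar>D x\<bar> \<partial>gegenbauer_measure l)"
    proof (rule integral_mono_AE)
      show "AE x in gegenbauer_measure l. (D x)\<^sup>2 - D x * g x \<le> e * \<bar>D x\<bar>"
        using AE_gegenbauer_measure_closed[of l]
      proof (rule eventually_mono)
        fix x :: real assume "x \<in> {-1..1}"
        then have "\<bar>D x - g x\<bar> \<le> e" using g(2) by (meson less_imp_le)
        then have "\<bar>D x\<bar> * \<bar>D x - g x\<bar> \<le> \<bar>D x\<bar> * e" by (intro mult_left_mono) auto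
        moreover have "(D x)\<^sup>2 - D x * g x = D x * (D x - g x)" by (simp add: power2_eq_square algebra_simps)
        moreover have "D x * (D x - g x) \<le> \<bar>D x\<bar> * \<bar>D x - g x\<bar>" by (metis abs_ge_self abs_mult)
        ultimately show "(D x)\<^sup>2 - D x * g x \<le> e * \<bar>D x\<bar>" by (simp add: mult.commute)
      qed
    qed (use l D gc in \<open>auto intro!: integrable_gegenbauer_measure_continuous continuous_intros\<close>)
    finally show ?thesis by (simp add: C_def)
  qed
  have "(\<integral>x. (D x)\<^sup>2 \<partial>gegenbauer_measure l) \<le> 0"
  proof (rule field_le_epsilon)
    fix e :: real assume e: "e > 0"
    have "(\<integral>x. (D x)\<^sup>2 \<partial>gegenbauer_measure l) \<le> (e / (C + 1)) * C"
      using e C by (intro le) auto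
    also have "\<dots> \<le> e" using e C by (simp add: field_simps)
    finally show "(\<integral>x. (D x)\<^sup>2 \<partial>gegenbauer_measure l) \<le> 0 + e" by simp
  qed
  moreover have "(\<integral>x. (D x)\<^sup>2 \<partial>gegenbauer_measure l) \<ge> 0" by simp
  ultimately show "(\<integral>x. (D x)\<^sup>2 \<partial>gegenbauer_measure l) = 0" by linarith
qed

section \<open>Positive semidefinite kernels and spheres\<close>

definition psd_form :: "nat \<Rightarrow> (nat \<Rightarrow> nat \<Rightarrow> real) \<Rightarrow> bool" where
  "psd_form n B \<longleftrightarrow> (\<forall>c. 0 \<le> (\<Sum>i<n. \<Sum>j<n. c i * c j * B i j))"

definition real_psd :: "'a set \<Rightarrow> ('a \<Rightarrow> 'a \<Rightarrow> real) \<Rightarrow> bool" where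
  "real_psd S K \<longleftrightarrow> (\<forall>n p. (\<forall>i<n. p i \<in> S) \<longrightarrow> psd_form n (\<lambda>i j. K (p i) (p j)))"

lemma real_psd_finite:
  assumes "real_psd S K" "finite I" "\<And>i. i \<in> I \<Longrightarrow> p i \<in> S"
  shows "0 \<le> (\<Sum>i\<in>I. \<Sum>j\<in>I. c i * c j * K (p i) (p j))"
proof -
  obtain h where h: "bij_betw h {..<card I} I"
    using ex_bij_betw_nat_finite[OF assms(2)] by (auto simp: atLeast0LessThan)
  have "\<forall>i<card I. p (h i) \<in> S"
    using h assms(3) by (auto simp: bij_betw_def)
  then have "psd_form (card I) (\<lambda>i j. K (p (h i)) (p (h j)))"
    using assms(1) unfolding real_psd_def by (drule_tac x="card I" in spec, drule_tac x="p \<circ> h" in spec) simp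
  then have "0 \<le> (\<Sum>i<card I. \<Sum>j<card I. c (h i) * c (h j) * K (p (h i)) (p (h j)))"
    unfolding psd_form_def by (drule_tac x="c \<circ> h" in spec) simp
  also have "\<dots> = (\<Sum>i<card I. \<Sum>j\<in>I. c (h i) * c j * K (p (h i)) (p j))"
    by (intro sum.cong refl sum.reindex_bij_betw[OF h])
  also have "\<dots> = (\<Sum>i\<in>I. \<Sum>j\<in>I. c i * c j * K (p i) (p j))"
    by (rule sum.reindex_bij_betw[OF h])
  finally show ?thesis .
qed

lemma real_psd_comp:
  assumes "real_psd T K" "\<And>p. p \<in> S \<Longrightarrow> h p \<in> T"
    and "\<And>p q. p \<in> S \<Longrightarrow> q \<in> S \<Longrightarrow> L p q = K (h p) (h q)"
  shows "real_psd S L"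
  unfolding real_psd_def psd_form_def
proof (intro allI impI)
  fix n and p :: "nat \<Rightarrow> 'b" and c :: "nat \<Rightarrow> real" assume p: "\<forall>i<n. p i \<in> S"
  have "0 \<le> (\<Sum>i<n. \<Sum>j<n. c i * c j * K (h (p i)) (h (p j)))"
    using real_psd_finite[OF assms(1), of "{..<n}" "\<lambda>i. h (p i)" c] assms(2) p by simp
  also have "\<dots> = (\<Sum>i<n. \<Sum>j<n. c i * c j * L (p i) (p j))"
    using p assms(3) by (intro sum.cong refl) simp
  finally show "0 \<le> (\<Sum>i<n. \<Sum>j<n. c i * c j * L (p i) (p j))" .
qed

text \<open>
For a real kernel, complex coefficients give nothing beyond real ones except symmetry: the real and
imaginary parts of the coefficients contribute separately to the real part of the sum, and the
imaginary part of the sum vanishes exactly for symmetric kernels.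
\<close>

lemma positive_definite_on_iff:
  "positive_definite_on S K \<longleftrightarrow> (\<forall>x\<in>S. \<forall>y\<in>S. K x y = K y x) \<and> real_psd S K"
proof (intro iffI conjI ballI)
  assume pd: "positive_definite_on S K"
  then have pd': "(\<Sum>i<n. \<Sum>j<n. c i * cnj (c j) * of_real (K (p i) (p j))) \<in> \<real>\<^sub>\<ge>\<^sub>0"
    if "\<forall>i<n. p i \<in> S" for n :: nat and p :: "nat \<Rightarrow> 'a" and c
    using that unfolding positive_definite_on_def by blast
  {
    fix x y assume "x \<in> S" "y \<in> S"
    then have "(\<Sum>i<(2::nat). \<Sum>j<(2::nat). (\<lambda>i. if i = 0 then 1 else \<i>) i * cnj ((\<lambda>i. if i = 0 then 1 else \<i>) j) *
        of_real (K ((\<lambda>i. if i = 0 then x else y) i) ((\<lambda>i. if i = 0 then x else y) j))) \<in> (\<real>\<^sub>\<ge>\<^sub>0 :: complex set)"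
      by (intro pd') auto
    then show "K x y = K y x"
      by (auto simp: numeral_2_eq_2 complex_nonneg_Reals_iff)
  }
  show "real_psd S K"
    unfolding real_psd_def psd_form_def
  proof (intro allI impI)
    fix n and p :: "nat \<Rightarrow> 'a" and c :: "nat \<Rightarrow> real" assume "\<forall>i<n. p i \<in> S"
    then have "(\<Sum>i<n. \<Sum>j<n. complex_of_real (c i) * cnj (complex_of_real (c j)) * of_real (K (p i) (p j))) \<in> \<real>\<^sub>\<ge>\<^sub>0"
      by (rule pd')
    also have "(\<Sum>i<n. \<Sum>j<n. complex_of_real (c i) * cnj (complex_of_real (c j)) * of_real (K (p i) (p j))) =
        complex_of_real (\<Sum>i<n. \<Sum>j<n. c i * c j * K (p i) (p j))" by simp
    finally show "0 \<le> (\<Sum>i<n. \<Sum>j<n. c i * c j * K (p i) (p j))" by (simp only: nonneg_Reals_of_real_iff)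
  qed
next
  assume *: "(\<forall>x\<in>S. \<forall>y\<in>S. K x y = K y x) \<and> real_psd S K"
  show "positive_definite_on S K"
    unfolding positive_definite_on_def
  proof (intro allI impI)
    fix n and p :: "nat \<Rightarrow> 'a" and c :: "nat \<Rightarrow> complex" assume p: "\<forall>i<n. p i \<in> S"
    let ?s = "\<Sum>i<n. \<Sum>j<n. c i * cnj (c j) * of_real (K (p i) (p j))"
    have "Re ?s = (\<Sum>i<n. \<Sum>j<n. Re (c i) * Re (c j) * K (p i) (p j)) + (\<Sum>i<n. \<Sum>j<n. Im (c i) * Im (c j) *
        K (p i) (p j))"
      by (simp add: sum.distrib[symmetric] algebra_simps)
    moreover have "0 \<le> (\<Sum>i<n. \<Sum>j<n. b i * b j * K (p i) (p j))" for b
      using * p by (simp add: real_psd_def psd_form_def)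
    ultimately have re: "0 \<le> Re ?s" by simp
    have "Im ?s = (\<Sum>i<n. \<Sum>j<n. Im (c i) * Re (c j) * K (p i) (p j)) - (\<Sum>i<n. \<Sum>j<n. Re (c i) * Im (c j) *
        K (p i) (p j))"
      by (simp add: sum_subtractf[symmetric] algebra_simps)
    also have "(\<Sum>i<n. \<Sum>j<n. Re (c i) * Im (c j) * K (p i) (p j)) =
        (\<Sum>j<n. \<Sum>i<n. Re (c i) * Im (c j) * K (p i) (p j))"
      by (rule sum.swap)
    also have "\<dots> = (\<Sum>i<n. \<Sum>j<n. Im (c i) * Re (c j) * K (p i) (p j))"
      using * p by (intro sum.cong refl) auto
    finally show "?s \<in> \<real>\<^sub>\<ge>\<^sub>0" using re by (simp add: complex_nonneg_Reals_iff)
  qed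
qed

lemma mem_nsphere: "\<xi> \<in> topspace (nsphere d) \<longleftrightarrow> (\<Sum>i\<le>d. (\<xi> i)\<^sup>2) = 1 \<and> (\<forall>i>d. \<xi> i = 0)"
  by (auto simp: nsphere)

lemma sphere_inner_commute: "sphere_inner d \<xi> \<eta> = sphere_inner d \<eta> \<xi>"
  by (simp add: sphere_inner_def mult.commute)

lemma abs_sphere_inner_le_1:
  assumes "\<xi> \<in> topspace (nsphere d)" "\<eta> \<in> topspace (nsphere d)"
  shows "\<bar>sphere_inner d \<xi> \<eta>\<bar> \<le> 1"
proof -
  have "(sphere_inner d \<xi> \<eta>)\<^sup>2 \<le> (\<Sum>i\<le>d. (\<xi> i)\<^sup>2) * (\<Sum>i\<le>d. (\<eta> i)\<^sup>2)"
    unfolding sphere_inner_def by (rule Cauchy_Schwarz_ineq_sum)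
  then show ?thesis using assms by (simp add: mem_nsphere abs_square_le_1)
qed

lemma cos_sphere_dist:
  assumes "\<xi> \<in> topspace (nsphere d)" "\<eta> \<in> topspace (nsphere d)"
  shows "cos (sphere_dist d \<xi> \<eta>) = sphere_inner d \<xi> \<eta>"
  using abs_sphere_inner_le_1[OF assms] by (simp add: sphere_dist_def cos_arccos_abs)

lemma nsphere_0_inner:
  assumes "\<xi> \<in> topspace (nsphere 0)" "\<eta> \<in> topspace (nsphere 0)"
  shows "sphere_inner 0 \<xi> \<eta> = 1 \<or> sphere_inner 0 \<xi> \<eta> = -1"
  using assms by (auto simp: mem_nsphere sphere_inner_def power2_eq_1_iff)

text \<open>
The point of the next higher sphere at height \<open>x\<close> above the direction \<open>\<zeta>\<close>.
\<close>

definition sphere_embed :: "nat \<Rightarrow> real \<Rightarrow> (nat \<Rightarrow> real) \<Rightarrow> nat \<Rightarrow> real" where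
  "sphere_embed d x \<zeta> = (\<lambda>i. if i = Suc d then x else sqrt (1 - x\<^sup>2) * \<zeta> i)"

lemma sphere_embed_mem:
  assumes "\<zeta> \<in> topspace (nsphere d)" "\<bar>x\<bar> \<le> 1"
  shows "sphere_embed d x \<zeta> \<in> topspace (nsphere (Suc d))"
proof -
  have "(\<Sum>i\<le>d. (sphere_embed d x \<zeta> i)\<^sup>2) = (1 - x\<^sup>2) * (\<Sum>i\<le>d. (\<zeta> i)\<^sup>2)"
    using assms(2) by (simp add: sphere_embed_def power_mult_distrib sum_distrib_left abs_square_le_1)
  then show ?thesis using assms by (auto simp: mem_nsphere sphere_embed_def)
qed

lemma sphere_embed_inner:
  "sphere_inner (Suc d) (sphere_embed d x \<zeta>) (sphere_embed d y \<zeta>') =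
    x * y + sqrt (1 - x\<^sup>2) * sqrt (1 - y\<^sup>2) * sphere_inner d \<zeta> \<zeta>'"
  by (simp add: sphere_inner_def sphere_embed_def sum_distrib_left mult_ac)

lemma sphere_embed_surj:
  assumes "\<xi> \<in> topspace (nsphere (Suc d))"
  obtains \<zeta> where "\<zeta> \<in> topspace (nsphere d)" "\<bar>\<xi> (Suc d)\<bar> \<le> 1" "\<xi> = sphere_embed d (\<xi> (Suc d)) \<zeta>"
proof -
  define s where "s = sqrt (1 - (\<xi> (Suc d))\<^sup>2)"
  have 0: "\<xi> i = 0" if "i > Suc d" for i using assms that by (simp add: mem_nsphere)
  have sum: "(\<Sum>i\<le>d. (\<xi> i)\<^sup>2) = 1 - (\<xi> (Suc d))\<^sup>2" using assms by (simp add: mem_nsphere)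
  have ge: "1 - (\<xi> (Suc d))\<^sup>2 \<ge> 0" unfolding sum[symmetric] by (intro sum_nonneg) auto
  have x1: "\<bar>\<xi> (Suc d)\<bar> \<le> 1" using ge by (simp add: abs_square_le_1)
  have s2: "s\<^sup>2 = 1 - (\<xi> (Suc d))\<^sup>2" using ge by (simp add: s_def)
  show ?thesis
  proof (cases "s = 0")
    case True
    then have "(\<Sum>i\<le>d. (\<xi> i)\<^sup>2) = 0" using s2 sum by simp
    then have "\<forall>i\<in>{..d}. (\<xi> i)\<^sup>2 = 0" by (subst (asm) sum_nonneg_eq_0_iff) auto
    then have z: "\<xi> i = 0" if "i \<noteq> Suc d" for i
      using 0[of i] that by (cases "i \<le> d") auto
    show ?thesis
    proof (rule that[of "\<lambda>n. if n = 0 then 1 else 0"])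
      show "(\<lambda>n. if n = 0 then 1 else 0) \<in> topspace (nsphere d)" by (rule in_topspace_nsphere)
      show "\<xi> = sphere_embed d (\<xi> (Suc d)) (\<lambda>n. if n = 0 then 1 else 0)"
        using True z by (auto simp: sphere_embed_def s_def)
    qed (rule x1)
  next
    case False
    define \<zeta> where "\<zeta> = (\<lambda>i. if i \<le> d then \<xi> i / s else 0)"
    have "(\<Sum>i\<le>d. (\<zeta> i)\<^sup>2) = (\<Sum>i\<le>d. (\<xi> i)\<^sup>2) / s\<^sup>2"
      by (simp add: \<zeta>_def power_divide sum_divide_distrib)
    then have "(\<Sum>i\<le>d. (\<zeta> i)\<^sup>2) = 1" using False unfolding sum s2[symmetric] by simp
    then have "\<zeta> \<in> topspace (nsphere d)" by (simp add: mem_nsphere \<zeta>_def)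
    moreover have "\<xi> = sphere_embed d (\<xi> (Suc d)) \<zeta>"
      using False 0 by (auto simp: sphere_embed_def s_def[symmetric] \<zeta>_def)
    ultimately show ?thesis using x1 that by blast
  qed
qed

text \<open>
The zonal harmonic of degree \<open>k\<close> on the sphere of dimension \<open>d\<close>. On \<open>S\<^sup>0\<close> only the values
\<open>1\<close> and \<open>-1\<close> of \<open>z\<close> occur, and powers replace the Gegenbauer polynomials of index \<open>-1/2\<close>.
\<close>

definition zonal :: "nat \<Rightarrow> nat \<Rightarrow> real \<Rightarrow> real" where
  "zonal d k z = (if d = 0 then z ^ k else gegenbauer ((real d - 1) / 2) k z)"

lemma zonal_Suc [simp]: "zonal (Suc d) k z = gegenbauer (real d / 2) k z"
  by (simp add: zonal_def)

lemma zonal_recurrence: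
  assumes "d > 0 \<or> z\<^sup>2 = 1" and e: "addition_scale (real d - 1) k \<noteq> 0"
  shows "z * zonal d k z = addition_up (real d - 1) k * zonal d (Suc k) z + addition_down (real d - 1) k *
      zonal d (k - 1) z"
proof (cases "k = 0")
  case True
  then show ?thesis by (simp add: zonal_def addition_up.simps addition_down.simps)
next
  case k: False
  show ?thesis
  proof (cases "d = 0")
    case True
    have "k = 1"
    proof (rule ccontr)
      assume "k \<noteq> 1"
      then have "k \<ge> 2" using k by simp
      then have "addition_scale (- 1) k = 0"
      proof (induction k rule: dec_induct)
        case base
        show ?case by (simp add: numeral_2_eq_2 addition_up.simps)
      qed simp
      then show False using e True by simp
    qed
    then show ?thesis using True assms(1) by (simp add: zonal_def addition_up.simps addition_down.simps
        power2_eq_square)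
  next
    case False
    define l where "l = (real d - 1) / 2"
    have l: "l \<ge> 0" using False by (simp add: l_def)
    have a: "real d - 1 = 2 * l" by (simp add: l_def)
    have ne: "2 * real k + 2 * l > 0" using k l by simp
    have l2: "2 * l / 2 = l" by simp
    have "(2 * real k + 2 * l) * (z * gegenbauer l k z) =
        (real k + 2 * l) * gegenbauer l (Suc k) z + real k * gegenbauer l (k - 1) z"
      using gegenbauer_recurrence[OF l, of k z] by (simp add: algebra_simps)
    then have "z * gegenbauer l k z = ((real k + 2 * l) * gegenbauer l (Suc k) z + real k * gegenbauer l (k -
        1) z) / (2 * real k + 2 * l)"
      using ne by (metis less_irrefl nonzero_mult_div_cancel_left)
    then show ?thesis using False k unfolding a
      by (simp only: zonal_def if_False addition_up.simps addition_down.simps l_def[symmetric]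
          add_divide_distrib[of "(real k + 2 * l) * gegenbauer l (Suc k) z"] times_divide_eq_left l2)
  qed
qed

lemma gegenbauer_addition_zonal:
  assumes x: "\<bar>x\<bar> \<le> 1" and y: "\<bar>y\<bar> \<le> 1" and "d > 0 \<or> z\<^sup>2 = 1"
  shows "gegenbauer (real d / 2) n (x * y + sqrt (1 - x\<^sup>2) * sqrt (1 - y\<^sup>2) * z) =
    (\<Sum>k\<le>n. addition_coeff (real d / 2) n k * assoc_gegenbauer (real d / 2) n k x *
        assoc_gegenbauer (real d / 2) n k y * zonal d k z)"
proof (rule gegenbauer_addition[OF _ x y])
  show "zonal d 0 z = 1" by (simp add: zonal_def)
  show "z * zonal d k z = addition_up (2 * (real d / 2) - 1) k * zonal d (Suc k) z + addition_down (2 *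
      (real d / 2) - 1) k * zonal d (k - 1) z"
    if "addition_scale (2 * (real d / 2) - 1) k \<noteq> 0" for k
    using zonal_recurrence[OF assms(3), of k] that by simp
qed simp

text \<open>
Kernels whose entrywise product with every positive semidefinite matrix is positive semidefinite. By
Schur's product theorem these are just the positive semidefinite kernels. The definition by products
is stable, directly by its form, under sums of kernels \<open>a \<phi>(p) \<phi>(q) K(p, q)\<close> with \<open>a \<ge> 0\<close> and \<open>K\<close> a
multiplier, and these are the steps that build zonal harmonics.
\<close>

definition multiplier :: "'a set \<Rightarrow> ('a \<Rightarrow> 'a \<Rightarrow> real) \<Rightarrow> bool" where
  "multiplier S K \<longleftrightarrow> (\<forall>n p B. (\<forall>i<n. p i \<in> S) \<longrightarrow> psd_form n B \<longrightarrow> psd_form n (\<lambda>i j. B i j * K (p i) (p j)))"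

lemma psd_form_rank_one:
  assumes "psd_form n B" "a \<ge> 0"
  shows "psd_form n (\<lambda>i j. B i j * (a * \<phi> i * \<phi> j))"
  unfolding psd_form_def
proof
  fix c :: "nat \<Rightarrow> real"
  have "0 \<le> a * (\<Sum>i<n. \<Sum>j<n. (c i * \<phi> i) * (c j * \<phi> j) * B i j)"
    using assms unfolding psd_form_def by (intro mult_nonneg_nonneg) (auto dest: spec[of _ "\<lambda>i. c i * \<phi> i"])
  then show "0 \<le> (\<Sum>i<n. \<Sum>j<n. c i * c j * (B i j * (a * \<phi> i * \<phi> j)))"
    by (simp add: sum_distrib_left mult_ac)
qed

lemma psd_form_sum:
  assumes "\<And>k. k \<in> A \<Longrightarrow> psd_form n (B k)"
  shows "psd_form n (\<lambda>i j. \<Sum>k\<in>A. B k i j)"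
  unfolding psd_form_def
proof
  fix c :: "nat \<Rightarrow> real"
  have "0 \<le> (\<Sum>k\<in>A. \<Sum>i<n. \<Sum>j<n. c i * c j * B k i j)"
    using assms unfolding psd_form_def by (intro sum_nonneg[of A]) blast
  also have "\<dots> = (\<Sum>i<n. \<Sum>k\<in>A. \<Sum>j<n. c i * c j * B k i j)"
    by (rule sum.swap)
  also have "\<dots> = (\<Sum>i<n. \<Sum>j<n. \<Sum>k\<in>A. c i * c j * B k i j)"
    by (intro sum.cong refl sum.swap)
  finally show "0 \<le> (\<Sum>i<n. \<Sum>j<n. c i * c j * (\<Sum>k\<in>A. B k i j))"
    by (simp add: sum_distrib_left)
qed

text \<open>
Induction on the dimension: by the addition theorem a zonal harmonic of \<open>S\<^sup>d\<^sup>+\<^sup>1\<close> is a sum, with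
nonnegative coefficients, of zonal harmonics of \<open>S\<^sup>d\<close> times functions of the two heights.
\<close>

theorem zonal_multiplier: "multiplier (topspace (nsphere d)) (\<lambda>\<xi> \<eta>. zonal d n (sphere_inner d \<xi> \<eta>))"
proof (induction d arbitrary: n)
  case 0
  show ?case unfolding multiplier_def
  proof (intro allI impI)
    fix N and p :: "nat \<Rightarrow> nat \<Rightarrow> real" and B assume B: "psd_form N B"
    show "psd_form N (\<lambda>i j. B i j * zonal 0 n (sphere_inner 0 (p i) (p j)))"
      using psd_form_rank_one[OF B, of 1 "\<lambda>i. p i 0 ^ n"]
      by (simp add: zonal_def sphere_inner_def power_mult_distrib)
  qed
next
  case (Suc d)
  show ?case unfolding multiplier_def
  proof (intro allI impI)
    fix N and p :: "nat \<Rightarrow> nat \<Rightarrow> real" and B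
    assume p: "\<forall>i<N. p i \<in> topspace (nsphere (Suc d))" and B: "psd_form N B"
    define x where "x = (\<lambda>i. p i (Suc d))"
    have "\<forall>i. \<exists>\<zeta>. i < N \<longrightarrow> \<zeta> \<in> topspace (nsphere d) \<and> \<bar>x i\<bar> \<le> 1 \<and> p i = sphere_embed d (x i) \<zeta>"
      using p sphere_embed_surj unfolding x_def by metis
    then obtain \<zeta> where \<zeta>: "\<And>i. i < N \<Longrightarrow> \<zeta> i \<in> topspace (nsphere d)" "\<And>i. i < N \<Longrightarrow> \<bar>x i\<bar> \<le> 1"
      "\<And>i. i < N \<Longrightarrow> p i = sphere_embed d (x i) (\<zeta> i)" by metis
    define l where "l = real d / 2"
    have eq: "zonal (Suc d) n (sphere_inner (Suc d) (p i) (p j)) =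
       (\<Sum>k\<le>n. zonal d k (sphere_inner d (\<zeta> i) (\<zeta> j)) * (addition_coeff l n k * assoc_gegenbauer l n k (x i) *
           assoc_gegenbauer l n k (x j)))"
      if ij: "i < N" "j < N" for i j
    proof -
      have "d > 0 \<or> (sphere_inner d (\<zeta> i) (\<zeta> j))\<^sup>2 = 1"
        using nsphere_0_inner[of "\<zeta> i" "\<zeta> j"] \<zeta>(1) ij by (cases "d = 0") auto
      then show ?thesis
        using gegenbauer_addition_zonal[OF \<zeta>(2)[OF ij(1)] \<zeta>(2)[OF ij(2)]] 
        by (simp add: \<zeta>(3)[OF ij(1)] \<zeta>(3)[OF ij(2)] sphere_embed_inner l_def mult_ac)
    qed
    have "psd_form N (\<lambda>i j. \<Sum>k\<le>n. (B i j * zonal d k (sphere_inner d (\<zeta> i) (\<zeta> j))) *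
        (addition_coeff l n k * assoc_gegenbauer l n k (x i) * assoc_gegenbauer l n k (x j)))"
    proof (intro psd_form_sum psd_form_rank_one)
      fix k
      show "psd_form N (\<lambda>i j. B i j * zonal d k (sphere_inner d (\<zeta> i) (\<zeta> j)))"
        using Suc.IH[of k] B \<zeta>(1) unfolding multiplier_def by blast
      show "0 \<le> addition_coeff l n k" by (rule addition_coeff_nonneg) (simp add: l_def)
    qed
    then show "psd_form N (\<lambda>i j. B i j * zonal (Suc d) n (sphere_inner (Suc d) (p i) (p j)))"
      unfolding psd_form_def
    proof (rule all_forward)
      fix c :: "nat \<Rightarrow> real"
      assume "0 \<le> (\<Sum>i<N. \<Sum>j<N. c i * c j * (\<Sum>k\<le>n. (B i j * zonal d k (sphere_inner d (\<zeta> i) (\<zeta> j))) *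
        (addition_coeff l n k * assoc_gegenbauer l n k (x i) * assoc_gegenbauer l n k (x j))))"
      also have "\<dots> = (\<Sum>i<N. \<Sum>j<N. c i * c j * (B i j * zonal (Suc d) n (sphere_inner (Suc d) (p i) (p j))))"
        by (intro sum.cong refl) (simp add: eq sum_distrib_left mult.assoc del: zonal_Suc)
      finally show "0 \<le> (\<Sum>i<N. \<Sum>j<N. c i * c j * (B i j * zonal (Suc d) n (sphere_inner (Suc d) (p i) (p j))))" .
    qed
  qed
qed

section \<open>Spherical means\<close>

context finite_interval_measure
begin

lemma continuous_on_integral:
  fixes h :: "'a::euclidean_space \<Rightarrow> real \<Rightarrow> real"
  assumes h: "continuous_on UNIV (\<lambda>q. h (fst q) (snd q))"
  shows "continuous_on UNIV (\<lambda>p. \<integral>z. h p z \<partial>\<nu>)"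
proof -
  have cz: "continuous_on UNIV (h p)" for p
    using continuous_on_compose2[OF h, of UNIV "\<lambda>z. (p, z)"] by (simp add: continuous_intros)
  have cp: "continuous_on UNIV (\<lambda>p. h p z)" for z
    using continuous_on_compose2[OF h, of UNIV "\<lambda>p. (p, z)"] by (simp add: continuous_intros)
  have "(\<lambda>n. \<integral>z. h (s n) z \<partial>\<nu>) \<longlonglongrightarrow> (\<integral>z. h p z \<partial>\<nu>)" if s: "s \<longlonglongrightarrow> p" for s :: "nat \<Rightarrow> 'a" and p
  proof -
    define Q where "Q = insert p (range s) \<times> {-1..1::real}"
    have "compact Q" unfolding Q_def using compact_sequence_with_limit[OF s] by (intro compact_Times) auto
    then have "compact ((\<lambda>q. h (fst q) (snd q)) ` Q)"
      by (intro compact_continuous_image continuous_on_subset[OF h]) auto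
    then have "bounded ((\<lambda>q. h (fst q) (snd q)) ` Q)" by (rule compact_imp_bounded)
    then obtain B where "\<forall>x\<in>(\<lambda>q. h (fst q) (snd q)) ` Q. norm x \<le> B"
      using bounded_iff by blast
    then have B: "\<bar>h p z\<bar> \<le> B" "\<bar>h (s n) z\<bar> \<le> B" if "z \<in> {-1..1}" for z n
      using that unfolding Q_def by auto
    show ?thesis
    proof (rule integral_dominated_convergence[where w = "\<lambda>_. B"])
      show "h p \<in> borel_measurable \<nu>" "\<And>n. h (s n) \<in> borel_measurable \<nu>"
        using borel_measurable_continuous_onI[OF cz] by simp_all
      show "AE z in \<nu>. (\<lambda>n. h (s n) z) \<longlonglongrightarrow> h p z"
        by (intro AE_I2 continuous_on_tendsto_compose[OF cp s]) auto
      show "\<And>n. AE z in \<nu>. norm (h (s n) z) \<le> B"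
        using AE_interval by (rule eventually_mono) (use B in simp)
    qed simp
  qed
  then show ?thesis unfolding continuous_on_sequentially comp_def by blast
qed

text \<open>
The integral version of positive semidefiniteness. Rounding both variables down to multiples of
\<open>1 / N\<close> turns the integral into a finite sum to which the hypothesis applies, and by uniform
continuity the error is arbitrarily small.
\<close>

lemma double_integral_nonneg:
  fixes F :: "real \<Rightarrow> real \<Rightarrow> real"
  assumes F: "continuous_on UNIV (\<lambda>q. F (fst q) (snd q))" and psd: "real_psd {-1..1} F"
    and \<phi>: "continuous_on UNIV \<phi>"
  shows "0 \<le> (\<integral>x. (\<integral>y. F x y * \<phi> y \<partial>\<nu>) * \<phi> x \<partial>\<nu>)"
proof (rule field_le_epsilon)
  fix e :: real assume e: "e > 0"
  define C where "C = (\<integral>x. \<bar>\<phi> x\<bar> \<partial>\<nu>)"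
  have C: "C \<ge> 0" by (simp add: C_def)
  \<comment> \<open>the error of the discretised double integral will be at most \<open>\<epsilon> * C\<^sup>2\<close>\<close>
  define \<epsilon> where "\<epsilon> = e / (C\<^sup>2 + 1)"
  have \<epsilon>: "\<epsilon> > 0" unfolding \<epsilon>_def using e by (intro divide_pos_pos add_nonneg_pos) auto
  have \<epsilon>C: "\<epsilon> * C\<^sup>2 \<le> e"
  proof -
    have "C\<^sup>2 + 1 > 0" by (intro add_nonneg_pos) auto
    then show ?thesis using e by (simp add: \<epsilon>_def field_simps)
  qed
  have i\<phi>: "integrable \<nu> (\<lambda>x. \<bar>\<phi> x\<bar>)" by (intro integrable_continuous continuous_intros \<phi>)
  have \<phi>m [measurable]: "\<phi> \<in> borel_measurable borel" by (rule borel_measurable_continuous_onI[OF \<phi>])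
  have "uniformly_continuous_on ({-1..1} \<times> {-1..1}) (\<lambda>q. F (fst q) (snd q))"
    by (intro compact_uniformly_continuous continuous_on_subset[OF F] compact_Times) auto
  then obtain \<delta> where \<delta>: "\<delta> > 0" and uc: "\<And>q q'. q \<in> {-1..1} \<times> {-1..1} \<Longrightarrow> q' \<in> {-1..1} \<times> {-1..1} \<Longrightarrow>
      dist q' q < \<delta> \<Longrightarrow> dist (F (fst q') (snd q')) (F (fst q) (snd q)) < \<epsilon>"
    using \<epsilon> unfolding uniformly_continuous_on_def by metis
  obtain N :: nat where N: "N > 0" "2 / real N < \<delta>"
    using reals_Archimedean2[of "2 / \<delta>"] \<delta> by (metis divide_less_eq gr0I mult.commute not_less_iff_gr_or_eq
        of_nat_0_less_iff divide_pos_pos less_trans zero_less_numeral)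
  define I where "I = {- int N..int N}"
  define pt where "pt = (\<lambda>k::int. real_of_int k / real N)"
  define cell where "cell = (\<lambda>k x. if \<lfloor>real N * x\<rfloor> = k then 1 else 0::real)"
  have cellm [measurable]: "cell k \<in> borel_measurable borel" for k unfolding cell_def by measurable
  have pt: "pt k \<in> {-1..1}" if "k \<in> I" for k
    using that N by (auto simp: pt_def I_def field_simps)
  define r where "r = (\<lambda>k. \<integral>x. cell k x * \<phi> x \<partial>\<nu>)"
  have icell: "integrable \<nu> (\<lambda>x. cell k x * \<phi> x)" for k
    by (rule Bochner_Integration.integrable_bound[OF i\<phi>]) (auto simp: cell_def)
  \<comment> \<open>\<open>F x y * \<phi> y\<close> with \<open>x\<close> and \<open>y\<close> rounded in \<open>F\<close>, written as a finite sum over the cells\<close>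
  define T where "T = (\<lambda>x y. \<Sum>k\<in>I. \<Sum>l\<in>I. cell k x * (cell l y * \<phi> y) * F (pt k) (pt l))"
  have fin: "finite I" by (simp add: I_def)
  have Ty: "(\<integral>y. T x y \<partial>\<nu>) = (\<Sum>k\<in>I. \<Sum>l\<in>I. cell k x * r l * F (pt k) (pt l))" for x
  proof -
    have "T x y = (\<Sum>k\<in>I. \<Sum>l\<in>I. (cell k x * F (pt k) (pt l)) * (cell l y * \<phi> y))" for y
      unfolding T_def by (simp add: mult_ac)
    then have "(\<integral>y. T x y \<partial>\<nu>) = (\<integral>y. (\<Sum>k\<in>I. \<Sum>l\<in>I. (cell k x * F (pt k) (pt l)) * (cell l y * \<phi> y)) \<partial>\<nu>)"
      by (simp only:)
    also have "\<dots> = (\<Sum>k\<in>I. \<Sum>l\<in>I. (cell k x * F (pt k) (pt l)) * r l)"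
      using icell by (simp add: Bochner_Integration.integral_sum r_def)
    finally show ?thesis by (simp add: mult_ac)
  qed
  have iTy: "integrable \<nu> (\<lambda>y. T x y)" for x
    unfolding T_def by (intro Bochner_Integration.integrable_sum integrable_mult_left integrable_mult_right icell)
  have iTx: "integrable \<nu> (\<lambda>x. (\<integral>y. T x y \<partial>\<nu>) * \<phi> x)"
  proof -
    have "(\<lambda>x. (\<integral>y. T x y \<partial>\<nu>) * \<phi> x) = (\<lambda>x. \<Sum>k\<in>I. \<Sum>l\<in>I. (r l * F (pt k) (pt l)) * (cell k x * \<phi> x))"
      unfolding Ty by (simp add: sum_distrib_left sum_distrib_right mult_ac)
    then show ?thesis using icell by simp
  qed
  have T0: "0 \<le> (\<integral>x. (\<integral>y. T x y \<partial>\<nu>) * \<phi> x \<partial>\<nu>)"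
  proof -
    have "0 \<le> (\<Sum>k\<in>I. \<Sum>l\<in>I. r k * r l * F (pt k) (pt l))"
      by (rule real_psd_finite[OF psd fin pt])
    also have "\<dots> = (\<integral>x. (\<Sum>k\<in>I. \<Sum>l\<in>I. (r l * F (pt k) (pt l)) * (cell k x * \<phi> x)) \<partial>\<nu>)"
    proof -
      have "(\<integral>x. (\<Sum>k\<in>I. \<Sum>l\<in>I. (r l * F (pt k) (pt l)) * (cell k x * \<phi> x)) \<partial>\<nu>) =
          (\<Sum>k\<in>I. \<Sum>l\<in>I. (r l * F (pt k) (pt l)) * r k)"
        using icell by (simp add: Bochner_Integration.integral_sum r_def)
      then show ?thesis by (simp add: mult_ac)
    qed
    also have "\<dots> = (\<integral>x. (\<integral>y. T x y \<partial>\<nu>) * \<phi> x \<partial>\<nu>)"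
      unfolding Ty by (simp add: sum_distrib_left sum_distrib_right mult_ac)
    finally show ?thesis .
  qed
  have close: "\<bar>T x y - F x y * \<phi> y\<bar> \<le> \<epsilon> * \<bar>\<phi> y\<bar>" if x: "x \<in> {-1..1}" and y: "y \<in> {-1..1}" for x y
  proof -
    define k l where "k = \<lfloor>real N * x\<rfloor>" and "l = \<lfloor>real N * y\<rfloor>"
    have kl: "\<lfloor>real N * u\<rfloor> \<in> I" if "u \<in> {-1..1}" for u
    proof -
      have "real N * u \<le> real N" "- real N \<le> real N * u"
        using that N mult_left_mono[of u 1 "real N"] mult_left_mono[of "-1" u "real N"] by auto
      then show ?thesis by (auto simp: I_def le_floor_iff floor_le_iff)
    qed
    have near: "\<bar>pt \<lfloor>real N * u\<rfloor> - u\<bar> \<le> 1 / real N" for u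
    proof -
      have "pt \<lfloor>real N * u\<rfloor> - u = (real_of_int \<lfloor>real N * u\<rfloor> - real N * u) / real N"
        using N by (simp add: pt_def field_simps)
      moreover have "\<bar>real_of_int \<lfloor>real N * u\<rfloor> - real N * u\<bar> \<le> 1" by linarith
      ultimately show ?thesis using N by (simp add: divide_right_mono)
    qed
    have "T x y = F (pt k) (pt l) * \<phi> y"
    proof -
      have "T x y = (\<Sum>k'\<in>I. \<Sum>l'\<in>I. if k' = k then (if l' = l then \<phi> y * F (pt k) (pt l) else 0) else 0)"
        unfolding T_def cell_def k_def l_def by (intro sum.cong refl) auto
      also have "\<dots> = (\<Sum>k'\<in>I. if k' = k then \<Sum>l'\<in>I. if l' = l then \<phi> y * F (pt k) (pt l) else 0 else 0)"
        by (intro sum.cong refl) auto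
      also have "\<dots> = \<phi> y * F (pt k) (pt l)"
        using kl[OF x] kl[OF y] fin by (simp add: k_def l_def)
      finally show ?thesis by (simp add: mult.commute)
    qed
    moreover have "\<bar>F (pt k) (pt l) - F x y\<bar> < \<epsilon>"
    proof -
      have "dist (pt k, pt l) (x, y) \<le> \<bar>pt k - x\<bar> + \<bar>pt l - y\<bar>"
        unfolding dist_Pair_Pair dist_real_def by (rule order.trans[OF sqrt_sum_squares_le_sum_abs]) simp
      also have "\<dots> \<le> 2 / real N" using near[of x] near[of y] by (simp add: k_def l_def)
      also have "\<dots> < \<delta>" by (rule N)
      finally show ?thesis using uc[of "(x, y)" "(pt k, pt l)"] x y pt kl
        by (simp add: dist_real_def k_def l_def)
    qed
    ultimately show ?thesis
      by (simp add: left_diff_distrib[symmetric] abs_mult mult_right_mono)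
  qed
  have cF: "continuous_on UNIV (F x)" for x
    using continuous_on_compose2[OF F, of UNIV "\<lambda>z. (x, z)"] by (simp add: continuous_intros)
  have iF: "integrable \<nu> (\<lambda>y. F x y * \<phi> y)" for x
    by (intro integrable_continuous continuous_intros cF \<phi>)
  have ciF: "continuous_on UNIV (\<lambda>x. \<integral>y. F x y * \<phi> y \<partial>\<nu>)"
    by (rule continuous_on_integral) (intro continuous_intros F continuous_on_compose2[OF \<phi>], auto)
  have inner: "\<bar>(\<integral>y. T x y \<partial>\<nu>) - (\<integral>y. F x y * \<phi> y \<partial>\<nu>)\<bar> \<le> \<epsilon> * C" if x: "x \<in> {-1..1}" for x
  proof -
    have "\<bar>\<integral>y. T x y - F x y * \<phi> y \<partial>\<nu>\<bar> \<le> (\<integral>y. \<bar>T x y - F x y * \<phi> y\<bar> \<partial>\<nu>)"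
      by (rule integral_abs_bound)
    also have "\<dots> \<le> (\<integral>y. \<epsilon> * \<bar>\<phi> y\<bar> \<partial>\<nu>)"
    proof (rule integral_mono_AE)
      show "AE y in \<nu>. \<bar>T x y - F x y * \<phi> y\<bar> \<le> \<epsilon> * \<bar>\<phi> y\<bar>"
        using AE_interval by (rule eventually_mono) (rule close[OF x])
    qed (use iTy iF i\<phi> in auto)
    finally show ?thesis using iTy iF by (simp add: C_def)
  qed
  have "(\<integral>x. (\<integral>y. T x y \<partial>\<nu>) * \<phi> x \<partial>\<nu>) - (\<integral>x. (\<integral>y. F x y * \<phi> y \<partial>\<nu>) * \<phi> x \<partial>\<nu>) =
      (\<integral>x. (\<integral>y. T x y \<partial>\<nu>) * \<phi> x - (\<integral>y. F x y * \<phi> y \<partial>\<nu>) * \<phi> x \<partial>\<nu>)"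
    by (intro Bochner_Integration.integral_diff[symmetric] iTx integrable_continuous continuous_intros ciF \<phi>)
  also have "\<dots> \<le> (\<integral>x. (\<epsilon> * C) * \<bar>\<phi> x\<bar> \<partial>\<nu>)"
  proof (rule integral_mono_AE)
    show "AE x in \<nu>. (\<integral>y. T x y \<partial>\<nu>) * \<phi> x - (\<integral>y. F x y * \<phi> y \<partial>\<nu>) * \<phi> x \<le> \<epsilon> * C * \<bar>\<phi> x\<bar>"
      using AE_interval
    proof (rule eventually_mono)
      fix x :: real assume "x \<in> {-1..1}"
      then have "\<bar>(\<integral>y. T x y \<partial>\<nu>) - (\<integral>y. F x y * \<phi> y \<partial>\<nu>)\<bar> * \<bar>\<phi> x\<bar> \<le> \<epsilon> * C * \<bar>\<phi> x\<bar>"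
        by (intro mult_right_mono inner) auto
      then show "(\<integral>y. T x y \<partial>\<nu>) * \<phi> x - (\<integral>y. F x y * \<phi> y \<partial>\<nu>) * \<phi> x \<le> \<epsilon> * C * \<bar>\<phi> x\<bar>"
        by (simp add: left_diff_distrib[symmetric] abs_mult[symmetric])
    qed
    show "integrable \<nu> (\<lambda>x. (\<integral>y. T x y \<partial>\<nu>) * \<phi> x - (\<integral>y. F x y * \<phi> y \<partial>\<nu>) * \<phi> x)"
      by (intro Bochner_Integration.integrable_diff iTx integrable_continuous continuous_intros ciF \<phi>)
  qed (use i\<phi> in simp)
  also have "\<dots> = \<epsilon> * C\<^sup>2" by (simp add: C_def power2_eq_square)
  also note \<epsilon>C
  finally show "0 \<le> (\<integral>x. (\<integral>y. F x y * \<phi> y \<partial>\<nu>) * \<phi> x \<partial>\<nu>) + e" using T0 by linarith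
qed

end

text \<open>
The distribution, up to a constant, of a coordinate of a uniformly distributed point of \<open>S\<^sup>d\<close>.
\<close>

definition zonal_measure :: "nat \<Rightarrow> real measure" where
  "zonal_measure d = (if d = 0 then distr (count_space {-1, 1}) borel (\<lambda>x. x) else gegenbauer_measure ((real d -
      1) / 2))"

lemma zonal_measure_Suc [simp]: "zonal_measure (Suc d) = gegenbauer_measure (real d / 2)"
  by (simp add: zonal_measure_def)

lemma AE_zonal_measure_0: "AE x in zonal_measure 0. x\<^sup>2 = 1"
proof -
  have z: "zonal_measure 0 = distr (count_space {-1, 1}) borel (\<lambda>x. x)" by (simp add: zonal_measure_def)
  show ?thesis unfolding z by (subst AE_distr_iff) (auto simp: AE_count_space)
qed

lemma finite_interval_measure_zonal_measure: "finite_interval_measure (zonal_measure d)"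
proof (cases d)
  case 0
  have fin: "finite_measure (count_space {-1, 1::real})"
    by (rule finite_measure_count_space) simp
  have "finite_measure (zonal_measure 0)"
    unfolding zonal_measure_def by (simp add: finite_measure.finite_measure_distr[OF fin])
  moreover have "AE x in zonal_measure 0. x \<in> {-1..1}"
    using AE_zonal_measure_0 by (rule eventually_mono) (auto simp: power2_eq_1_iff)
  moreover have "sets (zonal_measure 0) = sets borel" by (simp add: zonal_measure_def)
  ultimately show ?thesis using 0
    by (intro finite_interval_measure.intro finite_interval_measure_axioms.intro) auto
qed (simp add: finite_interval_measure_gegenbauer)

lemma integral_zonal_measure_0:
  fixes f :: "real \<Rightarrow> real"
  shows "f \<in> borel_measurable borel \<Longrightarrow> (\<integral>z. f z \<partial>zonal_measure 0) = f 1 + f (-1)"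
  unfolding zonal_measure_def by (simp add: integral_distr lebesgue_integral_count_space_finite)

lemma functional_eq_if_eq_on_polynomials:
  fixes L R :: "(real \<Rightarrow> real) \<Rightarrow> real"
  assumes L: "\<And>f g e. continuous_on UNIV f \<Longrightarrow> continuous_on UNIV g \<Longrightarrow> (\<And>x. x \<in> {-1..1} \<Longrightarrow> \<bar>f x - g x\<bar> \<le> e) \<Longrightarrow>
      \<bar>L f - L g\<bar> \<le> C * e"
    and R: "\<And>f g e. continuous_on UNIV f \<Longrightarrow> continuous_on UNIV g \<Longrightarrow> (\<And>x. x \<in> {-1..1} \<Longrightarrow> \<bar>f x - g x\<bar> \<le> e) \<Longrightarrow>
        \<bar>R f - R g\<bar> \<le> D * e"
    and eq: "\<And>a N. L (\<lambda>x. \<Sum>i\<le>N. a i * x ^ i) = R (\<lambda>x. \<Sum>i\<le>N. a i * x ^ i)"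
    and f: "continuous_on UNIV f"
  shows "L f = R f"
proof -
  have bound: "\<bar>L f - R f\<bar> \<le> (\<bar>C\<bar> + \<bar>D\<bar>) * e" if e: "e > 0" for e
  proof -
    obtain g where g: "real_polynomial_function g" "\<And>x. x \<in> {-1..1} \<Longrightarrow> \<bar>f x - g x\<bar> < e"
      using Stone_Weierstrass_real_polynomial_function[of "{-1..1::real}" f e] e continuous_on_subset[OF f]
      by (metis compact_Icc subset_UNIV)
    obtain a N where a: "g = (\<lambda>x. \<Sum>i\<le>N. a i * x ^ i)"
      using real_polynomial_function_imp_sum[OF g(1)] by auto
    have gc: "continuous_on UNIV g" unfolding a by (intro continuous_intros)
    have "\<bar>f x - g x\<bar> \<le> e" if "x \<in> {-1..1}" for x using g(2)[OF that] by simp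
    then have "\<bar>L f - L g\<bar> \<le> C * e" "\<bar>R f - R g\<bar> \<le> D * e"
      by (intro L R f gc; blast)+
    moreover have "L g = R g" unfolding a by (rule eq)
    moreover have "C * e \<le> \<bar>C\<bar> * e" "D * e \<le> \<bar>D\<bar> * e" using e by (auto intro!: mult_right_mono)
    ultimately show ?thesis unfolding distrib_right by linarith
  qed
  have "\<bar>L f - R f\<bar> \<le> 0"
  proof (rule field_le_epsilon)
    fix e :: real assume e: "e > 0"
    define M where "M = \<bar>C\<bar> + \<bar>D\<bar>"
    have M: "M \<ge> 0" by (simp add: M_def)
    have "\<bar>L f - R f\<bar> \<le> M * (e / (M + 1))"
      unfolding M_def[symmetric] using bound[of "e / (M + 1)"] e M by (simp add: M_def)
    also have "\<dots> \<le> e" using e M by (simp add: field_simps)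
    finally show "\<bar>L f - R f\<bar> \<le> 0 + e" by simp
  qed
  then show ?thesis by simp
qed

text \<open>
Integrate the addition theorem over \<open>z\<close>: by orthogonality only the term of order 0 survives.
\<close>

lemma gegenbauer_product_formula:
  assumes x: "\<bar>x\<bar> \<le> 1" and y: "\<bar>y\<bar> \<le> 1"
  shows "(\<integral>z. gegenbauer (real d / 2) n (x * y + sqrt (1 - x\<^sup>2) * sqrt (1 - y\<^sup>2) * z) \<partial>zonal_measure d) =
    measure (zonal_measure d) UNIV * gegenbauer (real d / 2) n x * gegenbauer (real d / 2) n y"
proof -
  interpret \<nu>: finite_interval_measure "zonal_measure d" by (rule finite_interval_measure_zonal_measure)
  define l where "l = real d / 2"
  have zc: "continuous_on UNIV (zonal d k)" for k
  proof -
    have "zonal d k = (if d = 0 then (\<lambda>z. z ^ k) else gegenbauer ((real d - 1) / 2) k)"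
      by (rule ext) (simp add: zonal_def)
    then show ?thesis by (auto intro!: continuous_intros continuous_on_gegenbauer')
  qed
  have int: "addition_coeff l n k * (\<integral>z. zonal d k z \<partial>zonal_measure d) = (if k =
      0 then measure (zonal_measure d) UNIV else 0)" for k
  proof (cases "k = 0")
    case True
    have "zonal d 0 = (\<lambda>_. 1)" by (rule ext) (simp add: zonal_def)
    then show ?thesis using True by simp
  next
    case k: False
    show ?thesis
    proof (cases d)
      case 0
      show ?thesis
      proof (cases "k = 1")
        case True
        then show ?thesis using 0 integral_zonal_measure_0[of "\<lambda>z. z"] by (simp add: zonal_def)
      next
        case False
        then have "k \<ge> 2" using k by simp
        then have "addition_scale (- 1) k = 0"
        proof (induction k rule: dec_induct)
          case base
          show ?case by (simp add: numeral_2_eq_2 addition_up.simps)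
        qed simp
        then have "addition_coeff l n k = 0" using 0 by (simp add: addition_coeff_def l_def)
        then show ?thesis using k by simp
      qed
    next
      case (Suc e)
      have "(\<integral>z. gegenbauer (real e / 2) k z * gegenbauer (real e / 2) 0 z \<partial>gegenbauer_measure (real e / 2)) = 0"
        using k by (intro gegenbauer_orthogonal) auto
      then show ?thesis using Suc k by simp
    qed
  qed
  have "(\<integral>z. gegenbauer l n (x * y + sqrt (1 - x\<^sup>2) * sqrt (1 - y\<^sup>2) * z) \<partial>zonal_measure d) =
      (\<integral>z. (\<Sum>k\<le>n. (addition_coeff l n k * assoc_gegenbauer l n k x * assoc_gegenbauer l n k y) *
          zonal d k z) \<partial>zonal_measure d)"
  proof (rule integral_cong_AE)
    have "AE z in zonal_measure d. d > 0 \<or> z\<^sup>2 = 1"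
      using AE_zonal_measure_0 by (cases "d = 0") auto
    then show "AE z in zonal_measure d. gegenbauer l n (x * y + sqrt (1 - x\<^sup>2) * sqrt (1 - y\<^sup>2) * z) =
       (\<Sum>k\<le>n. (addition_coeff l n k * assoc_gegenbauer l n k x * assoc_gegenbauer l n k y) * zonal d k z)"
    proof (rule eventually_mono)
      fix z :: real assume "d > 0 \<or> z\<^sup>2 = 1"
      from gegenbauer_addition_zonal[OF x y this, of n] show "gegenbauer l n (x * y + sqrt (1 - x\<^sup>2) * sqrt (1 -
          y\<^sup>2) * z) =
       (\<Sum>k\<le>n. (addition_coeff l n k * assoc_gegenbauer l n k x * assoc_gegenbauer l n k y) * zonal d k z)"
        by (simp add: l_def)
    qed
    show "(\<lambda>z. gegenbauer l n (x * y + sqrt (1 - x\<^sup>2) * sqrt (1 - y\<^sup>2) * z)) \<in> borel_measurable (zonal_measure d)"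
      using borel_measurable_continuous_onI[of "\<lambda>z. gegenbauer l n (x * y + sqrt (1 - x\<^sup>2) * sqrt (1 - y\<^sup>2) * z)"]
      by (simp add: continuous_intros)
    show "(\<lambda>z. \<Sum>k\<le>n. (addition_coeff l n k * assoc_gegenbauer l n k x * assoc_gegenbauer l n k y) *
        zonal d k z) \<in> borel_measurable (zonal_measure d)"
      using borel_measurable_continuous_onI[OF zc] by simp
  qed
  also have "\<dots> = (\<Sum>k\<le>n. (addition_coeff l n k * assoc_gegenbauer l n k x * assoc_gegenbauer l n k y) *
      (\<integral>z. zonal d k z \<partial>zonal_measure d))"
    by (subst Bochner_Integration.integral_sum) (auto intro!: \<nu>.integrable_continuous zc)
  also have "\<dots> = (\<Sum>k\<le>n. (addition_coeff l n k * (\<integral>z. zonal d k z \<partial>zonal_measure d)) * (assoc_gegenbauer l n k x *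
      assoc_gegenbauer l n k y))"
    by (simp add: mult_ac)
  also have "\<dots> = (\<Sum>k\<le>n. if k = 0 then measure (zonal_measure d) UNIV * (assoc_gegenbauer l n 0 x *
      assoc_gegenbauer l n 0 y) else 0)"
    unfolding int by (intro sum.cong refl) auto
  also have "\<dots> = measure (zonal_measure d) UNIV * gegenbauer l n x * gegenbauer l n y"
    by (simp add: assoc_gegenbauer_def)
  finally show ?thesis by (simp add: l_def)
qed

text \<open>
The spherical mean operator is diagonal in the Gegenbauer polynomials. For polynomials \<open>f\<close> this is the
product formula with orthogonality; both sides are continuous in \<open>f\<close>.
\<close>

lemma zonal_mean_eigen:
  fixes d :: nat
  assumes y: "\<bar>y\<bar> \<le> 1" and f: "continuous_on UNIV f"
  defines "l \<equiv> real d / 2"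
  shows "(\<integral>x. (\<integral>z. f (x * y + sqrt (1 - x\<^sup>2) * sqrt (1 - y\<^sup>2) * z) \<partial>zonal_measure d) *
      gegenbauer l n x \<partial>gegenbauer_measure l) =
    measure (zonal_measure d) UNIV * gegenbauer l n y * (\<integral>x. f x * gegenbauer l n x \<partial>gegenbauer_measure l)"
proof -
  interpret \<nu>: finite_interval_measure "zonal_measure d" by (rule finite_interval_measure_zonal_measure)
  have l: "l \<ge> 0" by (simp add: l_def)
  interpret g: finite_interval_measure "gegenbauer_measure l" by (rule finite_interval_measure_gegenbauer[OF l])
  define X where "X = (\<lambda>x z. x * y + sqrt (1 - x\<^sup>2) * sqrt (1 - y\<^sup>2) * z)"
  define A where "A = (\<lambda>(f :: real \<Rightarrow> real) x. \<integral>z. f (X x z) \<partial>zonal_measure d)"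
  define \<kappa> where "\<kappa> = measure (zonal_measure d) UNIV"
  have Xin: "X x z \<in> {-1..1}" if "x \<in> {-1..1}" "z \<in> {-1..1}" for x z
  proof -
    have x: "\<bar>x\<bar> \<le> 1" and z: "\<bar>z\<bar> \<le> 1" using that by auto
    define s t where "s = sqrt (1 - x\<^sup>2)" and "t = sqrt (1 - y\<^sup>2)"
    have s: "s \<ge> 0" "s\<^sup>2 = 1 - x\<^sup>2" and t: "t \<ge> 0" "t\<^sup>2 = 1 - y\<^sup>2"
      using x y by (simp_all add: s_def t_def abs_square_le_1)
    have "\<bar>s * t * z\<bar> \<le> s * t"
      using z s(1) t(1) by (simp add: abs_mult mult_left_le)
    moreover have "2 * (x * y) \<le> x\<^sup>2 + y\<^sup>2" "2 * (s * t) \<le> s\<^sup>2 + t\<^sup>2"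
      using sum_squares_bound[of x y] sum_squares_bound[of s t] by (simp_all add: mult.assoc)
    moreover have "- 2 * (x * y) \<le> x\<^sup>2 + y\<^sup>2" using sum_squares_bound[of "-x" y] by simp
    ultimately show ?thesis unfolding X_def s_def[symmetric] t_def[symmetric] using s t by auto
  qed
  have cX: "continuous_on UNIV (\<lambda>q. f (X (fst q) (snd q)))" if "continuous_on UNIV f" for f :: "real \<Rightarrow> real"
    unfolding X_def by (rule continuous_on_compose2[OF that]) (auto intro!: continuous_intros)
  have cA: "continuous_on UNIV (A f)" if "continuous_on UNIV f" for f :: "real \<Rightarrow> real"
    unfolding A_def by (rule \<nu>.continuous_on_integral[OF cX[OF that]])
  have cXx: "continuous_on UNIV (\<lambda>z. f (X x z))" if "continuous_on UNIV f" for f :: "real \<Rightarrow> real" and x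
    unfolding X_def by (rule continuous_on_compose2[OF that]) (auto intro!: continuous_intros)
  have A_diff: "A f x - A g x = A (\<lambda>x. f x - g x) x" if "continuous_on UNIV f" "continuous_on UNIV g" for f g ::
      "real \<Rightarrow> real" and x
    unfolding A_def by (intro Bochner_Integration.integral_diff[symmetric] \<nu>.integrable_continuous cXx that)
  have A_geg: "A (gegenbauer l m) x = \<kappa> * gegenbauer l m x * gegenbauer l m y" if "x \<in> {-1..1}" for m x
    unfolding A_def X_def \<kappa>_def l_def by (rule gegenbauer_product_formula) (use that y in auto)
  let ?L = "\<lambda>f. \<integral>x. A f x * gegenbauer l n x \<partial>gegenbauer_measure l"
      and ?R = "\<lambda>f. \<kappa> * gegenbauer l n y * (\<integral>x. f x * gegenbauer l n x \<partial>gegenbauer_measure l)"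
  have gb: "\<bar>gegenbauer l n x\<bar> \<le> 1" if "x \<in> {-1..1}" for x
    using that by (intro abs_gegenbauer_le_1[OF l]) auto
  have "?L f = ?R f"
  proof (rule functional_eq_if_eq_on_polynomials[where L = ?L and R = ?R and
        C = "measure (gegenbauer_measure l) UNIV * \<kappa>"
            and D = "\<kappa> * measure (gegenbauer_measure l) UNIV", OF _ _ _ f])
    fix f h :: "real \<Rightarrow> real" and e assume fh: "continuous_on UNIV f" "continuous_on UNIV h"
      and e: "\<And>x. x \<in> {-1..1} \<Longrightarrow> \<bar>f x - h x\<bar> \<le> e"
    have cd: "continuous_on UNIV (\<lambda>x. f x - h x)" by (intro continuous_intros fh)
    have e0: "e \<ge> 0" using e[of 0] by simp
    have "?L f - ?L h = (\<integral>x. A (\<lambda>x. f x - h x) x * gegenbauer l n x \<partial>gegenbauer_measure l)"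
      by (subst Bochner_Integration.integral_diff[symmetric])
        (auto intro!: g.integrable_continuous continuous_intros cA fh continuous_on_gegenbauer' simp:
            left_diff_distrib[symmetric] A_diff[OF fh])
    also have "\<bar>\<dots>\<bar> \<le> measure (gegenbauer_measure l) UNIV * (\<kappa> * e)"
    proof (rule g.abs_integral_le)
      fix x :: real assume x: "x \<in> {-1..1}"
      have "\<bar>A (\<lambda>x. f x - h x) x\<bar> \<le> \<kappa> * e"
        unfolding A_def \<kappa>_def by (rule \<nu>.abs_integral_le[OF cXx[OF cd]]) (rule e[OF Xin[OF x]])
      then have "\<bar>A (\<lambda>x. f x - h x) x\<bar> * \<bar>gegenbauer l n x\<bar> \<le> \<kappa> * e * 1"
        using gb[OF x] e0 by (intro mult_mono) (auto simp: \<kappa>_def)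
      then show "\<bar>A (\<lambda>x. f x - h x) x * gegenbauer l n x\<bar> \<le> \<kappa> * e" by (simp add: abs_mult)
    qed (intro continuous_intros cA cd continuous_on_gegenbauer')
    finally show "\<bar>?L f - ?L h\<bar> \<le> (measure (gegenbauer_measure l) UNIV * \<kappa>) * e" by (simp add: mult.assoc)
    have "?R f - ?R h = \<kappa> * gegenbauer l n y * (\<integral>x. (f x - h x) * gegenbauer l n x \<partial>gegenbauer_measure l)"
      unfolding left_diff_distrib right_diff_distrib[symmetric]
      by (subst Bochner_Integration.integral_diff) (auto
          intro!: g.integrable_continuous continuous_intros fh continuous_on_gegenbauer')
    also have "\<bar>\<dots>\<bar> \<le> \<kappa> * 1 * (measure (gegenbauer_measure l) UNIV * e)"
    proof -
      have "\<bar>\<integral>x. (f x - h x) * gegenbauer l n x \<partial>gegenbauer_measure l\<bar> \<le> measure (gegenbauer_measure l) UNIV * e"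
      proof (rule g.abs_integral_le)
        fix x :: real assume x: "x \<in> {-1..1}"
        have "\<bar>f x - h x\<bar> * \<bar>gegenbauer l n x\<bar> \<le> e * 1"
          using e[OF x] gb[OF x] e0 by (intro mult_mono) auto
        then show "\<bar>(f x - h x) * gegenbauer l n x\<bar> \<le> e" by (simp add: abs_mult)
      qed (intro continuous_intros fh continuous_on_gegenbauer')
      moreover have "\<bar>\<kappa> * gegenbauer l n y\<bar> \<le> \<kappa> * 1"
        using abs_gegenbauer_le_1[OF l y] unfolding abs_mult by (intro mult_mono) (auto simp: \<kappa>_def)
      ultimately show ?thesis
        unfolding abs_mult[of "\<kappa> * gegenbauer l n y"] by (intro mult_mono) (auto simp: \<kappa>_def)
    qed
    finally show "\<bar>?R f - ?R h\<bar> \<le> (\<kappa> * measure (gegenbauer_measure l) UNIV) * e" by (simp add: mult.assoc)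
  next
    fix a :: "nat \<Rightarrow> real" and N
    have "\<forall>i. \<exists>c. \<forall>x. x ^ i = (\<Sum>k\<le>i. c k * gegenbauer l k x)"
      using gegenbauer_cone_power[OF l, of 0] by (auto simp: gegenbauer_cone_def) blast
    then obtain c where c: "\<And>i x. x ^ i = (\<Sum>k\<le>i. c i k * gegenbauer l k x)" by metis
    have p: "(\<Sum>i\<le>N. a i * x ^ i) = (\<Sum>i\<le>N. \<Sum>k\<le>i. (a i * c i k) * gegenbauer l k x)" for x
      unfolding c by (simp add: sum_distrib_left mult_ac)
    have Ap: "A (\<lambda>x. \<Sum>i\<le>N. a i * x ^ i) x = (\<Sum>i\<le>N. \<Sum>k\<le>i. (a i * c i k) * A (gegenbauer l k) x)" for x
      unfolding p A_def using cXx[OF continuous_on_gegenbauer']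
      by (simp add: Bochner_Integration.integral_sum \<nu>.integrable_continuous)
    have one: "(\<integral>x. A (gegenbauer l k) x * gegenbauer l n x \<partial>gegenbauer_measure l) =
        \<kappa> * gegenbauer l n y * (\<integral>x. gegenbauer l k x * gegenbauer l n x \<partial>gegenbauer_measure l)" for k
    proof -
      have "(\<integral>x. A (gegenbauer l k) x * gegenbauer l n x \<partial>gegenbauer_measure l) =
          (\<integral>x. \<kappa> * gegenbauer l k y * (gegenbauer l k x * gegenbauer l n x) \<partial>gegenbauer_measure l)"
      proof (rule integral_gegenbauer_measure_cong)
        show "(\<lambda>x. A (gegenbauer l k) x * gegenbauer l n x) \<in> borel_measurable borel"
          by (intro borel_measurable_continuous_onI continuous_intros cA continuous_on_gegenbauer')
        show "(\<lambda>x. \<kappa> * gegenbauer l k y * (gegenbauer l k x * gegenbauer l n x)) \<in> borel_measurable borel"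
          by (intro borel_measurable_continuous_onI continuous_intros continuous_on_gegenbauer')
      qed (simp add: A_geg)
      also have "\<dots> = \<kappa> * gegenbauer l k y * (\<integral>x. gegenbauer l k x * gegenbauer l n x \<partial>gegenbauer_measure l)"
          by simp
      also have "\<dots> = \<kappa> * gegenbauer l n y * (\<integral>x. gegenbauer l k x * gegenbauer l n x \<partial>gegenbauer_measure l)"
        using gegenbauer_orthogonal[OF l, of k n] by (cases "k = n") auto
      finally show ?thesis .
    qed
    have "?L (\<lambda>x. \<Sum>i\<le>N. a i * x ^ i) = (\<integral>x. (\<Sum>i\<le>N. \<Sum>k\<le>i. (a i * c i k) * (A (gegenbauer l k) x *
        gegenbauer l n x)) \<partial>gegenbauer_measure l)"
      unfolding Ap by (simp add: sum_distrib_right mult.assoc)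
    also have "\<dots> = (\<Sum>i\<le>N. \<Sum>k\<le>i. (a i * c i k) * (\<integral>x. A (gegenbauer l k) x *
        gegenbauer l n x \<partial>gegenbauer_measure l))"
      by (simp add: Bochner_Integration.integral_sum g.integrable_continuous continuous_intros cA
          continuous_on_gegenbauer')
    also have "\<dots> = \<kappa> * gegenbauer l n y * (\<Sum>i\<le>N. \<Sum>k\<le>i. (a i * c i k) * (\<integral>x. gegenbauer l k x *
        gegenbauer l n x \<partial>gegenbauer_measure l))"
      unfolding one by (simp add: sum_distrib_left mult_ac)
    also have "(\<Sum>i\<le>N. \<Sum>k\<le>i. (a i * c i k) * (\<integral>x. gegenbauer l k x * gegenbauer l n x \<partial>gegenbauer_measure l)) =
        (\<integral>x. (\<Sum>i\<le>N. \<Sum>k\<le>i. (a i * c i k) * (gegenbauer l k x * gegenbauer l n x)) \<partial>gegenbauer_measure l)"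
      by (simp add: Bochner_Integration.integral_sum g.integrable_continuous continuous_intros
          continuous_on_gegenbauer')
    also have "\<dots> = (\<integral>x. (\<Sum>i\<le>N. a i * x ^ i) * gegenbauer l n x \<partial>gegenbauer_measure l)"
      unfolding p by (simp add: sum_distrib_right mult.assoc)
    finally show "?L (\<lambda>x. \<Sum>i\<le>N. a i * x ^ i) = ?R (\<lambda>x. \<Sum>i\<le>N. a i * x ^ i)" .
  qed
  then show ?thesis by (simp only: A_def X_def \<kappa>_def)
qed

section \<open>Gegenbauer coefficients of positive definite functions\<close>

definition sphere_kernel :: "nat \<Rightarrow> (real \<Rightarrow> 'a \<Rightarrow> 'a \<Rightarrow> real) \<Rightarrow> (nat \<Rightarrow> real) \<times> 'a \<Rightarrow> (nat \<Rightarrow> real) \<times> 'a \<Rightarrow> real" where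
  "sphere_kernel d g p q = g (sphere_inner d (fst p) (fst q)) (snd p) (snd q)"

lemma real_psd_on_finite_weighted:
  fixes n :: nat
  assumes "real_psd (S \<times> A) K"
    and "\<forall>i<n. a i \<in> A"
  shows "real_psd S (\<lambda>x y. \<Sum>i<n. \<Sum>j<n. c i * c j * K (x, a i) (y, a j))"
  unfolding real_psd_def psd_form_def
proof (intro allI impI)
  fix m and p :: "nat \<Rightarrow> 'a" and b :: "nat \<Rightarrow> real"
  assume p: "\<forall>k<m. p k \<in> S"
  have "0 \<le> (\<Sum>u\<in>{..<m} \<times> {..<n}. \<Sum>v\<in>{..<m} \<times> {..<n}. (b (fst u) * c (snd u)) * (b (fst v) * c (snd v)) *
      K (p (fst u), a (snd u)) (p (fst v), a (snd v)))"
    by (rule real_psd_finite[OF assms(1)]) (use p assms(2) in auto)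
  also have "\<dots> = (\<Sum>k<m. \<Sum>i<n. \<Sum>l<m. \<Sum>j<n. (b k * c i) * (b l * c j) * K (p k, a i) (p l, a j))"
    by (simp only: sum.cartesian_product' fst_conv snd_conv)
  also have "\<dots> = (\<Sum>k<m. \<Sum>l<m. \<Sum>i<n. \<Sum>j<n. (b k * c i) * (b l * c j) * K (p k, a i) (p l, a j))"
    by (intro sum.cong refl sum.swap)
  also have "\<dots> = (\<Sum>k<m. \<Sum>l<m. b k * b l * (\<Sum>i<n. \<Sum>j<n. c i * c j * K (p k, a i) (p l, a j)))"
    by (simp add: sum_distrib_left mult_ac)
  finally show "0 \<le> (\<Sum>k<m. \<Sum>l<m. b k * b l * (\<Sum>i<n. \<Sum>j<n. c i * c j * K (p k, a i) (p l, a j)))" .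
qed

lemma pos_mult_nonneg: "0 \<le> a * b \<Longrightarrow> 0 < b \<Longrightarrow> 0 \<le> (a :: real)"
  by (simp add: zero_le_mult_iff)

text \<open>
Passing from \<open>S\<^sup>d\<close> to \<open>S\<^sup>d\<^sup>+\<^sup>1\<close>. The heights are added to the parameters, so the mean over \<open>S\<^sup>d\<close> is
positive semidefinite in the heights and the old parameters; integrating it in both heights against
a Gegenbauer polynomial gives, by \<open>zonal_mean_eigen\<close>, a positive multiple of the coefficient.
Parameters are lists because the induction on \<open>d\<close> adds one real parameter in each step while the
type has to stay fixed.
\<close>

lemma coefficient_psd_step:
  fixes g :: "real \<Rightarrow> real list \<Rightarrow> real list \<Rightarrow> real"
  assumes mean: "\<And>A g. (\<And>a b. continuous_on UNIV (\<lambda>x. g x a b)) \<Longrightarrow>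
      real_psd (topspace (nsphere d) \<times> A) (sphere_kernel d g) \<Longrightarrow>
      real_psd A (\<lambda>a b. \<integral>z. g z (a :: real list) b \<partial>zonal_measure d)"
    and g: "\<And>a b. continuous_on UNIV (\<lambda>x. g x a b)"
    and psd: "real_psd (topspace (nsphere (Suc d)) \<times> A) (sphere_kernel (Suc d) g)"
  shows "real_psd A (\<lambda>a b. \<integral>x. g x a b * gegenbauer (real d / 2) n x \<partial>gegenbauer_measure (real d / 2))"
proof -
  define l where "l = real d / 2"
  have l: "l \<ge> 0" by (simp add: l_def)
  interpret \<nu>: finite_interval_measure "zonal_measure d" by (rule finite_interval_measure_zonal_measure)
  interpret G: finite_interval_measure "gegenbauer_measure l" by (rule finite_interval_measure_gegenbauer[OF l])
  define \<kappa> where "\<kappa> = measure (zonal_measure d) UNIV"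
  have \<kappa>: "\<kappa> > 0"
  proof (cases d)
    case 0
    have "(\<integral>z. 1 \<partial>zonal_measure 0) = (2::real)" by (subst integral_zonal_measure_0) auto
    moreover have "space (zonal_measure 0) = UNIV" using \<nu>.space_eq 0 by simp
    ultimately show ?thesis using 0 by (simp add: \<kappa>_def)
  next
    case (Suc e)
    have "gegenbauer_norm (real e / 2) 0 > 0" by (rule gegenbauer_norm_pos) simp
    then show ?thesis using Suc by (simp add: \<kappa>_def gegenbauer_norm_def)
  qed
  define X where "X = (\<lambda>x y z. x * y + sqrt (1 - x\<^sup>2) * sqrt (1 - y\<^sup>2) * z)"
  \<comment> \<open>the first list entries are the heights, the tails the old parameters\<close>
  define g' where "g' = (\<lambda>z u v. g (X (hd u) (hd v) z) (tl u) (tl v))"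
  define A' where "A' = {x # a | x a. x \<in> {-1..1} \<and> a \<in> A}"
  have psd': "real_psd (topspace (nsphere d) \<times> A') (sphere_kernel d g')"
  proof (rule real_psd_comp[OF psd, where h = "\<lambda>p. (sphere_embed d (hd (snd p)) (fst p), tl (snd p))"])
    fix p assume "p \<in> topspace (nsphere d) \<times> A'"
    then show "(sphere_embed d (hd (snd p)) (fst p), tl (snd p)) \<in> topspace (nsphere (Suc d)) \<times> A"
      by (auto simp: A'_def intro!: sphere_embed_mem)
  qed (simp add: sphere_kernel_def g'_def X_def sphere_embed_inner)
  have cg': "continuous_on UNIV (\<lambda>z. g' z u v)" for u v
    unfolding g'_def X_def by (rule continuous_on_compose2[OF g]) (auto intro!: continuous_intros)
  have h0: "real_psd A' (\<lambda>u v. \<integral>z. g' z u v \<partial>zonal_measure d)"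
    by (rule mean[OF cg' psd'])
  define h where "h = (\<lambda>a b x y. \<integral>z. g (X x y z) a b \<partial>zonal_measure d)"
  have h: "real_psd ({-1..1} \<times> A) (\<lambda>p q. h (snd p) (snd q) (fst p) (fst q))"
    by (rule real_psd_comp[OF h0, where h = "\<lambda>p. fst p # snd p"]) (auto simp: A'_def h_def g'_def)
  have ch: "continuous_on UNIV (\<lambda>q. h a b (fst q) (snd q))" for a b
    unfolding h_def X_def
    by (rule \<nu>.continuous_on_integral) (rule continuous_on_compose2[OF g], auto intro!: continuous_intros)
  show ?thesis
    unfolding real_psd_def psd_form_def
  proof (intro allI impI)
    fix N and a :: "nat \<Rightarrow> real list" and c :: "nat \<Rightarrow> real"
    assume a: "\<forall>i<N. a i \<in> A"
    define F where "F = (\<lambda>x y. \<Sum>i<N. \<Sum>j<N. c i * c j * h (a i) (a j) x y)"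
    define b where "b = (\<lambda>i j. \<integral>x. g x (a i) (a j) * gegenbauer l n x \<partial>gegenbauer_measure l)"
    have F: "real_psd {-1..1} F"
      using real_psd_on_finite_weighted[OF h a, of c] by (simp add: F_def)
    have cF: "continuous_on UNIV (\<lambda>q. F (fst q) (snd q))"
      unfolding F_def by (intro continuous_intros ch)
    have chx: "continuous_on UNIV (\<lambda>x. h u v x y)" and chy: "continuous_on UNIV (\<lambda>x. h u v y x)" for u v y
      using continuous_on_compose2[OF ch, of UNIV "\<lambda>x. (x, y)"] continuous_on_compose2[OF ch, of UNIV "\<lambda>x. (y, x)"]
      by (simp_all add: continuous_intros)
    have hs: "h u v x y = (\<integral>z. g (y * x + sqrt (1 - y\<^sup>2) * sqrt (1 - x\<^sup>2) * z) u v \<partial>zonal_measure d)" for u v x y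
      by (simp add: h_def X_def mult_ac)
    have inner: "(\<integral>y. F x y * gegenbauer l n y \<partial>gegenbauer_measure l) =
        (\<Sum>i<N. \<Sum>j<N. c i * c j * b i j) * \<kappa> * gegenbauer l n x"
      if x: "x \<in> {-1..1}" for x
    proof -
      have "(\<integral>y. F x y * gegenbauer l n y \<partial>gegenbauer_measure l) =
          (\<integral>y. (\<Sum>i<N. \<Sum>j<N. (c i * c j) * (h (a i) (a j) x y * gegenbauer l n y)) \<partial>gegenbauer_measure l)"
        unfolding F_def by (simp add: sum_distrib_right mult.assoc)
      also have "\<dots> = (\<Sum>i<N. \<Sum>j<N. (c i * c j) * (\<integral>y. h (a i) (a j) x y * gegenbauer l n y \<partial>gegenbauer_measure l))"
        by (simp add: Bochner_Integration.integral_sum G.integrable_continuous continuous_intros chy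
            continuous_on_gegenbauer')
      also have "\<dots> = (\<Sum>i<N. \<Sum>j<N. (c i * c j) * (\<kappa> * gegenbauer l n x * b i j))"
        using x unfolding hs \<kappa>_def b_def l_def
        by (intro sum.cong refl arg_cong2[where f = "(*)"] zonal_mean_eigen g) auto
      finally show ?thesis by (simp add: sum_distrib_left sum_distrib_right mult_ac)
    qed
    have "0 \<le> (\<integral>x. (\<integral>y. F x y * gegenbauer l n y \<partial>gegenbauer_measure l) * gegenbauer l n x \<partial>gegenbauer_measure l)"
      by (rule G.double_integral_nonneg[OF cF F continuous_on_gegenbauer'])
    also have "\<dots> = (\<integral>x. ((\<Sum>i<N. \<Sum>j<N. c i * c j * b i j) * \<kappa>) * (gegenbauer l n x)\<^sup>2 \<partial>gegenbauer_measure l)"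
    proof (rule integral_gegenbauer_measure_cong)
      have "continuous_on UNIV (\<lambda>x. \<integral>y. F x y * gegenbauer l n y \<partial>gegenbauer_measure l)"
        by (rule G.continuous_on_integral) (intro continuous_intros cF continuous_on_gegenbauer)
      then show "(\<lambda>x. (\<integral>y. F x y * gegenbauer l n y \<partial>gegenbauer_measure l) *
          gegenbauer l n x) \<in> borel_measurable borel"
        by (intro borel_measurable_continuous_onI continuous_intros continuous_on_gegenbauer')
      show "(\<lambda>x. ((\<Sum>i<N. \<Sum>j<N. c i * c j * b i j) * \<kappa>) * (gegenbauer l n x)\<^sup>2) \<in> borel_measurable borel"
        by (intro borel_measurable_continuous_onI continuous_intros continuous_on_gegenbauer')
    qed (simp add: inner power2_eq_square)
    also have "\<dots> = (\<Sum>i<N. \<Sum>j<N. c i * c j * b i j) * (\<kappa> * gegenbauer_norm l n)"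
      by (simp add: gegenbauer_norm_def)
    finally have "0 \<le> (\<Sum>i<N. \<Sum>j<N. c i * c j * b i j) * (\<kappa> * gegenbauer_norm l n)" .
    moreover have "0 < \<kappa> * gegenbauer_norm l n" using \<kappa> gegenbauer_norm_pos[OF l, of n] by (rule mult_pos_pos)
    ultimately have "0 \<le> (\<Sum>i<N. \<Sum>j<N. c i * c j * b i j)"
      by (rule pos_mult_nonneg)
    then show "0 \<le> (\<Sum>i<N. \<Sum>j<N. c i * c j * (\<integral>x. g x (a i) (a j) *
        gegenbauer (real d / 2) n x \<partial>gegenbauer_measure (real d / 2)))"
      by (simp add: b_def l_def)
  qed
qed

text \<open>
The coefficient of degree 0 in \<open>coefficient_psd_step\<close> is the mean itself, which closes the induction.
\<close>

lemma zonal_mean_psd: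
  assumes "\<And>a b. continuous_on UNIV (\<lambda>x. g x a b)"
    and "real_psd (topspace (nsphere d) \<times> A) (sphere_kernel d g)"
  shows "real_psd A (\<lambda>a b. \<integral>z. g z (a :: real list) b \<partial>zonal_measure d)"
  using assms
proof (induction d arbitrary: g A)
  case 0
  show ?case unfolding real_psd_def psd_form_def
  proof (intro allI impI)
    fix N and a :: "nat \<Rightarrow> real list" and c :: "nat \<Rightarrow> real"
    assume a: "\<forall>i<N. a i \<in> A"
    define e where "e = (\<lambda>s i. if i = (0::nat) then s else 0::real)"
    have e: "e 1 \<in> topspace (nsphere 0)" "e (-1) \<in> topspace (nsphere 0)" by (simp_all add: mem_nsphere e_def)
    have K: "real_psd (topspace (nsphere 0)) (\<lambda>x y. \<Sum>i<N. \<Sum>j<N. c i * c j * sphere_kernel 0 g (x, a i) (y, a j))"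
      by (rule real_psd_on_finite_weighted[OF 0(2) a])
    let ?K = "\<lambda>x y. \<Sum>i<N. \<Sum>j<N. c i * c j * sphere_kernel 0 g (e x, a i) (e y, a j)"
    have "0 \<le> (\<Sum>u\<in>{1,-1::real}. \<Sum>v\<in>{1,-1}. 1 * 1 * ?K u v)"
      by (rule real_psd_finite[OF K]) (use e in auto)
    also have "\<dots> = 2 * (\<Sum>i<N. \<Sum>j<N. c i * c j * (g 1 (a i) (a j) + g (-1) (a i) (a j)))"
      by (simp add: sphere_kernel_def sphere_inner_def e_def sum.distrib[symmetric] sum_distrib_left algebra_simps)
    finally show "0 \<le> (\<Sum>i<N. \<Sum>j<N. c i * c j * (\<integral>z. g z (a i) (a j) \<partial>zonal_measure 0))"
      using borel_measurable_continuous_onI[OF 0(1)] by (simp add: integral_zonal_measure_0)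
  qed
next
  case (Suc d)
  show ?case
    using coefficient_psd_step[OF Suc.IH Suc.prems, of 0] by simp
qed

theorem coefficient_psd:
  assumes g: "\<And>a b. continuous_on UNIV (\<lambda>x. g x a b)"
    and psd: "real_psd (topspace (nsphere (Suc d)) \<times> UNIV) (sphere_kernel (Suc d) g)"
  shows "real_psd UNIV (\<lambda>s t. \<integral>x. g x (s :: real) t *
      gegenbauer (real d / 2) n x \<partial>gegenbauer_measure (real d / 2))"
proof -
  have "real_psd (topspace (nsphere (Suc d)) \<times> UNIV) (sphere_kernel (Suc d) (\<lambda>x a b. g x (hd a) (hd b)))"
    by (rule real_psd_comp[OF psd, where h = "\<lambda>p. (fst p, hd (snd p))"]) (auto simp: sphere_kernel_def)
  then have "real_psd UNIV (\<lambda>a b. \<integral>x. g x (hd a) (hd b) *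
      gegenbauer (real d / 2) n x \<partial>gegenbauer_measure (real d / 2))"
    by (intro coefficient_psd_step[OF zonal_mean_psd]) (auto intro: g)
  then show ?thesis
    by (rule real_psd_comp[where h = "\<lambda>t. [t]"]) auto
qed

section \<open>Gegenbauer series of continuous positive definite functions\<close>

lemma psd_diagonal:
  fixes B :: "real \<Rightarrow> real"
  assumes "real_psd UNIV (\<lambda>s t. B (s - t))"
  shows "B 0 \<ge> 0" 
proof -
  have "0 \<le> (\<Sum>i\<in>{0::nat}. \<Sum>j\<in>{0::nat}. (1::real) * 1 * B ((0::real) - 0))"
    using real_psd_finite[OF assms, of "{0::nat}" "\<lambda>_. 0" "\<lambda>_. 1"] by simp
  then show ?thesis by simp
qed

lemma psd_bound:
  fixes B :: "real \<Rightarrow> real"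
  assumes psd: "real_psd UNIV (\<lambda>s t. B (s - t))" and sym: "B (- t) = B t"
  shows "\<bar>B t\<bar> \<le> B 0"
proof (cases "t = 0")
  case False
  have "0 \<le> (\<Sum>i\<in>{0,t}. \<Sum>j\<in>{0,t}. c i * c j * B (i - j))" for c
    using real_psd_finite[OF psd, of "{0,t}" "\<lambda>x. x" c] by simp
  from this[of "\<lambda>_. 1"] this[of "\<lambda>x. if x = 0 then 1 else -1"] show ?thesis
    using False sym by (simp add: algebra_simps)
qed (use psd_diagonal[OF psd] in simp)

text \<open>
Pair \<open>H\<close> with \<open>(1 + x) ^ N\<close>, a nonnegative function with nonnegative Gegenbauer coefficients. The
pairing is at most \<open>M\<close> times the mass \<open>q N 0\<close> of that function, and it is a combination of the
normalised coefficients of \<open>H\<close> with weights \<open>q N n\<close>. As \<open>N\<close> grows, \<open>q N n / q N 0\<close> tends to 1 because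
\<open>(1 + x) ^ N\<close> concentrates at \<open>x = 1\<close>.
\<close>

theorem nonneg_coefficients_summable:
  assumes l: "l \<ge> 0" and H: "continuous_on UNIV H" and M: "\<And>x. x \<in> {-1..1} \<Longrightarrow> \<bar>H x\<bar> \<le> M"
    and nonneg: "\<And>n. (\<integral>x. H x * gegenbauer l n x \<partial>gegenbauer_measure l) \<ge> 0"
  shows "summable (\<lambda>n. (\<integral>x. H x * gegenbauer l n x \<partial>gegenbauer_measure l) / gegenbauer_norm l n)"
proof (rule summableI_nonneg_bounded)
  interpret G: finite_interval_measure "gegenbauer_measure l" by (rule finite_interval_measure_gegenbauer[OF l])
  define B where "B = (\<lambda>n. \<integral>x. H x * gegenbauer l n x \<partial>gegenbauer_measure l)"
  note npos = gegenbauer_norm_pos[OF l]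
  fix m
  show "0 \<le> (\<integral>x. H x * gegenbauer l m x \<partial>gegenbauer_measure l) / gegenbauer_norm l m"
    using nonneg[of m] npos[of m] by simp
  \<comment> \<open>the coefficients of \<open>(1 + x) ^ N\<close>\<close>
  define q where "q = (\<lambda>N n. \<integral>x. (1 + x) ^ N * gegenbauer l n x \<partial>gegenbauer_measure l)"
  define K where "K = 2 powr (2 * l) * Gamma (l + 1/2)"
  have K: "K > 0" using l by (simp add: K_def Gamma_real_pos)
  have q: "q N n = K * 2 ^ N * falling N n * Gamma (real N + l + 1/2) / Gamma (real N + real n + 2 * l +
      1)" for N n
    unfolding q_def K_def by (rule gegenbauer_moment[OF l])
  have q0: "q N 0 > 0" for N
    unfolding q using K l by (auto simp: falling_def intro!: divide_pos_pos mult_pos_pos Gamma_real_pos)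
  have upper: "(\<Sum>n<m. q N n / q N 0 * (B n / gegenbauer_norm l n)) \<le> M" if N: "N \<ge> m" for N
  proof -
    obtain c where c: "\<And>k. 0 \<le> c k" "\<And>x. (1 + x) ^ N = (\<Sum>k\<le>N. c k * gegenbauer l k x)"
      using gegenbauer_cone_power[OF l, of 1 N] by (auto simp: gegenbauer_cone_def)
    have qc: "q N n = c n * gegenbauer_norm l n" if n: "n \<le> N" for n
    proof -
      have "q N n = (\<integral>x. (\<Sum>k\<le>N. c k * (gegenbauer l k x * gegenbauer l n x)) \<partial>gegenbauer_measure l)"
        unfolding q_def c by (simp add: sum_distrib_right mult.assoc)
      also have "\<dots> = (\<Sum>k\<le>N. c k * (\<integral>x. gegenbauer l k x * gegenbauer l n x \<partial>gegenbauer_measure l))"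
        by (simp add: Bochner_Integration.integral_sum G.integrable_continuous continuous_intros
            continuous_on_gegenbauer')
      also have "\<dots> = (\<Sum>k\<le>N. if k = n then c n * gegenbauer_norm l n else 0)"
        using gegenbauer_orthogonal[OF l] by (intro sum.cong refl) (auto simp: gegenbauer_norm_def
            power2_eq_square)
      finally show ?thesis using n by simp
    qed
    have "(\<Sum>n<m. q N n * (B n / gegenbauer_norm l n)) \<le> (\<Sum>n\<le>N. q N n * (B n / gegenbauer_norm l n))"
    proof (rule sum_mono2)
      show "0 \<le> q N b * (B b / gegenbauer_norm l b)" if "b \<in> {..N} - {..<m}" for b
        using qc[of b] c(1)[of b] npos[of b] nonneg[of b] that by (simp add: B_def)
    qed (use N in auto)
    also have "\<dots> = (\<Sum>n\<le>N. c n * B n)"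
    proof (intro sum.cong refl)
      fix n assume "n \<in> {..N}"
      then show "q N n * (B n / gegenbauer_norm l n) = c n * B n" using qc[of n] npos[of n] by simp
    qed
    also have "\<dots> = (\<integral>x. (\<Sum>n\<le>N. c n * (H x * gegenbauer l n x)) \<partial>gegenbauer_measure l)"
      by (simp add: B_def Bochner_Integration.integral_sum G.integrable_continuous continuous_intros H
          continuous_on_gegenbauer')
    also have "\<dots> = (\<integral>x. H x * (1 + x) ^ N \<partial>gegenbauer_measure l)"
      unfolding c by (simp add: sum_distrib_left mult_ac)
    also have "\<dots> \<le> (\<integral>x. M * (1 + x) ^ N \<partial>gegenbauer_measure l)"
    proof (rule integral_mono_AE)
      show "AE x in gegenbauer_measure l. H x * (1 + x) ^ N \<le> M * (1 + x) ^ N"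
        using AE_gegenbauer_measure_closed[of l]
      proof (rule eventually_mono)
        fix x :: real assume x: "x \<in> {-1..1}"
        then have "H x \<le> M" using M[OF x] by simp
        then show "H x * (1 + x) ^ N \<le> M * (1 + x) ^ N"
          using x by (intro mult_right_mono) auto
      qed
    qed (auto intro!: G.integrable_continuous continuous_intros H)
    also have "\<dots> = M * q N 0" by (simp add: q_def)
    finally have "(\<Sum>n<m. q N n * (B n / gegenbauer_norm l n)) / q N 0 \<le> M"
      using q0[of N] by (simp add: divide_le_eq)
    then show ?thesis by (simp only: sum_divide_distrib times_divide_eq_left)
  qed
  have lim: "(\<lambda>N. q N n / q N 0) \<longlonglongrightarrow> 1" for n
  proof (induction n)
    case 0
    show ?case using q0 by (simp add: less_imp_neq[symmetric])
  next
    case (Suc n)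
    \<comment> \<open>from \<open>gegenbauer_moment\<close> and the functional equation of the Gamma function\<close>
    have ratio: "q N (Suc n) / q N 0 = (q N n / q N 0) * ((real N - real n) / (real N + real n + 2 * l + 1))" for N
    proof -
      have ni: "real N + real n + 2 * l + 1 \<notin> \<int>\<^sub>\<le>\<^sub>0" using l by (auto elim!: nonpos_Ints_cases)
      have pos: "real N + real n + 2 * l + 1 > 0" using l by simp
      have "Gamma (real N + real (Suc n) + 2 * l + 1) =
          (real N + real n + 2 * l + 1) * Gamma (real N + real n + 2 * l + 1)"
        using Gamma_plus1[OF ni] by (simp add: add_ac)
      moreover have "falling N (Suc n) = falling N n * (real N - real n)"
        by (simp add: falling_def)
      ultimately have "q N (Suc n) = q N n * ((real N - real n) / (real N + real n + 2 * l + 1))"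
        unfolding q by (simp only: times_divide_times_eq mult_ac)
      then show ?thesis by simp
    qed
    have "(\<lambda>N. (real N - real n) / (real N + real n + 2 * l + 1)) \<longlonglongrightarrow> 1"
      by real_asymp
    from tendsto_mult[OF Suc.IH this] show ?case unfolding ratio by simp
  qed
  have "(\<lambda>N. \<Sum>n<m. q N n / q N 0 * (B n / gegenbauer_norm l n)) \<longlonglongrightarrow> (\<Sum>n<m. 1 * (B n / gegenbauer_norm l n))"
    by (intro tendsto_intros lim)
  then have "(\<Sum>n<m. 1 * (B n / gegenbauer_norm l n)) \<le> M"
    by (rule LIMSEQ_le_const2) (use upper in blast)
  then show "(\<Sum>n<m. (\<integral>x. H x * gegenbauer l n x \<partial>gegenbauer_measure l) / gegenbauer_norm l n) \<le> M"
    by (simp add: B_def)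
qed

text \<open>
A positive definite function of one real variable is bounded by its value at 0. Hence summability
at \<open>t = 0\<close>, from \<open>nonneg_coefficients_summable\<close>, gives uniform convergence of the series for every \<open>t\<close>;
the sum has the same coefficients as \<open>H\<close>.
\<close>

theorem gegenbauer_inversion:
  fixes H :: "real \<Rightarrow> real \<Rightarrow> real"
  assumes d: "d > 0" and l: "l = (real d - 1) / 2" and H: "\<And>t. continuous_on UNIV (\<lambda>x. H x t)"
    and psd: "\<And>n. real_psd UNIV (\<lambda>s t. \<integral>x. H x (s - t) * gegenbauer l n x \<partial>gegenbauer_measure l)"
    and sym: "\<And>n t. (\<integral>x. H x (- t) * gegenbauer l n x \<partial>gegenbauer_measure l) =
        (\<integral>x. H x t * gegenbauer l n x \<partial>gegenbauer_measure l)"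
  shows "real_psd (topspace (nsphere d) \<times> UNIV) (sphere_kernel d (\<lambda>x s t. H x (s - t)))"
    and "\<And>x t. x \<in> {-1..1} \<Longrightarrow> H x (- t) = H x t"
proof -
  have l0: "l \<ge> 0" using d l by simp
  interpret G: finite_interval_measure "gegenbauer_measure l" by (rule finite_interval_measure_gegenbauer[OF l0])
  define B where "B = (\<lambda>n t. \<integral>x. H x t * gegenbauer l n x \<partial>gegenbauer_measure l)"
  define b where "b = (\<lambda>n t. B n t / gegenbauer_norm l n)"
  note npos = gegenbauer_norm_pos[OF l0]
  have psdB: "real_psd UNIV (\<lambda>s t. B n (s - t))" for n unfolding B_def by (rule psd)
  have symB: "B n (- t) = B n t" for n t unfolding B_def by (rule sym)
  have B0: "B n 0 \<ge> 0" for n by (rule psd_diagonal[OF psdB])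
  have Bb: "\<bar>b n t\<bar> \<le> b n 0" for n t
    using psd_bound[OF psdB symB, of n t] npos[of n] by (simp add: b_def divide_right_mono)
  have "compact ((\<lambda>x. H x 0) ` {-1..1})"
    by (intro compact_continuous_image continuous_on_subset[OF H]) auto
  then obtain M where "\<And>x. x \<in> {-1..1} \<Longrightarrow> \<bar>H x 0\<bar> \<le> M"
    using compact_imp_bounded bounded_iff by (metis imageI real_norm_def)
  then have summ: "summable (\<lambda>n. b n 0)"
    unfolding b_def B_def using B0 by (intro nonneg_coefficients_summable[OF l0 H]) (auto simp: B_def)
  have series: "(\<lambda>n. b n t * gegenbauer l n x) sums H x t" if x: "x \<in> {-1..1}" for x t
  proof -
    define cl where "cl = (\<lambda>x::real. max (-1) (min 1 x))"
    have cl: "cl x \<in> {-1..1}" for x by (auto simp: cl_def)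
    have ccl: "continuous_on UNIV cl" unfolding cl_def by (intro continuous_intros)
    define S where "S = (\<lambda>x. \<Sum>n. b n t * gegenbauer l n (cl x))"
    have bd: "norm (b n t * gegenbauer l n (cl x)) \<le> b n 0" for n x
    proof -
      have "\<bar>b n t\<bar> * \<bar>gegenbauer l n (cl x)\<bar> \<le> b n 0 * 1"
        using Bb[of n t] abs_gegenbauer_le_1[OF l0, of "cl x" n] cl[of x] by (intro mult_mono) auto
      then show ?thesis by (simp add: abs_mult)
    qed
    have ul: "uniform_limit UNIV (\<lambda>N x. \<Sum>n<N. b n t * gegenbauer l n (cl x)) S sequentially"
      unfolding S_def by (rule Weierstrass_m_test[OF bd summ])
    have cS: "continuous_on UNIV S"
      by (rule uniform_limit_theorem[OF _ ul]) (auto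
          intro!: always_eventually continuous_intros ccl continuous_on_gegenbauer)
    have sumS: "summable (\<lambda>n. b n t * gegenbauer l n (cl x))" for x
      by (rule summable_norm_cancel[OF summable_comparison_test'[OF summ]]) (use bd in auto)
    have coef: "(\<integral>x. S x * gegenbauer l m x \<partial>gegenbauer_measure l) = B m t" for m
    proof -
      have "(\<lambda>n. \<integral>x. (b n t * gegenbauer l n (cl x)) * gegenbauer l m (cl x) \<partial>gegenbauer_measure l) sums
          (\<integral>x. (\<Sum>n. (b n t * gegenbauer l n (cl x)) * gegenbauer l m (cl x)) \<partial>gegenbauer_measure l)"
      proof (rule sums_integral)
        have bd2: "\<bar>b n t * gegenbauer l n (cl x) * gegenbauer l m (cl x)\<bar> \<le> b n 0" for n x
        proof -
          have "\<bar>b n t * gegenbauer l n (cl x)\<bar> * \<bar>gegenbauer l m (cl x)\<bar> \<le> b n 0 * 1"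
            using bd[of n x] abs_gegenbauer_le_1[OF l0, of "cl x" m] cl[of x] by (intro mult_mono) auto
          then show ?thesis by (simp add: abs_mult)
        qed
        have c: "continuous_on UNIV (\<lambda>x. b n t * gegenbauer l n (cl x) * gegenbauer l m (cl x))" for n
          by (intro continuous_intros ccl continuous_on_gegenbauer)
        then show "\<And>n. integrable (gegenbauer_measure l) (\<lambda>x. b n t * gegenbauer l n (cl x) *
            gegenbauer l m (cl x))"
          by (rule G.integrable_continuous)
        show "AE x in gegenbauer_measure l. summable (\<lambda>n. norm (b n t * gegenbauer l n (cl x) *
            gegenbauer l m (cl x)))"
          by (intro AE_I2 summable_comparison_test'[OF summ]) (use bd2 in auto)
        have "(\<integral>x. norm (b n t * gegenbauer l n (cl x) * gegenbauer l m (cl x)) \<partial>gegenbauer_measure l) \<le>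
            measure (gegenbauer_measure l) UNIV * b n 0" for n
        proof -
          have "\<bar>\<integral>x. norm (b n t * gegenbauer l n (cl x) * gegenbauer l m (cl x)) \<partial>gegenbauer_measure l\<bar> \<le>
              measure (gegenbauer_measure l) UNIV * b n 0"
            using bd2 by (intro G.abs_integral_le continuous_intros ccl continuous_on_gegenbauer) auto
          then show ?thesis by simp
        qed
        then show "summable (\<lambda>n. \<integral>x. norm (b n t * gegenbauer l n (cl x) *
            gegenbauer l m (cl x)) \<partial>gegenbauer_measure l)"
          by (intro summable_comparison_test'[OF summable_mult[OF summ,
              of "measure (gegenbauer_measure l) UNIV"]]) auto
      qed
      also have "(\<lambda>n. \<integral>x. (b n t * gegenbauer l n (cl x)) * gegenbauer l m (cl x) \<partial>gegenbauer_measure l) =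
          (\<lambda>n. if n = m then B m t else 0)"
      proof
        fix n
        have "(\<integral>x. (b n t * gegenbauer l n (cl x)) * gegenbauer l m (cl x) \<partial>gegenbauer_measure l) =
            (\<integral>x. b n t * (gegenbauer l n x * gegenbauer l m x) \<partial>gegenbauer_measure l)"
          by (intro integral_gegenbauer_measure_cong borel_measurable_continuous_onI continuous_intros ccl
              continuous_on_gegenbauer continuous_on_gegenbauer')
            (auto simp: cl_def)
        also have "\<dots> = b n t * (\<integral>x. gegenbauer l n x * gegenbauer l m x \<partial>gegenbauer_measure l)" by simp
        also have "\<dots> = (if n = m then B m t else 0)"
          using gegenbauer_orthogonal[OF l0, of n m] npos[of m]
              by (auto simp: b_def gegenbauer_norm_def power2_eq_square)
        finally show "(\<integral>x. (b n t * gegenbauer l n (cl x)) * gegenbauer l m (cl x) \<partial>gegenbauer_measure l) = (if n =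
            m then B m t else 0)" .
      qed
      also have "(\<integral>x. (\<Sum>n. (b n t * gegenbauer l n (cl x)) * gegenbauer l m (cl x)) \<partial>gegenbauer_measure l) =
          (\<integral>x. S x * gegenbauer l m (cl x) \<partial>gegenbauer_measure l)"
        unfolding S_def by (simp add: suminf_mult2[OF sumS])
      also have "\<dots> = (\<integral>x. S x * gegenbauer l m x \<partial>gegenbauer_measure l)"
        by (intro integral_gegenbauer_measure_cong borel_measurable_continuous_onI continuous_intros ccl cS
            continuous_on_gegenbauer continuous_on_gegenbauer')
            (auto simp: cl_def)
      finally show ?thesis using sums_single[of m "\<lambda>n. B m t"] sums_unique2 by fastforce
    qed
    have "H x t - S x = 0"
    proof (rule continuous_eq_0_if_coefficients_0[OF l0 _ _ x])
      show "continuous_on UNIV (\<lambda>x. H x t - S x)" by (intro continuous_intros H cS)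
      fix n
      have "(\<integral>x. (H x t - S x) * gegenbauer l n x \<partial>gegenbauer_measure l) =
          (\<integral>x. H x t * gegenbauer l n x \<partial>gegenbauer_measure l) - (\<integral>x. S x *
          gegenbauer l n x \<partial>gegenbauer_measure l)"
        unfolding left_diff_distrib
        by (intro Bochner_Integration.integral_diff G.integrable_continuous continuous_intros H cS
            continuous_on_gegenbauer')
      then show "(\<integral>x. (H x t - S x) * gegenbauer l n x \<partial>gegenbauer_measure l) = 0" using coef by (simp add: B_def)
    qed
    then have "H x t = (\<Sum>n. b n t * gegenbauer l n (cl x))" by (simp add: S_def)
    moreover have "cl x = x" using x by (simp add: cl_def)
    ultimately show ?thesis using summable_sums[OF sumS[of x]] by simp
  qed
  show "H x (- t) = H x t" if "x \<in> {-1..1}" for x t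
  proof -
    have "b n (- t) = b n t" for n by (simp add: b_def symB)
    then show ?thesis using series[OF that, of t] series[OF that, of "- t"] sums_unique2 by simp
  qed
  show "real_psd (topspace (nsphere d) \<times> UNIV) (sphere_kernel d (\<lambda>x s t. H x (s - t)))"
    unfolding real_psd_def psd_form_def
  proof (intro allI impI)
    fix N and p :: "nat \<Rightarrow> (nat \<Rightarrow> real) \<times> real" and c :: "nat \<Rightarrow> real"
    assume p: "\<forall>i<N. p i \<in> topspace (nsphere d) \<times> UNIV"
    define X where "X = (\<lambda>i j. sphere_inner d (fst (p i)) (fst (p j)))"
    define T where "T = (\<lambda>i j. snd (p i) - snd (p j))"
    have X: "X i j \<in> {-1..1}" if "i < N" "j < N" for i j
      using abs_sphere_inner_le_1[of "fst (p i)" d "fst (p j)"] p that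
          by (auto simp: X_def mem_Times_iff abs_le_iff)
    have trm: "0 \<le> (\<Sum>i<N. \<Sum>j<N. c i * c j * (b n (T i j) * gegenbauer l n (X i j)))" for n
    proof -
      have "psd_form N (\<lambda>i j. B n (T i j))"
        using psdB[of n] unfolding real_psd_def T_def by simp
      then have "psd_form N (\<lambda>i j. B n (T i j) * zonal d n (X i j))"
        using zonal_multiplier[of d n] p unfolding multiplier_def X_def by (auto simp: mem_Times_iff)
      moreover have "zonal d n x = gegenbauer l n x" for x unfolding zonal_def l using d by simp
      ultimately have "0 \<le> (\<Sum>i<N. \<Sum>j<N. c i * c j * (B n (T i j) * gegenbauer l n (X i j)))"
        by (simp add: psd_form_def)
      then have "0 \<le> (\<Sum>i<N. \<Sum>j<N. c i * c j * (B n (T i j) * gegenbauer l n (X i j))) / gegenbauer_norm l n"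
        using npos[of n] by simp
      then show ?thesis by (simp add: b_def sum_divide_distrib)
    qed
    have "(\<lambda>n. \<Sum>i<N. \<Sum>j<N. c i * c j * (b n (T i j) * gegenbauer l n (X i j))) sums
        (\<Sum>i<N. \<Sum>j<N. c i * c j * H (X i j) (T i j))"
      by (intro sums_sum sums_mult series X) auto
    then have "0 \<le> (\<Sum>i<N. \<Sum>j<N. c i * c j * H (X i j) (T i j))"
      by (rule sums_le[OF trm sums_zero])
    then show "0 \<le> (\<Sum>i<N. \<Sum>j<N. c i * c j * sphere_kernel d (\<lambda>x s t. H x (s - t)) (p i) (p j))"
      by (simp add: sphere_kernel_def X_def T_def)
  qed
qed

section \<open>Jordan decomposition of absolutely continuous functions\<close>

text \<open>
Arbitrary finite families of nonoverlapping subintervals take the place of partitions: this matches the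
definition of absolute continuity, and such families can be cut at a point without reordering.
\<close>

definition variation_sums :: "(real \<Rightarrow> real) \<Rightarrow> real \<Rightarrow> real \<Rightarrow> real set" where
  "variation_sums f A x = {(\<Sum>i<n. \<bar>f (b i) - f (a i)\<bar>) | (n::nat) a b.
     (\<forall>i<n. A \<le> a i \<and> a i \<le> b i \<and> b i \<le> x) \<and> disjoint_family_on (\<lambda>i. {a i<..<b i}) {..<n}}"

lemma variation_sumsI:
  assumes "\<And>i. i < n \<Longrightarrow> A \<le> a i \<and> a i \<le> b i \<and> b i \<le> x" "disjoint_family_on (\<lambda>i. {a i<..<b i}) {..<n}"
  shows "(\<Sum>i<(n::nat). \<bar>f (b i) - f (a i)\<bar>) \<in> variation_sums f A x"
  using assms unfolding variation_sums_def by blast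

lemma zero_mem_variation_sums: "0 \<in> variation_sums f A x"
  using variation_sumsI[of 0 A "\<lambda>_. 0" "\<lambda>_. 0" x f] by (simp add: disjoint_family_on_def)

lemma variation_sums_mono: "x \<le> y \<Longrightarrow> variation_sums f A x \<subseteq> variation_sums f A y"
  unfolding variation_sums_def by fastforce

lemma variation_sums_extend:
  assumes s: "s \<in> variation_sums f A x" and "A \<le> x" "x \<le> y"
  shows "s + \<bar>f y - f x\<bar> \<in> variation_sums f A y"
proof -
  obtain n a b where n: "\<And>i. i < n \<Longrightarrow> A \<le> a i \<and> a i \<le> b i \<and> b i \<le> x"
    "disjoint_family_on (\<lambda>i. {a i<..<b i}) {..<n}" "s = (\<Sum>i<(n::nat). \<bar>f (b i) - f (a i)\<bar>)"
    using s unfolding variation_sums_def by blast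
  define a' where "a' = a(n := x)"
  define b' where "b' = b(n := y)"
  have "(\<Sum>i<Suc n. \<bar>f (b' i) - f (a' i)\<bar>) \<in> variation_sums f A y"
  proof (rule variation_sumsI)
    fix i assume "i < Suc n"
    then show "A \<le> a' i \<and> a' i \<le> b' i \<and> b' i \<le> y"
      using n(1)[of i] assms by (cases "i = n") (auto simp: a'_def b'_def)
  next
    have new: "{a i<..<b i} \<inter> {x<..<y} = {}" if "i < n" for i using n(1)[OF that] by auto
    have old: "{a i<..<b i} \<inter> {a j<..<b j} = {}" if "i < n" "j < n" "i \<noteq> j" for i j
      using n(2) that unfolding disjoint_family_on_def by blast
    show "disjoint_family_on (\<lambda>i. {a' i<..<b' i}) {..<Suc n}"
      unfolding disjoint_family_on_def
    proof (intro ballI impI)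
      fix i j assume ij: "i \<in> {..<Suc n}" "j \<in> {..<Suc n}" "i \<noteq> j"
      then consider "i = n" "j < n" | "j = n" "i < n" | "i < n" "j < n" by fastforce
      then show "{a' i<..<b' i} \<inter> {a' j<..<b' j} = {}"
      proof cases
        case 1 then show ?thesis using new[of j] unfolding a'_def b'_def by (simp only: fun_upd_def) auto
      next
        case 2 then show ?thesis using new[of i] unfolding a'_def b'_def by (simp only: fun_upd_def) auto
      next
        case 3 then show ?thesis using old[of i j] ij unfolding a'_def b'_def by (simp only: fun_upd_def) auto
      qed
    qed
  qed
  moreover have "(\<Sum>i<Suc n. \<bar>f (b' i) - f (a' i)\<bar>) = s + \<bar>f y - f x\<bar>"
    by (simp add: n(3) a'_def b'_def)
  ultimately show ?thesis by simp
qed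

lemma sum_lengths_le:
  fixes a b :: "nat \<Rightarrow> real"
  assumes "\<And>i. i < n \<Longrightarrow> x \<le> a i \<and> a i \<le> b i \<and> b i \<le> y" "disjoint_family_on (\<lambda>i. {a i<..<b i}) {..<n}" "x \<le> y"
  shows "(\<Sum>i<n. b i - a i) \<le> y - x"
proof -
  have "(\<Sum>i<n. b i - a i) = (\<Sum>i<n. measure lborel {a i<..<b i})"
    using assms(1) by (intro sum.cong) auto
  also have "\<dots> = measure lborel (\<Union>i<n. {a i<..<b i})"
    using assms(1,2) by (intro measure_finite_Union[symmetric]) (auto simp: emeasure_lborel_Ioo)
  also have "\<dots> \<le> measure lborel {x..y}"
  proof (rule measure_mono_fmeasurable)
    show "(\<Union>i<n. {a i<..<b i}) \<subseteq> {x..y}" using assms(1) by fastforce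
    show "{x..y} \<in> fmeasurable lborel" using assms(3) by (intro fmeasurableI) auto
  qed auto
  also have "\<dots> = y - x" using assms(3) by simp
  finally show ?thesis .
qed

text \<open>
Cut every interval of the family at \<open>x\<close>. The parts to the right of \<open>x\<close> have total length below \<open>\<delta>\<close>, so
they contribute less than \<open>\<epsilon>\<close>.
\<close>

lemma variation_sums_split:
  assumes s: "s \<in> variation_sums f A y" and xy: "A \<le> x" "x \<le> y" "y \<le> B" "y - x < \<delta>"
    and ac: "\<forall>(n::nat) a b. (\<forall>i<n. A \<le> a i \<and> a i \<le> b i \<and> b i \<le> B) \<longrightarrow>
        disjoint_family_on (\<lambda>i. {a i<..<b i}) {..<n} \<longrightarrow>
        (\<Sum>i<n. b i - a i) < \<delta> \<longrightarrow> (\<Sum>i<n. \<bar>f (b i) - f (a i)\<bar>) < \<epsilon>"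
  shows "\<exists>s'\<in>variation_sums f A x. s \<le> s' + \<epsilon>"
proof -
  obtain n a b where n: "\<And>i. i < n \<Longrightarrow> A \<le> a i \<and> a i \<le> b i \<and> b i \<le> y"
    "disjoint_family_on (\<lambda>i. {a i<..<b i}) {..<n}" "s = (\<Sum>i<(n::nat). \<bar>f (b i) - f (a i)\<bar>)"
    using s unfolding variation_sums_def by blast
  \<comment> \<open>the contributions from the left and from the right of \<open>x\<close>\<close>
  define s1 where "s1 = (\<Sum>i<n. \<bar>f (min (b i) x) - f (min (a i) x)\<bar>)"
  define s2 where "s2 = (\<Sum>i<n. \<bar>f (max (b i) x) - f (max (a i) x)\<bar>)"
  have "s \<le> s1 + s2"
    unfolding n(3) s1_def s2_def sum.distrib[symmetric]
  proof (rule sum_mono)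
    fix i assume "i \<in> {..<n}"
    then have "a i \<le> b i" using n(1) by auto
    then have "f (b i) - f (a i) = (f (min (b i) x) - f (min (a i) x)) + (f (max (b i) x) - f (max (a i) x))"
      by (auto simp: min_def max_def)
    then show "\<bar>f (b i) - f (a i)\<bar> \<le> \<bar>f (min (b i) x) - f (min (a i) x)\<bar> + \<bar>f (max (b i) x) - f (max (a i) x)\<bar>"
      by (metis abs_triangle_ineq)
  qed
  moreover have "s1 \<in> variation_sums f A x"
    unfolding s1_def
  proof (rule variation_sumsI)
    show "disjoint_family_on (\<lambda>i. {min (a i) x<..<min (b i) x}) {..<n}"
      using n(2) unfolding disjoint_family_on_def by fastforce
    fix i assume "i < n"
    then show "A \<le> min (a i) x \<and> min (a i) x \<le> min (b i) x \<and> min (b i) x \<le> x"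
      using n(1)[of i] xy by (auto simp: min_def)
  qed
  moreover have "s2 < \<epsilon>"
  proof -
    have disj: "disjoint_family_on (\<lambda>i. {max (a i) x<..<max (b i) x}) {..<n}"
      using n(2) unfolding disjoint_family_on_def by fastforce
    have "(\<Sum>i<n. max (b i) x - max (a i) x) \<le> y - x"
    proof (rule sum_lengths_le[OF _ disj])
      fix i assume "i < n"
      then show "x \<le> max (a i) x \<and> max (a i) x \<le> max (b i) x \<and> max (b i) x \<le> y"
        using n(1)[of i] xy by (auto simp: max_def)
    qed (rule xy)
    also have "\<dots> < \<delta>" by (rule xy)
    finally have lt: "(\<Sum>i<n. max (b i) x - max (a i) x) < \<delta>" .
    show ?thesis
      unfolding s2_def
    proof (rule ac[rule_format, OF _ disj lt])
      fix i assume "i < n"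
      then show "A \<le> max (a i) x \<and> max (a i) x \<le> max (b i) x \<and> max (b i) x \<le> B"
        using n(1)[of i] xy by (auto simp: max_def)
    qed
  qed
  ultimately show ?thesis by (intro bexI[of _ s1]) auto
qed

text \<open>
Jordan decomposition. The variation function is finite because it grows by at most 1 on intervals
shorter than the \<open>\<delta>\<close> that belongs to \<open>\<epsilon> = 1\<close>, and it is continuous because \<open>variation_sums_split\<close> applies
to every \<open>\<epsilon>\<close>. Outside the interval the two monotone functions are continued as constants.
\<close>

theorem absolutely_continuous_mono_diff:
  assumes f: "absolutely_continuous_on_interval A B f" and AB: "A < B"
  obtains F1 F2 where "mono F1" "mono F2" "continuous_on UNIV F1" "continuous_on UNIV F2"
    "\<And>x. x \<in> {A..B} \<Longrightarrow> f x = F1 x - F2 x"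
proof -
  have ac: "\<exists>\<delta>>0. \<forall>(n::nat) a b. (\<forall>i<n. A \<le> a i \<and> a i \<le> b i \<and> b i \<le> B) \<longrightarrow>
        disjoint_family_on (\<lambda>i. {a i<..<b i}) {..<n} \<longrightarrow>
        (\<Sum>i<n. b i - a i) < \<delta> \<longrightarrow> (\<Sum>i<n. \<bar>f (b i) - f (a i)\<bar>) < \<epsilon>" if "\<epsilon> > 0" for \<epsilon>
    using f that unfolding absolutely_continuous_on_interval_def by blast
  let ?S = "variation_sums f A"
  obtain \<delta>1 where \<delta>1: "\<delta>1 > 0" and ac1: "\<forall>(n::nat) a b. (\<forall>i<n. A \<le> a i \<and> a i \<le> b i \<and> b i \<le> B) \<longrightarrow>
        disjoint_family_on (\<lambda>i. {a i<..<b i}) {..<n} \<longrightarrow>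
        (\<Sum>i<n. b i - a i) < \<delta>1 \<longrightarrow> (\<Sum>i<n. \<bar>f (b i) - f (a i)\<bar>) < 1"
    using ac[of 1] by auto
  have bdd: "\<forall>s\<in>?S (min B (A + real k * (\<delta>1 / 2))). s \<le> real k" for k
  proof (induction k)
    case 0
    have "s \<le> 0" if s: "s \<in> ?S A" for s
    proof -
      obtain n a b where n: "\<And>i. i < n \<Longrightarrow> A \<le> a i \<and> a i \<le> b i \<and> b i \<le> A"
          "s = (\<Sum>i<(n::nat). \<bar>f (b i) - f (a i)\<bar>)"
        using s unfolding variation_sums_def by blast
      have "\<bar>f (b i) - f (a i)\<bar> = 0" if "i < n" for i
        using n(1)[OF that] by (metis abs_zero cancel_comm_monoid_add_class.diff_cancel order_antisym order_trans)
      then show ?thesis using n(2) by simp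
    qed
    then show ?case using AB by simp
  next
    case (Suc k)
    show ?case
    proof
      fix s assume "s \<in> ?S (min B (A + real (Suc k) * (\<delta>1 / 2)))"
      then have "\<exists>s'\<in>?S (min B (A + real k * (\<delta>1 / 2))). s \<le> s' + 1"
      proof (rule variation_sums_split[OF _ _ _ _ _ ac1])
        define p where "p = real k * (\<delta>1 / 2)"
        have p: "real (Suc k) * (\<delta>1 / 2) = p + \<delta>1 / 2" "p \<ge> 0"
          using \<delta>1 by (simp_all add: p_def distrib_right)
        show "A \<le> min B (A + real k * (\<delta>1 / 2))"
          "min B (A + real k * (\<delta>1 / 2)) \<le> min B (A + real (Suc k) * (\<delta>1 / 2))"
          "min B (A + real (Suc k) * (\<delta>1 / 2)) \<le> B"
          "min B (A + real (Suc k) * (\<delta>1 / 2)) - min B (A + real k * (\<delta>1 / 2)) < \<delta>1"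
          unfolding p(1) unfolding p_def[symmetric] using AB \<delta>1 p(2) by (auto simp: min_def)
      qed
      then show "s \<le> real (Suc k)" using Suc by auto
    qed
  qed
  obtain k :: nat where k: "(B - A) / (\<delta>1 / 2) \<le> real k" using real_arch_simple by blast
  have "min B (A + real k * (\<delta>1 / 2)) = B" using k \<delta>1 by (simp add: divide_le_eq)
  then have bd: "s \<le> real k" if "s \<in> ?S B" for s using bdd[of k] that by simp
  have bddS: "bdd_above (?S x)" if "x \<le> B" for x
    using bd variation_sums_mono[OF that, of f A] by (meson bdd_aboveI subsetD)
  have ne: "?S x \<noteq> {}" for x using zero_mem_variation_sums by blast
  define V where "V = (\<lambda>x. Sup (?S x))"
  have V1: "V x + \<bar>f y - f x\<bar> \<le> V y" if "A \<le> x" "x \<le> y" "y \<le> B" for x y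
  proof -
    have "V x \<le> V y - \<bar>f y - f x\<bar>"
      unfolding V_def
    proof (rule cSup_least[OF ne])
      fix s assume "s \<in> ?S x"
      from variation_sums_extend[OF this that(1,2)] show "s \<le> Sup (?S y) - \<bar>f y - f x\<bar>"
        using cSup_upper[OF _ bddS[OF that(3)]] by fastforce
    qed
    then show ?thesis by simp
  qed
  have V2: "\<exists>\<delta>>0. \<forall>x y. A \<le> x \<longrightarrow> x \<le> y \<longrightarrow> y \<le> B \<longrightarrow> y - x < \<delta> \<longrightarrow> V y \<le> V x + \<epsilon>" if eps: "\<epsilon> > 0" for \<epsilon>
  proof -
    obtain \<delta> where \<delta>: "\<delta> > 0" and ac\<delta>: "\<forall>(n::nat) a b. (\<forall>i<n. A \<le> a i \<and> a i \<le> b i \<and> b i \<le> B) \<longrightarrow>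
        disjoint_family_on (\<lambda>i. {a i<..<b i}) {..<n} \<longrightarrow>
        (\<Sum>i<n. b i - a i) < \<delta> \<longrightarrow> (\<Sum>i<n. \<bar>f (b i) - f (a i)\<bar>) < \<epsilon>"
      using ac[OF eps] by auto
    have "V y \<le> V x + \<epsilon>" if xy: "A \<le> x" "x \<le> y" "y \<le> B" "y - x < \<delta>" for x y
      unfolding V_def
    proof (rule cSup_least[OF ne])
      fix s assume "s \<in> ?S y"
      from variation_sums_split[OF this xy ac\<delta>] obtain s' where "s' \<in> ?S x" "s \<le> s' + \<epsilon>" by blast
      then show "s \<le> Sup (?S x) + \<epsilon>"
        using cSup_upper[OF _ bddS, of s' x] xy by fastforce
    qed
    then show ?thesis using \<delta> by blast
  qed
  have contV: "continuous_on {A..B} V"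
    unfolding continuous_on_iff dist_real_def
  proof (intro ballI allI impI)
    fix x \<epsilon> :: real assume x: "x \<in> {A..B}" and \<epsilon>: "\<epsilon> > 0"
    obtain \<delta> where \<delta>: "\<delta> > 0" "\<And>x y. A \<le> x \<Longrightarrow> x \<le> y \<Longrightarrow> y \<le> B \<Longrightarrow> y - x < \<delta> \<Longrightarrow> V y \<le> V x + \<epsilon> / 2"
      using V2[of "\<epsilon> / 2"] \<epsilon> by auto
    have "\<bar>V y - V x\<bar> < \<epsilon>" if y: "y \<in> {A..B}" "\<bar>y - x\<bar> < \<delta>" for y
      using \<delta>(2)[of x y] \<delta>(2)[of y x] V1[of x y] V1[of y x] x y \<epsilon> by (cases "x \<le> y") auto
    then show "\<exists>d>0. \<forall>x'\<in>{A..B}. \<bar>x' - x\<bar> < d \<longrightarrow> \<bar>V x' - V x\<bar> < \<epsilon>" using \<delta>(1) by blast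
  qed
  have contf: "continuous_on {A..B} f"
    unfolding continuous_on_iff dist_real_def
  proof (intro ballI allI impI)
    fix x \<epsilon> :: real assume x: "x \<in> {A..B}" and \<epsilon>: "\<epsilon> > 0"
    then obtain d where d: "d > 0" "\<And>x'. x' \<in> {A..B} \<Longrightarrow> \<bar>x' - x\<bar> < d \<Longrightarrow> \<bar>V x' - V x\<bar> < \<epsilon>"
      using contV unfolding continuous_on_iff dist_real_def by meson
    have "\<bar>f y - f x\<bar> < \<epsilon>" if y: "y \<in> {A..B}" "\<bar>y - x\<bar> < d" for y
      using d(2)[OF y] V1[of x y] V1[of y x] x y by (cases "x \<le> y") auto
    then show "\<exists>d>0. \<forall>x'\<in>{A..B}. \<bar>x' - x\<bar> < d \<longrightarrow> \<bar>f x' - f x\<bar> < \<epsilon>" using d(1) by blast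
  qed
  define cl where "cl = (\<lambda>x::real. max A (min B x))"
  have cl: "cl x \<in> {A..B}" for x using AB by (auto simp: cl_def)
  have cl_mono: "cl x \<le> cl y" if "x \<le> y" for x y using that by (auto simp: cl_def)
  have ccl: "continuous_on UNIV cl" unfolding cl_def by (intro continuous_intros)
  show ?thesis
  proof (rule that[of "\<lambda>x. V (cl x)" "\<lambda>x. V (cl x) - f (cl x)"])
    show "mono (\<lambda>x. V (cl x))"
    proof (rule monoI)
      fix x y :: real assume "x \<le> y"
      then show "V (cl x) \<le> V (cl y)" using V1[of "cl x" "cl y"] cl[of x] cl[of y] cl_mono by fastforce
    qed
    show "mono (\<lambda>x. V (cl x) - f (cl x))"
    proof (rule monoI)
      fix x y :: real assume "x \<le> y"
      then show "V (cl x) - f (cl x) \<le> V (cl y) - f (cl y)"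
        using V1[of "cl x" "cl y"] cl[of x] cl[of y] cl_mono by fastforce
    qed
    show "continuous_on UNIV (\<lambda>x. V (cl x))"
      by (rule continuous_on_compose2[OF contV ccl]) (use cl in auto)
    show "continuous_on UNIV (\<lambda>x. V (cl x) - f (cl x))"
      by (intro continuous_on_diff continuous_on_compose2[OF contV ccl] continuous_on_compose2[OF contf ccl]) (use
          cl in auto)
    show "f x = V (cl x) - (V (cl x) - f (cl x))" if "x \<in> {A..B}" for x
      using that by (simp add: cl_def)
  qed
qed

section \<open>Half-order means and their kernel\<close>

definition half_weight :: "real \<Rightarrow> real \<Rightarrow> real" where
  "half_weight lam s = (1 - s) powr (-1/2) * s powr (lam - 1/2)"

text \<open>
The half-order integral after the substitution \<open>u = -1 + s (1 + x)\<close>, which removes all powers of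
\<open>1 + x\<close>. It makes sense also at \<open>x = -1\<close>.
\<close>

definition half_mean :: "real \<Rightarrow> (real \<Rightarrow> real) \<Rightarrow> real \<Rightarrow> real" where
  "half_mean lam f x = (LBINT s. indicator {0..1} s * half_weight lam s * f (-1 + s * (1 + x)))"

lemma half_weight_measurable [measurable]: "half_weight lam \<in> borel_measurable borel"
  unfolding half_weight_def by measurable

lemma half_weight_nonneg [simp]: "half_weight lam s \<ge> 0"
  by (simp add: half_weight_def)

lemma half_int_plus_eq_half_mean:
  assumes "x > -1"
  shows "half_int_plus lam f x t = half_mean lam (\<lambda>u. f u t) x"
proof -
  define c where "c = 1 + x"
  have c: "c > 0" using assms by (simp add: c_def)
  define h where "h = (\<lambda>u. indicator {-1..x} u * ((x - u) powr (-1/2) * (1 + u) powr (lam - 1/2) * f u t))"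
  have "(LBINT u. h u) = c * (LBINT s. h (-1 + c * s))"
    using lborel_integral_real_affine[of c h "-1"] c by simp
  moreover have "c powr (- lam) * (c * h (-1 + c * s)) =
      indicator {0..1} s * half_weight lam s * f (-1 + s * (1 + x)) t" for s
  proof (cases "s \<in> {0..1}")
    case True
    have 1: "x - (-1 + c * s) = c * (1 - s)" "1 + (-1 + c * s) = c * s" by (simp_all add: c_def algebra_simps)
    have 2: "-1 + c * s \<in> {-1..x}"
    proof -
      have "c * s \<le> c" "0 \<le> c * s" using True c mult_left_mono[of s 1 c] by auto
      moreover have "x = c - 1" by (simp add: c_def)
      ultimately show ?thesis by simp
    qed
    have 3: "c powr (- lam) * (c * (c powr (-1/2) * c powr (lam - 1/2))) = 1"
    proof -
      have "c powr (- lam) * (c powr 1 * (c powr (-1/2) * c powr (lam - 1/2))) =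
          c powr (- lam + (1 + (-1/2 + (lam - 1/2))))"
        unfolding powr_add ..
      also have "\<dots> = c powr 0" by (rule arg_cong2[where f = "(powr)"]) auto
      finally show ?thesis using c by simp
    qed
    have "c powr (- lam) * (c * h (-1 + c * s)) =
        c powr (- lam) * (c * ((c powr (-1/2) * (1 - s) powr (-1/2)) * (c powr (lam - 1/2) * s powr (lam - 1/2)) *
        f (-1 + c * s) t))"
      using True c 2 unfolding h_def 1 by (simp add: powr_mult)
    also have "\<dots> = (c powr (- lam) * (c * (c powr (-1/2) * c powr (lam - 1/2)))) * ((1 - s) powr (-1/2) *
        s powr (lam - 1/2) * f (-1 + c * s) t)"
      by (simp add: mult_ac)
    finally show ?thesis using True unfolding 3 by (simp add: half_weight_def c_def mult.commute)
  next
    case False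
    have "-1 + c * s \<notin> {-1..x}"
    proof
      assume *: "-1 + c * s \<in> {-1..x}"
      then have "0 \<le> c * s" "c * s \<le> c * 1" by (auto simp: c_def)
      then have "0 \<le> s" "s \<le> 1" using c by (simp_all add: zero_le_mult_iff)
      then show False using False by simp
    qed
    then show ?thesis using False by (simp add: h_def)
  qed
  ultimately have "c powr (- lam) * (LBINT u. h u) =
      (LBINT s. indicator {0..1} s * half_weight lam s * f (-1 + s * (1 + x)) t)"
    by (simp add: integral_mult_right_zero[symmetric] mult.assoc del: integral_mult_right_zero)
  then show ?thesis
    by (simp add: half_int_plus_def half_mean_def set_lebesgue_integral_def h_def c_def)
qed

lemma half_int_minus_eq_half_mean:
  assumes "x < 1"
  shows "half_int_minus lam f x t = half_mean lam (\<lambda>u. f (- u) t) (- x)"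
proof -
  let ?h = "\<lambda>u. indicator {x..1} u * ((u - x) powr (-1/2) * (1 - u) powr (lam - 1/2) * f u t)"
  have "(LBINT u. ?h u) = (LBINT u. ?h (- u))"
    using lborel_integral_real_affine[of "-1" ?h 0] by simp
  also have "\<dots> = (LBINT u. indicator {-1..-x} u * ((- x - u) powr (-1/2) * (1 + u) powr (lam - 1/2) * f (- u) t))"
  proof (intro Bochner_Integration.integral_cong refl)
    fix u
    have e: "- u - x = - x - u" by simp
    show "?h (- u) = indicator {-1..-x} u * ((- x - u) powr (-1/2) * (1 + u) powr (lam - 1/2) * f (- u) t)"
      by (subst e) (auto simp: indicator_def)
  qed
  finally have "half_int_minus lam f x t = half_int_plus lam (\<lambda>u t. f (- u) t) (- x) t"
    by (simp add: half_int_minus_def half_int_plus_def set_lebesgue_integral_def)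
  then show ?thesis using half_int_plus_eq_half_mean[of "- x" lam "\<lambda>u t. f (- u) t" t] assms by simp
qed

lemma half_weight_integrable:
  assumes "lam \<ge> 0"
  shows "integrable lborel (\<lambda>s. indicator {0..1} s * half_weight lam s)"
  using integrable_Beta[of "lam + 1/2" "1/2"] assms
  by (simp add: set_integrable_def half_weight_def mult.commute)

lemma half_mean_cong: "(\<And>u. u \<in> {-1..1} \<Longrightarrow> f u = g u) \<Longrightarrow> x \<in> {-1..1} \<Longrightarrow> half_mean lam f x = half_mean lam g x"
  unfolding half_mean_def
proof (intro Bochner_Integration.integral_cong refl)
  fix s assume *: "\<And>u. u \<in> {-1..1} \<Longrightarrow> f u = g u" "x \<in> {-1..1}"
  have "-1 + s * (1 + x) \<in> {-1..1}" if "s \<in> {0..1}"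
    using that *(2) mult_mono[of s 1 "1 + x" 2] by auto
  then show "indicator {0..1} s * half_weight lam s * f (-1 + s * (1 + x)) =
      indicator {0..1} s * half_weight lam s * g (-1 + s * (1 + x))"
    using *(1) by (cases "s \<in> {0..1}") auto
qed

lemma half_mean_integrand_integrable:
  assumes "lam \<ge> 0" "continuous_on UNIV f" "x \<in> {-1..1}"
  shows "integrable lborel (\<lambda>s. indicator {0..1} s * half_weight lam s * f (-1 + s * (1 + x)))"
proof -
  have "compact (f ` {-1..1})"
    by (intro compact_continuous_image continuous_on_subset[OF assms(2)]) auto
  then obtain B where B: "\<And>u. u \<in> {-1..1} \<Longrightarrow> \<bar>f u\<bar> \<le> B"
    using compact_imp_bounded bounded_iff by (metis imageI real_norm_def)
  have [measurable]: "f \<in> borel_measurable borel" by (rule borel_measurable_continuous_onI[OF assms(2)])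
  show ?thesis
  proof (rule Bochner_Integration.integrable_bound[OF integrable_mult_right[OF half_weight_integrable[OF assms(1)],
      of B]])
    show "AE s in lborel. norm (indicator {0..1} s * half_weight lam s * f (-1 + s * (1 + x))) \<le>
        norm (B * (indicator {0..1} s * half_weight lam s))"
    proof (rule AE_I2)
      fix s :: real
      show "norm (indicator {0..1} s * half_weight lam s * f (-1 + s * (1 + x))) \<le>
          norm (B * (indicator {0..1} s * half_weight lam s))"
      proof (cases "s \<in> {0..1}")
        case True
        then have "-1 + s * (1 + x) \<in> {-1..1}"
          using assms(3) mult_mono[of s 1 "1 + x" 2] by auto
        from B[OF this] have "half_weight lam s * \<bar>f (-1 + s * (1 + x))\<bar> \<le> half_weight lam s * \<bar>B\<bar>"
          by (intro mult_left_mono) auto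
        then show ?thesis using True by (simp add: abs_mult mult.commute)
      qed simp
    qed
  qed measurable
qed

lemma half_mean_diff:
  assumes "lam \<ge> 0" "continuous_on UNIV f" "continuous_on UNIV g" "x \<in> {-1..1}"
  shows "half_mean lam (\<lambda>u. f u - g u) x = half_mean lam f x - half_mean lam g x"
  unfolding half_mean_def right_diff_distrib
  by (intro Bochner_Integration.integral_diff half_mean_integrand_integrable assms)

definition half_weight_tail :: "real \<Rightarrow> real \<Rightarrow> real" where
  "half_weight_tail lam r = integral {r..1} (half_weight lam)"

text \<open>
The half-order mean, at \<open>z\<close>, of the function that jumps from 0 to 1 at \<open>u\<close>. A monotone
function is a superposition of such functions. The derivative in \<open>z\<close> is \<open>half_kernel_deriv\<close>, which has
an inverse square root singularity at \<open>z = u\<close>.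
\<close>

definition half_kernel :: "real \<Rightarrow> real \<Rightarrow> real \<Rightarrow> real" where
  "half_kernel lam u z = (if z \<le> u then 0 else half_weight_tail lam ((1 + u) / (1 + z)))"

definition half_kernel_deriv :: "real \<Rightarrow> real \<Rightarrow> real \<Rightarrow> real" where
  "half_kernel_deriv lam u z = (if u < z then (z - u) powr (-1/2) * ((1 + u) powr (lam + 1/2) * (1 + z) powr (-
      lam - 1)) else 0)"

lemma half_kernel_deriv_measurable [measurable]: "(\<lambda>p. half_kernel_deriv lam (fst p) (snd p)) \<in> borel_measurable
    (borel \<Otimes>\<^sub>M borel)"
  unfolding half_kernel_deriv_def by measurable

lemma half_kernel_deriv_nonneg [simp]: "half_kernel_deriv lam u z \<ge> 0"
  by (simp add: half_kernel_deriv_def)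

lemma half_weight_integrable_on: "lam \<ge> 0 \<Longrightarrow> half_weight lam integrable_on {0..1}"
  using integrable_Beta'[of "lam + 1/2" "1/2"] by (simp add: half_weight_def[abs_def] mult.commute)

lemma half_weight_tail_eq_lebesgue:
  assumes "lam \<ge> 0" "r \<ge> 0"
  shows "(LBINT s. indicator {r..1} s * half_weight lam s) = half_weight_tail lam r"
    and "integrable lborel (\<lambda>s. indicator {r..1} s * half_weight lam s)"
proof -
  show i: "integrable lborel (\<lambda>s. indicator {r..1} s * half_weight lam s)"
    by (rule Bochner_Integration.integrable_bound[OF half_weight_integrable[OF assms(1)]])
      (use assms(2) in \<open>auto simp: indicator_def\<close>)
  then have "set_integrable lborel {r..1} (half_weight lam)" by (simp add: set_integrable_def)
  from set_borel_integral_eq_integral(2)[OF this]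
  show "(LBINT s. indicator {r..1} s * half_weight lam s) = half_weight_tail lam r"
    by (simp add: half_weight_tail_def set_lebesgue_integral_def)
qed

lemma half_weight_tail_continuous:
  assumes "lam \<ge> 0"
  shows "continuous_on {0..1} (half_weight_tail lam)"
  unfolding half_weight_tail_def[abs_def] by (rule indefinite_integral_continuous_1'[OF
      half_weight_integrable_on[OF assms]])

lemma half_weight_tail_derivative:
  assumes lam: "lam \<ge> 0" and r: "0 < r" "r < 1"
  shows "(half_weight_tail lam has_real_derivative - half_weight lam r) (at r)"
proof -
  have "isCont (half_weight lam) r"
    unfolding half_weight_def using r by (intro continuous_intros) auto
  then have "((\<lambda>u. integral {0..u} (half_weight lam)) has_vector_derivative half_weight lam r) (at r within {0..1}
      - {})"
    by (intro integral_has_vector_derivative_continuous_at half_weight_integrable_on lam)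
      (use r in \<open>auto intro: continuous_at_imp_continuous_at_within\<close>)
  then have "((\<lambda>u. integral {0..u} (half_weight lam)) has_real_derivative half_weight lam r) (at r)"
    using r by (simp add: has_real_derivative_iff_has_vector_derivative at_within_Icc_at)
  then have d: "((\<lambda>u. integral {0..1} (half_weight lam) - integral {0..u} (half_weight lam)) has_real_derivative -
      half_weight lam r) (at r)"
    by (auto intro!: derivative_eq_intros)
  have "\<forall>\<^sub>F u in nhds r. u \<in> {0<..<1}"
    by (rule eventually_nhds_in_open) (use r in auto)
  then have "\<forall>\<^sub>F u in nhds r. half_weight_tail lam u =
      integral {0..1} (half_weight lam) - integral {0..u} (half_weight lam)"
  proof (rule eventually_mono)
    fix u :: real assume "u \<in> {0<..<1}"
    then show "half_weight_tail lam u = integral {0..1} (half_weight lam) - integral {0..u} (half_weight lam)"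
      using Henstock_Kurzweil_Integration.integral_combine[of 0 u 1 "half_weight lam"] half_weight_integrable_on[OF
          lam]
      by (simp add: half_weight_tail_def)
  qed
  then show ?thesis using d by (subst DERIV_cong_ev[OF refl _ refl]) auto
qed

lemma half_kernel_derivative:
  assumes lam: "lam \<ge> 0" and u: "u > -1" and z: "z > -1" "z \<noteq> u"
  shows "(half_kernel lam u has_real_derivative half_kernel_deriv lam u z) (at z)"
proof (cases "z < u")
  case True
  have "\<forall>\<^sub>F w in nhds z. w \<in> {..<u}" by (rule eventually_nhds_in_open) (use True in auto)
  then have "\<forall>\<^sub>F w in nhds z. half_kernel lam u w = 0"
    by (rule eventually_mono) (simp add: half_kernel_def)
  then have "(half_kernel lam u has_real_derivative 0) (at z)"
    by (subst DERIV_cong_ev[OF refl _ refl]) auto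
  then show ?thesis using True by (simp add: half_kernel_deriv_def)
next
  case False
  then have uz: "u < z" using z by simp
  define r where "r = (1 + u) / (1 + z)"
  have r: "0 < r" "r < 1" using u uz by (auto simp: r_def)
  have "- 1 - u = - (1 + u)" by simp
  then have "(- 1 - u) / ((1 + z) * (1 + z)) = - ((1 + u) / (1 + z)\<^sup>2)"
    by (simp only: minus_divide_left power2_eq_square)
  moreover have "((\<lambda>w. (1 + u) / (1 + w)) has_real_derivative (- 1 - u) / ((1 + z) * (1 + z))) (at z)"
    using z by (auto intro!: derivative_eq_intros)
  ultimately have "((\<lambda>w. (1 + u) / (1 + w)) has_real_derivative - ((1 + u) / (1 + z)\<^sup>2)) (at z)"
    by (simp only:)
  from DERIV_chain2[OF half_weight_tail_derivative[OF lam r, unfolded r_def] this]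
  have d: "((\<lambda>w. half_weight_tail lam ((1 + u) / (1 + w))) has_real_derivative half_weight lam r * ((1 + u) / (1 +
      z)\<^sup>2)) (at z)"
    by (simp add: r_def)
  have "half_weight lam r * ((1 + u) / (1 + z)\<^sup>2) = half_kernel_deriv lam u z"
  proof -
    define a c where "a = 1 + u" and "c = 1 + z"
    have ac: "a > 0" "c > 0" using u z by (simp_all add: a_def c_def)
    have 1: "1 - a / c = (z - u) / c" using ac by (simp add: a_def c_def field_simps)
    have "half_weight lam (a / c) * (a / c\<^sup>2) = (z - u) powr (-1/2) * (a powr (lam - 1/2) * a powr 1) *
        (c powr (1/2) * (c powr (- (lam - 1/2)) * c powr (- 2)))"
    proof -
      have p1: "((z - u) / c) powr (-1/2) = (z - u) powr (-1/2) * c powr (1/2)"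
        using ac uz by (simp add: powr_divide powr_minus field_simps)
      have "(a / c) powr e = a powr e * c powr (- e)" for e
        using ac by (simp add: powr_divide powr_minus_divide)
      then have p2: "(a / c) powr (lam - 1/2) = a powr (lam - 1/2) * c powr (- (lam - 1/2))" .
      have p3: "a / c\<^sup>2 = a powr 1 * c powr (- 2)"
        using ac by (simp add: powr_minus powr_numeral divide_inverse)
      show ?thesis unfolding half_weight_def 1 p1 p2 p3 by (simp only: mult_ac)
    qed
    also have "a powr (lam - 1/2) * a powr 1 = a powr (lam + 1/2)"
      unfolding powr_add[symmetric] by (rule arg_cong2[where f = "(powr)"]) auto
    also have "c powr (1/2) * (c powr (- (lam - 1/2)) * c powr (- 2)) = c powr (1/2 + (- (lam - 1/2) + (-2)))"
      unfolding powr_add ..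
    also have "1/2 + (- (lam - 1/2) + (-2)) = - lam - 1" by simp
    finally show ?thesis using uz by (simp add: half_kernel_deriv_def r_def a_def c_def mult_ac)
  qed
  note d = d[unfolded this]
  have "\<forall>\<^sub>F w in nhds z. w \<in> {u<..}" by (rule eventually_nhds_in_open) (use uz in auto)
  then have "\<forall>\<^sub>F w in nhds z. half_kernel lam u w = half_weight_tail lam ((1 + u) / (1 + w))"
    by (rule eventually_mono) (simp add: half_kernel_def)
  then show ?thesis using d by (subst DERIV_cong_ev[OF refl _ refl]) auto
qed

lemma half_kernel_continuous:
  assumes lam: "lam \<ge> 0" and u: "u > -1"
  shows "continuous_on UNIV (half_kernel lam u)"
proof -
  have "continuous_on ({..u} \<union> {u..}) (\<lambda>z. if z \<le> u then 0 else half_weight_tail lam ((1 + u) / (1 + z)))"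
  proof (rule continuous_on_If)
    show "continuous_on {u..} (\<lambda>z. half_weight_tail lam ((1 + u) / (1 + z)))"
      by (rule continuous_on_compose2[OF half_weight_tail_continuous[OF lam]]) (use u in \<open>auto
          intro!: continuous_intros\<close>)
    fix z assume "z \<in> {u..}" "z \<le> u"
    then have "(1 + u) / (1 + z) = 1" using u by simp
    then show "0 = half_weight_tail lam ((1 + u) / (1 + z))" by (simp add: half_weight_tail_def)
  qed auto
  moreover have "{..u} \<union> {u..} = UNIV" by auto
  ultimately show ?thesis by (simp add: half_kernel_def[abs_def])
qed

lemma half_kernel_deriv_has_integral:
  assumes lam: "lam \<ge> 0" and u: "u > -1" and ab: "-1 \<le> a" "a \<le> b"
  shows "(half_kernel_deriv lam u has_integral (half_kernel lam u b - half_kernel lam u a)) {a..b}"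
proof (rule fundamental_theorem_of_calculus_interior_strong[of "{u}"])
  show "continuous_on {a..b} (half_kernel lam u)"
      by (rule continuous_on_subset[OF half_kernel_continuous[OF lam u]]) simp
  show "(half_kernel lam u has_vector_derivative half_kernel_deriv lam u x) (at x)" if "x \<in> {a<..<b} - {u}" for x
    using half_kernel_derivative[OF lam u, of x] that ab
        by (simp add: has_real_derivative_iff_has_vector_derivative)
qed (use ab in auto)

text \<open>
The derivative of the kernel is at most \<open>1 / sqrt c\<close> times that of \<open>2 * sqrt (z - u)\<close>.
\<close>

lemma half_kernel_diff_bound:
  assumes lam: "lam \<ge> 0" and u: "u > -1" and c: "c > 0" "-1 + c \<le> a" "a \<le> b"
  shows "0 \<le> half_kernel lam u b - half_kernel lam u a"
    and "half_kernel lam u b - half_kernel lam u a \<le> 2 / sqrt c * (sqrt (max 0 (b - u)) - sqrt (max 0 (a - u)))"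
proof -
  have I: "(half_kernel_deriv lam u has_integral (half_kernel lam u b - half_kernel lam u a)) {a..b}"
    by (rule half_kernel_deriv_has_integral[OF lam u]) (use c in auto)
  then show "0 \<le> half_kernel lam u b - half_kernel lam u a"
    by (rule has_integral_nonneg) simp
  let ?s = "\<lambda>z. 2 / sqrt c * sqrt (max 0 (z - u))"
      and ?d = "\<lambda>z. if u < z then 1 / sqrt c * (z - u) powr (-1/2) else 0"
  have J: "(?d has_integral (?s b - ?s a)) {a..b}"
  proof (rule fundamental_theorem_of_calculus_interior_strong[of "{u}"])
    show "continuous_on {a..b} ?s" by (intro continuous_intros)
    fix z assume z: "z \<in> {a<..<b} - {u}"
    have "(?s has_real_derivative ?d z) (at z)"
    proof (cases "u < z")
      case True
      have "\<forall>\<^sub>F w in nhds z. w \<in> {u<..}" by (rule eventually_nhds_in_open) (use True in auto)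
      then have ev: "\<forall>\<^sub>F w in nhds z. ?s w = 2 / sqrt c * sqrt (w - u)"
        by (rule eventually_mono) (simp add: max_def)
      have "((\<lambda>w. 2 / sqrt c * sqrt (w - u)) has_real_derivative ?d z) (at z)"
      proof -
        have e: "(z - u) powr - (1/2) = inverse (sqrt (z - u))"
          using True by (simp add: powr_minus powr_half_sqrt)
        have "((\<lambda>w. sqrt (w - u)) has_real_derivative inverse (sqrt (z - u)) / 2) (at z)"
          using True by (auto intro!: derivative_eq_intros)
        from DERIV_cmult[OF this, of "2 / sqrt c"] show ?thesis using True by (simp add: e)
      qed
      then show ?thesis using ev by (subst DERIV_cong_ev[OF refl _ refl]) auto
    next
      case False
      then have "z < u" using z by auto
      have "\<forall>\<^sub>F w in nhds z. w \<in> {..<u}" by (rule eventually_nhds_in_open) (use \<open>z < u\<close> in auto)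
      then have ev: "\<forall>\<^sub>F w in nhds z. ?s w = 0"
        by (rule eventually_mono) (simp add: max_def)
      show ?thesis using False by (subst DERIV_cong_ev[OF refl ev refl]) simp
    qed
    then show "(?s has_vector_derivative ?d z) (at z)" by (simp add: has_real_derivative_iff_has_vector_derivative)
  qed (use c in auto)
  have "half_kernel lam u b - half_kernel lam u a \<le> ?s b - ?s a"
  proof (rule has_integral_le[OF I J])
    fix z assume z: "z \<in> {a..b}"
    show "half_kernel_deriv lam u z \<le> ?d z"
    proof (cases "u < z")
      case True
      have "(1 + u) powr (lam + 1/2) \<le> (1 + z) powr (lam + 1/2)"
        using True u lam by (intro powr_mono2) auto
      then have "(1 + u) powr (lam + 1/2) * (1 + z) powr (- lam - 1) \<le>
          (1 + z) powr (lam + 1/2) * (1 + z) powr (- lam - 1)"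
        by (intro mult_right_mono) auto
      also have "\<dots> = (1 + z) powr (- (1/2))" by (simp add: powr_add[symmetric])
      also have "\<dots> \<le> c powr (- (1/2))"
        using z c by (intro powr_mono2') auto
      also have "\<dots> = 1 / sqrt c" using c by (simp add: powr_minus powr_half_sqrt field_simps)
      finally have "(z - u) powr (-1/2) * ((1 + u) powr (lam + 1/2) * (1 + z) powr (- lam - 1)) \<le>
          (z - u) powr (-1/2) * (1 / sqrt c)"
        by (intro mult_left_mono) auto
      then show ?thesis using True by (simp add: half_kernel_deriv_def)
    qed (simp add: half_kernel_deriv_def)
  qed
  then show "half_kernel lam u b - half_kernel lam u a \<le>
      2 / sqrt c * (sqrt (max 0 (b - u)) - sqrt (max 0 (a - u)))"
    by (simp add: right_diff_distrib)
qed

text \<open>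
If \<open>a\<close> is positive this is concavity; if \<open>a < 0 < b\<close> it follows from
\<open>2 * sqrt b * sqrt (- a) \<le> b - a\<close>.
\<close>

lemma sqrt_pos_part_diff:
  fixes a b :: real
  assumes "a \<noteq> 0"
  shows "\<bar>sqrt (max 0 b) - sqrt (max 0 a)\<bar> \<le> \<bar>b - a\<bar> / sqrt \<bar>a\<bar>"
proof (cases "a > 0")
  case True
  then have s: "sqrt a > 0" by simp
  show ?thesis
  proof (cases "b \<ge> 0")
    case b: True
    have "\<bar>sqrt b - sqrt a\<bar> * sqrt a \<le> \<bar>sqrt b - sqrt a\<bar> * (sqrt b + sqrt a)"
      using b by (intro mult_left_mono) auto
    also have "\<dots> = \<bar>(sqrt b - sqrt a) * (sqrt b + sqrt a)\<bar>"
      using b True by (simp add: abs_mult)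
    also have "(sqrt b - sqrt a) * (sqrt b + sqrt a) = b - a"
      using b True by (simp add: algebra_simps)
    finally show ?thesis using b True s by (simp add: max_def field_simps)
  next
    case False
    have "sqrt a * sqrt a \<le> \<bar>b - a\<bar>" using False True by simp
    then show ?thesis using False True s by (simp add: max_def field_simps)
  qed
next
  case False
  then have a: "a < 0" using assms by simp
  show ?thesis
  proof (cases "b > 0")
    case True
    define p q where "p = sqrt b" and "q = sqrt (- a)"
    have pq: "p > 0" "q > 0" "p\<^sup>2 = b" "q\<^sup>2 = - a" using True a by (simp_all add: p_def q_def)
    have "2 * p * q \<le> p\<^sup>2 + q\<^sup>2" by (rule sum_squares_bound)
    moreover have "p * q \<ge> 0" using pq by simp
    ultimately have "p * q \<le> b - a" using pq(3,4) by linarith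
    then have "p \<le> (b - a) / q" using pq by (simp add: field_simps)
    then show ?thesis using True a by (simp add: p_def q_def max_def)
  next
    case False
    then have "max 0 b = 0" "max 0 a = 0" using a by auto
    then show ?thesis by simp
  qed
qed

text \<open>
Difference quotients of the kernel at \<open>x\<close> are bounded by an inverse square root of the distance of
\<open>x\<close> to the singularity, uniformly in the second point. This is the majorant for dominated convergence.
\<close>

lemma half_kernel_lipschitz:
  assumes lam: "lam \<ge> 0" and u: "u > -1" and c: "c > 0" "-1 + c \<le> x" "-1 + c \<le> y" and "x \<noteq> u"
  shows "\<bar>half_kernel lam u y - half_kernel lam u x\<bar> \<le> 2 / sqrt c * \<bar>y - x\<bar> * \<bar>x - u\<bar> powr (-1/2)"
proof -
  have "\<bar>half_kernel lam u y - half_kernel lam u x\<bar> \<le> 2 / sqrt c * \<bar>sqrt (max 0 (y - u)) - sqrt (max 0 (x - u))\<bar>"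
  proof (cases "x \<le> y")
    case True
    have "sqrt (max 0 (y - u)) \<ge> sqrt (max 0 (x - u))" using True by simp
    then show ?thesis using half_kernel_diff_bound[OF lam u c(1,2) True] by simp
  next
    case False
    then have "y \<le> x" by simp
    have "sqrt (max 0 (y - u)) \<le> sqrt (max 0 (x - u))" using \<open>y \<le> x\<close> by simp
    then show ?thesis using half_kernel_diff_bound[OF lam u c(1,3) \<open>y \<le> x\<close>] by simp
  qed
  also have "\<dots> \<le> 2 / sqrt c * (\<bar>(y - u) - (x - u)\<bar> / sqrt \<bar>x - u\<bar>)"
    using assms(6) c by (intro mult_left_mono sqrt_pos_part_diff) auto
  also have "\<dots> = 2 / sqrt c * \<bar>y - x\<bar> * \<bar>x - u\<bar> powr (-1/2)"
    by (simp add: powr_minus_divide powr_half_sqrt)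
  finally show ?thesis .
qed

section \<open>Differentiability of half-order means\<close>

lemma inverse_sqrt_distance_nn_integral:
  assumes u: "u \<in> {-1..1}"
  shows "(\<integral>\<^sup>+z. ennreal (indicator {-1..1} z * \<bar>z - u\<bar> powr (-1/2)) \<partial>lborel) \<le> 8"
proof -
  define S where "S = (\<lambda>z. 2 * (sqrt (max 0 (z - u)) - sqrt (max 0 (u - z))))"
  have "((\<lambda>z. \<bar>z - u\<bar> powr (-1/2)) has_integral (S 1 - S (-1))) {-1..1}"
  proof (rule fundamental_theorem_of_calculus_interior_strong[of "{u}"])
    show "continuous_on {-1..1} S" unfolding S_def by (intro continuous_intros)
    fix z assume z: "z \<in> {-1<..<1} - {u}"
    have "(S has_real_derivative \<bar>z - u\<bar> powr (-1/2)) (at z)"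
    proof (cases "u < z")
      case True
      have "\<forall>\<^sub>F w in nhds z. w \<in> {u<..}" by (rule eventually_nhds_in_open) (use True in auto)
      then have ev: "\<forall>\<^sub>F w in nhds z. S w = 2 * sqrt (w - u)"
        by (rule eventually_mono) (simp add: S_def max_def)
      have e: "\<bar>z - u\<bar> powr - (1/2) = inverse (sqrt (z - u))"
        using True by (simp add: powr_minus powr_half_sqrt)
      have "((\<lambda>w. sqrt (w - u)) has_real_derivative inverse (sqrt (z - u)) / 2) (at z)"
        using True by (auto intro!: derivative_eq_intros)
      from DERIV_cmult[OF this, of 2] show ?thesis
        by (subst DERIV_cong_ev[OF refl ev refl]) (simp add: e)
    next
      case False
      then have zu: "z < u" using z by auto
      have "\<forall>\<^sub>F w in nhds z. w \<in> {..<u}" by (rule eventually_nhds_in_open) (use zu in auto)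
      then have ev: "\<forall>\<^sub>F w in nhds z. S w = -2 * sqrt (u - w)"
        by (rule eventually_mono) (simp add: S_def max_def)
      have e: "\<bar>z - u\<bar> powr - (1/2) = inverse (sqrt (u - z))"
        using zu by (simp add: powr_minus powr_half_sqrt abs_if)
      have "((\<lambda>w. sqrt (u - w)) has_real_derivative - (inverse (sqrt (u - z)) / 2)) (at z)"
        using zu by (auto intro!: derivative_eq_intros)
      from DERIV_cmult[OF this, of "-2"] show ?thesis
        by (subst DERIV_cong_ev[OF refl ev refl]) (simp add: e)
    qed
    then show "(S has_vector_derivative \<bar>z - u\<bar> powr (-1/2)) (at z)"
      by (simp add: has_real_derivative_iff_has_vector_derivative)
  qed auto
  then have "(\<integral>\<^sup>+z. ennreal (indicator {-1..1} z * \<bar>z - u\<bar> powr (-1/2)) \<partial>lborel) = ennreal (S 1 - S (-1))"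
    by (rule nn_integral_has_integral_lebesgue[rotated]) simp
  also have "S 1 - S (-1) \<le> 8"
  proof -
    have "sqrt (1 - u) \<le> 2" "sqrt (u + 1) \<le> 2" using u by (auto intro!: real_le_lsqrt)
    moreover have "max 0 (1 - u) = 1 - u" "max 0 (u - 1) = 0" "max 0 (-1 - u) = 0" "max 0 (u - (-1)) = u + 1"
      using u by auto
    ultimately show ?thesis unfolding S_def by (simp only:) simp
  qed
  finally show ?thesis by (simp add: ennreal_leI)
qed

text \<open>
With the Stieltjes measure \<open>\<mu>\<close> of \<open>F\<close>, the mean is a constant plus the integral of \<open>half_kernel lam u x\<close>
over \<open>\<mu>\<close>. By Tonelli it is an indefinite integral of \<open>g\<close>, the \<open>\<mu>\<close>-integral of the derivative of the
kernel. By Tonelli again, the integral of \<open>\<bar>x - u\<bar> powr (-1/2)\<close> over \<open>\<mu>\<close> is finite for almost every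
\<open>x\<close>, and at such \<open>x\<close> dominated convergence shows that \<open>g x\<close> is the derivative.
\<close>

lemma half_mean_mono_continuous:
  assumes lam: "lam \<ge> 0" and mono: "mono F" and F: "continuous_on UNIV F"
  obtains g where "integrable lborel (\<lambda>x. indicator {-1..1} x * g x)"
    "\<And>x. x \<in> {-1..1} \<Longrightarrow> half_mean lam F x = half_mean lam F (-1) + (LBINT z. indicator {-1..x} z * g z)"
    "AE x in lborel. x \<in> {-1<..<1} \<longrightarrow> (half_mean lam F has_real_derivative g x) (at x)"
proof -
  define m where "m = interval_measure F"
  \<comment> \<open>the part of the Stieltjes measure that is carried by the interval\<close>
  define \<mu> where "\<mu> = density m (indicator {-1<..1})"
  have monoF: "x \<le> y \<Longrightarrow> F x \<le> F y" for x y using mono by (rule monoD)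
  have rc: "continuous (at_right a) F" for a
    using F by (simp add: continuous_on_eq_continuous_at continuous_at_imp_continuous_at_within)
  have sm [simp, measurable_cong]: "sets m = sets borel" by (simp add: m_def)
  have s\<mu> [simp, measurable_cong]: "sets \<mu> = sets borel" by (simp add: \<mu>_def)
  have sp: "space \<mu> = UNIV" using sets_eq_imp_space_eq[OF s\<mu>] by simp
  have em: "emeasure \<mu> A = emeasure m ({-1<..1} \<inter> A)" if "A \<in> sets borel" for A
    unfolding \<mu>_def by (rule emeasure_restricted) (use that in simp_all)
  have \<mu>v: "emeasure \<mu> {..v} = ennreal (F v - F (-1))" if "v \<in> {-1..1}" for v
  proof -
    have "{-1<..1} \<inter> {..v} = {-1<..v}" using that by auto
    then show ?thesis
      using that emeasure_interval_measure_Ioc[of "-1" v F, OF _ monoF rc] by (simp add: em m_def)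
  qed
  have fin: "finite_measure \<mu>"
  proof
    have "emeasure \<mu> (space \<mu>) = emeasure m {-1<..1}" by (simp add: sp em)
    also have "\<dots> = ennreal (F 1 - F (-1))"
      using emeasure_interval_measure_Ioc[of "-1" 1 F, OF _ monoF rc] by (simp add: m_def)
    finally show "emeasure \<mu> (space \<mu>) \<noteq> \<infinity>" by simp
  qed
  interpret \<mu>: finite_measure \<mu> by (rule fin)
  interpret P: pair_sigma_finite lborel \<mu> by standard
  have AE\<mu>: "AE u in \<mu>. u \<in> {-1<..1}"
    unfolding \<mu>_def by (subst AE_density) (auto simp: indicator_def)
  have AEne: "AE u in \<mu>. u \<noteq> x" for x
  proof -
    have "emeasure \<mu> {x} \<le> emeasure m {x..x}" unfolding em[of "{x}", simplified]
      by (intro emeasure_mono) auto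
    also have "\<dots> = 0"
      unfolding m_def by (subst emeasure_interval_measure_Icc[OF _ monoF F]) auto
    finally have "{x} \<in> null_sets \<mu>" by (auto simp: null_sets_def)
    then show ?thesis using AE_not_in by fastforce
  qed
  define W where "W = (\<lambda>s. indicator {0..1} s * half_weight lam s)"
  have Wm [measurable]: "W \<in> borel_measurable borel" unfolding W_def by measurable
  have W0: "W s \<ge> 0" for s by (simp add: W_def)
  have Fm [measurable]: "F \<in> borel_measurable borel" by (rule borel_measurable_continuous_onI[OF F])
  define H0 where "H0 = (\<lambda>x. half_mean lam F x - half_mean lam F (-1))"
  have H0_eq: "H0 x = (LBINT s. W s * (F (-1 + s * (1 + x)) - F (-1)))" if "x \<in> {-1..1}" for x
  proof -
    have "half_mean lam (\<lambda>_. F (-1)) x = half_mean lam F (-1)"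
      by (simp add: half_mean_def)
    then show ?thesis
      using half_mean_diff[OF lam F continuous_on_const that, of "F (-1)"]
      by (simp add: H0_def W_def) (simp add: half_mean_def)
  qed
  have vin: "-1 + s * (1 + x) \<in> {-1..1}" if "s \<in> {0..1}" "x \<in> {-1..1}" for s x :: real
    using that mult_mono[of s 1 "1 + x" 2] by auto
  have H0_nn: "ennreal (H0 x) = (\<integral>\<^sup>+s. ennreal (W s * (F (-1 + s * (1 + x)) - F (-1))) \<partial>lborel)"
    and H0_nonneg: "H0 x \<ge> 0" if x: "x \<in> {-1..1}" for x
  proof -
    have "integrable lborel (\<lambda>s. indicator {0..1} s * half_weight lam s * (F (-1 + s * (1 + x)) - F (-1)))"
      by (rule half_mean_integrand_integrable[OF lam _ x]) (intro continuous_intros F)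
    then have i: "integrable lborel (\<lambda>s. W s * (F (-1 + s * (1 + x)) - F (-1)))" by (simp add: W_def)
    have nn: "0 \<le> W s * (F (-1 + s * (1 + x)) - F (-1))" for s
    proof (cases "s \<in> {0..1}")
      case True
      then show ?thesis using monoF[of "-1" "-1 + s * (1 + x)"] vin[OF True x] W0[of s] by simp
    qed (simp add: W_def)
    show "H0 x \<ge> 0" unfolding H0_eq[OF x] by (intro integral_nonneg_AE AE_I2 nn)
    show "ennreal (H0 x) = (\<integral>\<^sup>+s. ennreal (W s * (F (-1 + s * (1 + x)) - F (-1))) \<partial>lborel)"
      unfolding H0_eq[OF x] by (intro nn_integral_eq_integral[symmetric] i AE_I2 nn)
  qed
  have H0_kk: "ennreal (H0 x) = (\<integral>\<^sup>+u. ennreal (half_kernel lam u x) \<partial>\<mu>)" if x: "-1 < x" "x \<le> 1" for x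
  proof -
    have x': "x \<in> {-1..1}" using x by auto
    have "ennreal (H0 x) = (\<integral>\<^sup>+s. \<integral>\<^sup>+u. ennreal (W s) * indicator {..-1 + s * (1 + x)} u \<partial>\<mu> \<partial>lborel)"
      unfolding H0_nn[OF x']
    proof (intro nn_integral_cong)
      fix s :: real
      show "ennreal (W s * (F (-1 + s * (1 + x)) - F (-1))) =
          (\<integral>\<^sup>+u. ennreal (W s) * indicator {..-1 + s * (1 + x)} u \<partial>\<mu>)"
      proof (cases "s \<in> {0..1}")
        case True
        then show ?thesis using \<mu>v[OF vin[OF True x']] W0[of s]
          by (simp add: nn_integral_cmult ennreal_mult')
      qed (simp add: W_def)
    qed
    also have "\<dots> = (\<integral>\<^sup>+u. \<integral>\<^sup>+s. ennreal (W s) * indicator {..-1 + s * (1 + x)} u \<partial>lborel \<partial>\<mu>)"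
      by (rule P.Fubini'[symmetric]) (simp add: indicator_def[abs_def] split_def)
    also have "\<dots> = (\<integral>\<^sup>+u. ennreal (half_kernel lam u x) \<partial>\<mu>)"
    proof (rule nn_integral_cong_AE)
      show "AE u in \<mu>. (\<integral>\<^sup>+s. ennreal (W s) * indicator {..-1 + s * (1 + x)} u \<partial>lborel) =
          ennreal (half_kernel lam u x)"
        using AE\<mu>
      proof (rule eventually_mono)
        fix u assume u: "u \<in> {-1<..1::real}"
        define r where "r = (1 + u) / (1 + x)"
        have r: "r \<ge> 0" using u x by (simp add: r_def)
        have iff: "u \<le> s * (1 + x) - 1 \<longleftrightarrow> r \<le> s" for s
          using x by (simp add: r_def divide_le_eq) linarith
        have "(\<integral>\<^sup>+s. ennreal (W s) * indicator {..-1 + s * (1 + x)} u \<partial>lborel) =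
            (\<integral>\<^sup>+s. ennreal (indicator {r..1} s * half_weight lam s) \<partial>lborel)"
        proof (rule nn_integral_cong)
          fix s :: real
          show "ennreal (W s) * indicator {..-1 + s * (1 + x)} u =
              ennreal (indicator {r..1} s * half_weight lam s)"
            using r by (cases "r \<le> s") (auto simp: W_def indicator_def iff)
        qed
        also have "\<dots> = ennreal (half_weight_tail lam r)"
          unfolding half_weight_tail_eq_lebesgue(1)[OF lam r, symmetric]
          by (rule nn_integral_eq_integral[OF half_weight_tail_eq_lebesgue(2)[OF lam r]]) simp
        also have "half_weight_tail lam r = half_kernel lam u x"
        proof (cases "x \<le> u")
          case True
          then have "r \<ge> 1" using x by (simp add: r_def)
          then have "half_weight_tail lam r = 0" by (cases "r = 1") (simp_all add: half_weight_tail_def)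
          then show ?thesis using True by (simp add: half_kernel_def)
        qed (simp add: half_kernel_def r_def)
        finally show "(\<integral>\<^sup>+s. ennreal (W s) * indicator {..-1 + s * (1 + x)} u \<partial>lborel) =
            ennreal (half_kernel lam u x)" .
      qed
    qed
    finally show ?thesis .
  qed
  have Dm [measurable]: "(\<lambda>u. half_kernel_deriv lam u z) \<in> borel_measurable borel" for z
    unfolding half_kernel_deriv_def by measurable
  define G where "G = (\<lambda>z. \<integral>\<^sup>+u. ennreal (half_kernel_deriv lam u z) \<partial>\<mu>)"
  have Gm [measurable]: "G \<in> borel_measurable borel"
  proof -
    have "(\<lambda>(z, u). ennreal (half_kernel_deriv lam u z)) \<in> borel_measurable (borel \<Otimes>\<^sub>M \<mu>)"
      unfolding half_kernel_deriv_def by measurable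
    then show ?thesis unfolding G_def by (rule \<mu>.borel_measurable_nn_integral)
  qed
  have H0_G: "ennreal (H0 x) = (\<integral>\<^sup>+z. indicator {-1..x} z * G z \<partial>lborel)" if x: "-1 < x" "x \<le> 1" for x
  proof -
    have "ennreal (H0 x) = (\<integral>\<^sup>+u. \<integral>\<^sup>+z. indicator {-1..x} z * ennreal (half_kernel_deriv lam u z) \<partial>lborel \<partial>\<mu>)"
      unfolding H0_kk[OF x]
    proof (rule nn_integral_cong_AE)
      show "AE u in \<mu>. ennreal (half_kernel lam u x) =
          (\<integral>\<^sup>+z. indicator {-1..x} z * ennreal (half_kernel_deriv lam u z) \<partial>lborel)"
        using AE\<mu>
      proof (rule eventually_mono)
        fix u assume u: "u \<in> {-1<..1::real}"
        have "(half_kernel_deriv lam u has_integral (half_kernel lam u x - half_kernel lam u (-1))) {-1..x}"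
          by (rule half_kernel_deriv_has_integral[OF lam]) (use u x in auto)
        then have "(\<integral>\<^sup>+z. ennreal (indicator {-1..x} z * half_kernel_deriv lam u z) \<partial>lborel) =
            ennreal (half_kernel lam u x - half_kernel lam u (-1))"
          by (rule nn_integral_has_integral_lebesgue[rotated]) simp
        moreover have "half_kernel lam u (-1) = 0" using u by (simp add: half_kernel_def)
        moreover have "ennreal (indicator {-1..x} z * half_kernel_deriv lam u z) =
            indicator {-1..x} z * ennreal (half_kernel_deriv lam u z)" for z
          by (simp add: indicator_def)
        ultimately show "ennreal (half_kernel lam u x) =
            (\<integral>\<^sup>+z. indicator {-1..x} z * ennreal (half_kernel_deriv lam u z) \<partial>lborel)" by simp
      qed
    qed
    also have "\<dots> = (\<integral>\<^sup>+z. \<integral>\<^sup>+u. indicator {-1..x} z * ennreal (half_kernel_deriv lam u z) \<partial>\<mu> \<partial>lborel)"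
      by (rule P.Fubini') (unfold half_kernel_deriv_def, measurable)
    also have "\<dots> = (\<integral>\<^sup>+z. indicator {-1..x} z * G z \<partial>lborel)"
      unfolding G_def by (intro nn_integral_cong nn_integral_cmult) simp
    finally show ?thesis .
  qed
  define g where "g = (\<lambda>z. enn2real (G z))"
  have gegenbauer_measure [measurable]: "g \<in> borel_measurable borel" unfolding g_def by measurable
  have g0: "g z \<ge> 0" for z by (simp add: g_def)
  have Gfin: "AE z in lborel. z \<in> {-1..1} \<longrightarrow> G z < \<infinity>"
  proof -
    have "(\<integral>\<^sup>+z. indicator {-1..1} z * G z \<partial>lborel) = ennreal (H0 1)" using H0_G[of 1] by simp
    then have "(\<integral>\<^sup>+z. indicator {-1..1} z * G z \<partial>lborel) \<noteq> \<infinity>" by simp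
    then have "AE z in lborel. indicator {-1..1} z * G z \<noteq> \<infinity>"
      by (intro nn_integral_PInf_AE) auto
    then show ?thesis by (rule eventually_mono) (auto simp: indicator_def less_top)
  qed
  have nn_g: "(\<integral>\<^sup>+z. ennreal (indicator {-1..x} z * g z) \<partial>lborel) = ennreal (H0 x)" if x: "-1 < x" "x \<le> 1" for x
    unfolding H0_G[OF x]
  proof (rule nn_integral_cong_AE)
    show "AE z in lborel. ennreal (indicator {-1..x} z * g z) = indicator {-1..x} z * G z"
      using Gfin by (rule eventually_mono) (use x in \<open>auto simp: indicator_def g_def\<close>)
  qed
  show ?thesis
  proof (rule that[of g])
    show "integrable lborel (\<lambda>x. indicator {-1..1} x * g x)"
      by (rule integrableI_nonneg) (use nn_g[of 1] g0 in auto)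
    show "half_mean lam F x = half_mean lam F (-1) + (LBINT z. indicator {-1..x} z *
        g z)" if x: "x \<in> {-1..1}" for x
    proof (cases "x = -1")
      case True
      have "AE z in lborel. z \<noteq> (-1::real)" by (rule AE_lborel_singleton)
      then have "AE z in lborel. indicator {-1..x} z * g z = 0"
        by (rule eventually_mono) (use True in \<open>auto simp: indicator_def\<close>)
      then have "(LBINT z. indicator {-1..x} z * g z) = 0" by (rule integral_eq_zero_AE)
      then show ?thesis using True by simp
    next
      case False
      then have "-1 < x" "x \<le> 1" using x by auto
      then have "(LBINT z. indicator {-1..x} z * g z) = H0 x"
        using H0_nonneg[OF x] g0 by (subst integral_eq_nn_integral) (simp_all add: nn_g)
      then show ?thesis by (simp add: H0_def)
    qed
    have good: "AE x in lborel. x \<in> {-1..1} \<longrightarrow> (\<integral>\<^sup>+u. ennreal (\<bar>x - u\<bar> powr (-1/2)) \<partial>\<mu>) < \<infinity>"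
    proof -
      define Q where "Q = (\<lambda>x. \<integral>\<^sup>+u. ennreal (\<bar>x - u\<bar> powr (-1/2)) \<partial>\<mu>)"
      have Qm [measurable]: "Q \<in> borel_measurable borel"
      proof -
        have "(\<lambda>(z, u). ennreal (\<bar>z - u\<bar> powr (-1/2))) \<in> borel_measurable (borel \<Otimes>\<^sub>M \<mu>)"
          by measurable
        then show ?thesis unfolding Q_def by (rule \<mu>.borel_measurable_nn_integral)
      qed
      have "(\<integral>\<^sup>+x. indicator {-1..1} x * Q x \<partial>lborel) =
          (\<integral>\<^sup>+x. \<integral>\<^sup>+u. ennreal (indicator {-1..1} x * \<bar>x - u\<bar> powr (-1/2)) \<partial>\<mu> \<partial>lborel)"
        unfolding Q_def by (intro nn_integral_cong) (simp add: nn_integral_cmult[symmetric] indicator_def)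
      also have "\<dots> = (\<integral>\<^sup>+u. \<integral>\<^sup>+x. ennreal (indicator {-1..1} x * \<bar>x - u\<bar> powr (-1/2)) \<partial>lborel \<partial>\<mu>)"
        by (rule P.Fubini'[symmetric]) measurable
      also have "\<dots> \<le> (\<integral>\<^sup>+u. 8 \<partial>\<mu>)"
      proof (rule nn_integral_mono_AE)
        show "AE u in \<mu>. (\<integral>\<^sup>+x. ennreal (indicator {-1..1} x * \<bar>x - u\<bar> powr (-1/2)) \<partial>lborel) \<le> 8"
          using AE\<mu> by (rule eventually_mono) (intro inverse_sqrt_distance_nn_integral, auto)
      qed
      also have "\<dots> < \<infinity>" using \<mu>.emeasure_finite[of UNIV] less_top[of "emeasure \<mu> UNIV"]
        by (simp add: sp ennreal_mult_less_top)
      finally have "AE x in lborel. indicator {-1..1} x * Q x \<noteq> \<infinity>"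
        by (intro nn_integral_PInf_AE) auto
      then show ?thesis unfolding Q_def by (rule eventually_mono) (auto simp: indicator_def less_top)
    qed
    show "AE x in lborel. x \<in> {-1<..<1} \<longrightarrow> (half_mean lam F has_real_derivative g x) (at x)"
      using good
    proof (rule eventually_mono, intro impI)
      fix x :: real
      assume good: "x \<in> {-1..1} \<longrightarrow> (\<integral>\<^sup>+u. ennreal (\<bar>x - u\<bar> powr (-1/2)) \<partial>\<mu>) < \<infinity>" and x: "x \<in> {-1<..<1}"
      \<comment> \<open>keeps the second point of the difference quotients away from \<open>-1\<close>, where the kernel estimate degenerates\<close>
      define c where "c = (1 + x) / 2"
      have c: "c > 0" "-1 + c \<le> x" using x by (simp_all add: c_def)
      \<comment> \<open>agrees with the kernel for \<open>u > -1\<close> but is continuous, hence measurable, in \<open>u\<close>\<close>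
      define kc where "kc = (\<lambda>y u. half_weight_tail lam (max 0 (min 1 ((1 + u) / (1 + y)))))"
      have kc_kk: "kc y u = half_kernel lam u y" if "y > -1" "u > -1" for y u
      proof (cases "y \<le> u")
        case True
        then have "(1 + u) / (1 + y) \<ge> 1" using that by simp
        then show ?thesis using True by (simp add: kc_def half_kernel_def half_weight_tail_def)
      next
        case False
        then have "(1 + u) / (1 + y) \<le> 1" "(1 + u) / (1 + y) \<ge> 0" using that by simp_all
        then show ?thesis using False by (simp add: kc_def half_kernel_def)
      qed
      have kc_c: "continuous_on UNIV (kc y)" if "y > -1" for y
        unfolding kc_def
        by (rule continuous_on_compose2[OF half_weight_tail_continuous[OF lam]]) (use that in \<open>auto
            intro!: continuous_intros\<close>)
      have kc_m [measurable]: "kc y \<in> borel_measurable borel" if "y > -1" for y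
        by (rule borel_measurable_continuous_onI[OF kc_c[OF that]])
      have kk0: "half_kernel lam u y \<ge> 0" if "u > -1" "y > -1" for u y
      proof (cases "y \<le> u")
        case False
        have "(1 + u) / (1 + y) \<ge> 0" using that by simp
        from half_weight_tail_eq_lebesgue(1)[OF lam this] have "half_weight_tail lam ((1 + u) / (1 + y)) \<ge> 0"
          by (metis (no_types, lifting) half_weight_nonneg indicator_pos_le integral_nonneg_AE AE_I2
              mult_nonneg_nonneg)
        then show ?thesis using False by (simp add: half_kernel_def)
      qed (simp add: half_kernel_def)
      have kc_int: "integrable \<mu> (kc y)" "H0 y = (\<integral>u. kc y u \<partial>\<mu>)" if y: "y \<in> {-1<..1}" for y
      proof -
        have nn: "AE u in \<mu>. 0 \<le> kc y u"
          using AE\<mu> by (rule eventually_mono) (use kc_kk kk0 y in simp)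
        have "(\<integral>\<^sup>+u. ennreal (kc y u) \<partial>\<mu>) = (\<integral>\<^sup>+u. ennreal (half_kernel lam u y) \<partial>\<mu>)"
        proof (rule nn_integral_cong_AE)
          show "AE u in \<mu>. ennreal (kc y u) = ennreal (half_kernel lam u y)"
            using AE\<mu> by (rule eventually_mono) (use kc_kk y in simp)
        qed
        also have "\<dots> = ennreal (H0 y)" using H0_kk[of y] y by simp
        finally have e: "(\<integral>\<^sup>+u. ennreal (kc y u) \<partial>\<mu>) = ennreal (H0 y)" .
        show "integrable \<mu> (kc y)"
          by (rule integrableI_nonneg) (use kc_m y nn e in auto)
        show "H0 y = (\<integral>u. kc y u \<partial>\<mu>)"
          using H0_nonneg[of y] y nn kc_m by (subst integral_eq_nn_integral) (auto simp: e)
      qed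
      have wint: "integrable \<mu> (\<lambda>u. 2 / sqrt c * \<bar>x - u\<bar> powr (-1/2))"
        by (intro integrable_mult_right integrableI_nonneg) (use good x in auto)
      have gx: "g x = (\<integral>u. half_kernel_deriv lam u x \<partial>\<mu>)"
        unfolding g_def G_def by (subst integral_eq_nn_integral) auto
      show "(half_mean lam F has_real_derivative g x) (at x)"
        unfolding has_field_derivative_iff tendsto_at_iff_sequentially
      proof (intro allI impI)
        fix X :: "nat \<Rightarrow> real" assume X: "\<forall>i. X i \<in> UNIV - {x}" and lim: "X \<longlonglongrightarrow> x"
        have "\<forall>\<^sub>F i in sequentially. X i \<in> {-1 + c<..<1}"
          by (rule topological_tendstoD[OF lim]) (use x in \<open>auto simp: c_def\<close>)
        then obtain N where N: "\<And>i. i \<ge> N \<Longrightarrow> X i \<in> {-1 + c<..<1}"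
          unfolding eventually_sequentially by blast
        define Y where "Y = (\<lambda>i. X (i + N))"
        have Y: "Y i \<in> {-1 + c<..<1}" "Y i \<noteq> x" for i using N X by (auto simp: Y_def)
        have Yx: "Y \<longlonglongrightarrow> x" unfolding Y_def by (rule LIMSEQ_ignore_initial_segment[OF lim])
        have Y1: "Y i \<in> {-1<..1}" for i using Y(1)[of i] c by auto
        have x1: "x \<in> {-1<..1}" using x by auto
        have "(\<lambda>i. \<integral>u. (kc (Y i) u - kc x u) / (Y i - x) \<partial>\<mu>) \<longlonglongrightarrow> (\<integral>u. half_kernel_deriv lam u x \<partial>\<mu>)"
        proof (rule integral_dominated_convergence[OF _ _ wint])
          show "(\<lambda>u. half_kernel_deriv lam u x) \<in> borel_measurable \<mu>" by measurable
          show "(\<lambda>u. (kc (Y i) u - kc x u) / (Y i - x)) \<in> borel_measurable \<mu>" for i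
            using kc_m[of "Y i"] kc_m[of x] Y1[of i] x1 by (intro borel_measurable_divide borel_measurable_diff)
                auto
          show "AE u in \<mu>. (\<lambda>i. (kc (Y i) u - kc x u) / (Y i - x)) \<longlonglongrightarrow> half_kernel_deriv lam u x"
            using AE\<mu> AEne[of x]
          proof eventually_elim
            case (elim u)
            have "(half_kernel lam u has_real_derivative half_kernel_deriv lam u x) (at x)"
              by (rule half_kernel_derivative[OF lam]) (use elim x in auto)
            then have "((\<lambda>y. (half_kernel lam u y - half_kernel lam u x) / (y -
                x)) \<circ> Y) \<longlonglongrightarrow> half_kernel_deriv lam u x"
              using Y(2) Yx unfolding has_field_derivative_iff tendsto_at_iff_sequentially by blast
            moreover have "((\<lambda>y. (half_kernel lam u y - half_kernel lam u x) / (y - x)) \<circ> Y) =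
                (\<lambda>i. (kc (Y i) u - kc x u) / (Y i - x))"
              using kc_kk Y1 x1 elim by (auto simp: fun_eq_iff)
            ultimately show ?case by simp
          qed
          show "AE u in \<mu>. norm ((kc (Y i) u - kc x u) / (Y i - x)) \<le> 2 / sqrt c * \<bar>x - u\<bar> powr (-1/2)" for i
            using AE\<mu> AEne[of x]
          proof eventually_elim
            case (elim u)
            have "\<bar>half_kernel lam u (Y i) - half_kernel lam u x\<bar> \<le> 2 / sqrt c * \<bar>Y i - x\<bar> * \<bar>x - u\<bar> powr (-1/2)"
              by (rule half_kernel_lipschitz[OF lam _ c(1,2)]) (use elim Y(1)[of i] in auto)
            moreover have "\<bar>Y i - x\<bar> > 0" using Y(2)[of i] by simp
            ultimately have "\<bar>half_kernel lam u (Y i) - half_kernel lam u x\<bar> / \<bar>Y i - x\<bar> \<le>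
                2 / sqrt c * \<bar>x - u\<bar> powr (-1/2)"
              by (subst pos_divide_le_eq) (auto simp: mult_ac)
            then show ?case using kc_kk Y1[of i] x1 elim by (simp add: abs_divide)
          qed
        qed
        moreover have "(\<integral>u. (kc (Y i) u - kc x u) / (Y i - x) \<partial>\<mu>) =
            (half_mean lam F (Y i) - half_mean lam F x) / (Y i - x)" for i
        proof -
          have "(\<integral>u. (kc (Y i) u - kc x u) / (Y i - x) \<partial>\<mu>) = (H0 (Y i) - H0 x) / (Y i - x)"
            using kc_int[OF Y1[of i]] kc_int[OF x1] by simp
          then show ?thesis by (simp add: H0_def)
        qed
        ultimately have "(\<lambda>i. (half_mean lam F (Y i) - half_mean lam F x) / (Y i - x)) \<longlonglongrightarrow> g x"
          unfolding gx by (simp only:)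
        then have "(\<lambda>i. ((\<lambda>y. (half_mean lam F y - half_mean lam F x) / (y - x)) \<circ> X) (i + N)) \<longlonglongrightarrow> g x"
          by (simp add: Y_def comp_def)
        then show "((\<lambda>y. (half_mean lam F y - half_mean lam F x) / (y - x)) \<circ> X) \<longlonglongrightarrow> g x"
          by (rule LIMSEQ_offset)
      qed
    qed
  qed
qed

theorem half_mean_absolutely_continuous:
  assumes lam: "lam \<ge> 0" and f: "absolutely_continuous_on_interval (-1) 1 f"
  obtains g where "integrable lborel (\<lambda>x. indicator {-1..1} x * g x)"
    "\<And>x. x \<in> {-1..1} \<Longrightarrow> half_mean lam f x = half_mean lam f (-1) + (LBINT z. indicator {-1..x} z * g z)"
    "AE x in lborel. x \<in> {-1<..<1} \<longrightarrow> (half_mean lam f has_real_derivative g x) (at x)"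
proof -
  obtain F1 F2 where F: "mono F1" "mono F2" "continuous_on UNIV F1" "continuous_on UNIV F2"
    "\<And>x. x \<in> {-1..1} \<Longrightarrow> f x = F1 x - F2 x"
    using absolutely_continuous_mono_diff[OF f] by auto
  obtain g1 where g1: "integrable lborel (\<lambda>x. indicator {-1..1} x * g1 x)"
    "\<And>x. x \<in> {-1..1} \<Longrightarrow> half_mean lam F1 x = half_mean lam F1 (-1) + (LBINT z. indicator {-1..x} z * g1 z)"
    "AE x in lborel. x \<in> {-1<..<1} \<longrightarrow> (half_mean lam F1 has_real_derivative g1 x) (at x)"
    using half_mean_mono_continuous[OF lam F(1,3)] by blast
  obtain g2 where g2: "integrable lborel (\<lambda>x. indicator {-1..1} x * g2 x)"
    "\<And>x. x \<in> {-1..1} \<Longrightarrow> half_mean lam F2 x = half_mean lam F2 (-1) + (LBINT z. indicator {-1..x} z * g2 z)"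
    "AE x in lborel. x \<in> {-1<..<1} \<longrightarrow> (half_mean lam F2 has_real_derivative g2 x) (at x)"
    using half_mean_mono_continuous[OF lam F(2,4)] by blast
  have eq: "half_mean lam f x = half_mean lam F1 x - half_mean lam F2 x" if "x \<in> {-1..1}" for x
    using half_mean_cong[OF F(5) that, where lam = lam] half_mean_diff[OF lam F(3,4) that] by simp
  have sub: "integrable lborel (\<lambda>z. indicator {-1..x} z * g z)"
    if "integrable lborel (\<lambda>x. indicator {-1..1} x * g x)" "x \<in> {-1..1}" for g :: "real \<Rightarrow> real" and x
  proof -
    have "integrable lborel (\<lambda>z. indicator {-1..x} z *\<^sub>R (indicator {-1..1} z * g z))"
      by (intro integrable_mult_indicator that) auto
    moreover have "(\<lambda>z. indicator {-1..x} z *\<^sub>R (indicator {-1..1} z * g z)) = (\<lambda>z. indicator {-1..x} z * g z)"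
      using that(2) by (auto simp: indicator_def fun_eq_iff)
    ultimately show ?thesis by simp
  qed
  show ?thesis
  proof (rule that[of "\<lambda>x. g1 x - g2 x"])
    show "integrable lborel (\<lambda>x. indicator {-1..1} x * (g1 x - g2 x))"
      using g1(1) g2(1) by (simp add: right_diff_distrib)
    show "half_mean lam f x = half_mean lam f (-1) + (LBINT z. indicator {-1..x} z * (g1 z -
        g2 z))" if x: "x \<in> {-1..1}" for x
      using sub[OF g1(1) x] sub[OF g2(1) x] g1(2)[OF x] g2(2)[OF x] eq[OF x] eq[of "-1"]
      by (simp add: right_diff_distrib)
    show "AE x in lborel. x \<in> {-1<..<1} \<longrightarrow> (half_mean lam f has_real_derivative g1 x - g2 x) (at x)"
      using g1(3) g2(3)
    proof eventually_elim
      case (elim x)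
      show ?case
      proof
        assume x: "x \<in> {-1<..<1}"
        have "\<forall>\<^sub>F y in nhds x. y \<in> {-1<..<1}" by (rule eventually_nhds_in_open) (use x in auto)
        then have ev: "\<forall>\<^sub>F y in nhds x. half_mean lam f y = half_mean lam F1 y - half_mean lam F2 y"
          by (rule eventually_mono) (rule eq, auto)
        show "(half_mean lam f has_real_derivative g1 x - g2 x) (at x)"
          using elim x by (subst DERIV_cong_ev[OF refl ev refl]) (auto intro: DERIV_diff)
      qed
    qed
  qed
qed

section \<open>Half-order means of powers and integration by parts\<close>

text \<open>
Fubini for \<open>g x * \<psi> z\<close> over the triangle \<open>x \<le> z\<close>.
\<close>

lemma integral_by_parts_density:
  fixes g \<psi> G \<Psi> :: "real \<Rightarrow> real"
  assumes g: "integrable lborel (\<lambda>x. indicator {-1..1} x * g x)"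
    and \<psi>: "integrable lborel (\<lambda>x. indicator {-1..1} x * \<psi> x)"
    and G: "\<And>x. x \<in> {-1..1} \<Longrightarrow> G x = G (-1) + (LBINT z. indicator {-1..x} z * g z)"
    and \<Psi>: "\<And>x. x \<in> {-1..1} \<Longrightarrow> \<Psi> x = \<Psi> 1 - (LBINT z. indicator {x..1} z * \<psi> z)"
    and \<Psi>0: "\<Psi> (-1) = 0"
    and int: "integrable lborel (\<lambda>x. indicator {-1..1} x * (\<psi> x * G x))"
  shows "(LBINT x. indicator {-1..1} x * (\<Psi> x * g x)) = \<Psi> 1 * G 1 - (LBINT x. indicator {-1..1} x * (\<psi> x * G x))"
proof -
  define g1 where "g1 = (\<lambda>x. indicator {-1..1} x * g x)"
  define \<psi>1 where "\<psi>1 = (\<lambda>x. indicator {-1..1} x * \<psi> x)"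
  have ig: "integrable lborel g1" and i\<psi>: "integrable lborel \<psi>1"
    using g \<psi> by (simp_all add: g1_def \<psi>1_def)
  note [measurable] = borel_measurable_integrable[OF ig] borel_measurable_integrable[OF i\<psi>]
  define f where "f = (\<lambda>x z. g1 x * \<psi>1 z * (if x \<le> z then 1 else 0))"
  have fm: "(\<lambda>(x, z). f x z) \<in> borel_measurable (lborel \<Otimes>\<^sub>M lborel)"
    unfolding f_def by measurable
  have ifx: "integrable lborel (f x)" for x
    unfolding f_def by (rule Bochner_Integration.integrable_bound[OF integrable_mult_right[OF i\<psi>, of "g1 x"]]) auto
  have ifz: "integrable lborel (\<lambda>x. f x z)" for z
    unfolding f_def by (rule Bochner_Integration.integrable_bound[OF integrable_mult_left[OF ig, of "\<psi>1 z"]]) auto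
  have "integrable (lborel \<Otimes>\<^sub>M lborel) (\<lambda>(x, z). f x z)"
  proof (rule lborel_pair.Fubini_integrable[OF fm])
    have nm: "(\<lambda>x. LBINT z. norm (f x z)) \<in> borel_measurable lborel"
      unfolding f_def by measurable
    show "integrable lborel (\<lambda>x. LBINT z. norm (case (x, z) of (x, z) \<Rightarrow> f x z))"
    proof (rule Bochner_Integration.integrable_bound)
      show "integrable lborel (\<lambda>x. \<bar>g1 x\<bar> * (LBINT z. \<bar>\<psi>1 z\<bar>))" using ig by simp
      show "AE x in lborel. norm (LBINT z. norm (case (x, z) of (x, z) \<Rightarrow> f x z)) \<le>
          norm (\<bar>g1 x\<bar> * (LBINT z. \<bar>\<psi>1 z\<bar>))"
      proof (rule AE_I2)
        fix x
        have "(LBINT z. norm (f x z)) \<le> (LBINT z. \<bar>g1 x\<bar> * \<bar>\<psi>1 z\<bar>)"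
        proof (rule integral_mono)
          show "integrable lborel (\<lambda>z. norm (f x z))" by (rule integrable_norm[OF ifx])
          show "integrable lborel (\<lambda>z. \<bar>g1 x\<bar> * \<bar>\<psi>1 z\<bar>)" using i\<psi> by simp
        qed (simp add: f_def abs_mult)
        then show "norm (LBINT z. norm (case (x, z) of (x, z) \<Rightarrow> f x z)) \<le> norm (\<bar>g1 x\<bar> * (LBINT z. \<bar>\<psi>1 z\<bar>))"
          by simp
      qed
    qed (use nm in simp)
    show "AE x in lborel. integrable lborel (\<lambda>z. case (x, z) of (x, z) \<Rightarrow> f x z)"
      using ifx by simp
  qed
  from lborel_pair.Fubini_integral[OF this]
  have fub: "(LBINT z. LBINT x. f x z) = (LBINT x. LBINT z. f x z)" .
  have inz: "(LBINT z. f x z) = g1 x * (\<Psi> 1 - \<Psi> x)" for x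
  proof (cases "x \<in> {-1..1}")
    case True
    have "(LBINT z. f x z) = (LBINT z. g1 x * (indicator {x..1} z * \<psi> z))"
      unfolding f_def \<psi>1_def by (intro Bochner_Integration.integral_cong refl) (use True in \<open>auto simp:
          indicator_def\<close>)
    then show ?thesis using \<Psi>[OF True] by simp
  qed (simp add: f_def g1_def)
  have inx: "(LBINT x. f x z) = \<psi>1 z * (G z - G (-1))" for z
  proof (cases "z \<in> {-1..1}")
    case True
    have "(LBINT x. f x z) = (LBINT x. \<psi>1 z * (indicator {-1..z} x * g x))"
      unfolding f_def g1_def by (intro Bochner_Integration.integral_cong refl) (use True in \<open>auto simp:
          indicator_def\<close>)
    then show ?thesis using G[OF True] by simp
  qed (simp add: f_def \<psi>1_def)
  have ig\<Psi>: "integrable lborel (\<lambda>x. g1 x * (\<Psi> 1 - \<Psi> x))"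
    unfolding inz[symmetric] by (rule lborel_pair.integrable_fst[OF \<open>integrable (lborel \<Otimes>\<^sub>M lborel) (\<lambda>(x,
        z). f x z)\<close>, simplified])
  have "(LBINT x. indicator {-1..1} x * (\<Psi> x * g x)) = (LBINT x. \<Psi> 1 * g1 x - g1 x * (\<Psi> 1 - \<Psi> x))"
    by (intro Bochner_Integration.integral_cong refl) (simp add: g1_def algebra_simps)
  also have "\<dots> = \<Psi> 1 * (LBINT x. g1 x) - (LBINT x. g1 x * (\<Psi> 1 - \<Psi> x))"
    using ig ig\<Psi> by simp
  also have "(LBINT x. g1 x * (\<Psi> 1 - \<Psi> x)) = (LBINT z. \<psi>1 z * (G z - G (-1)))"
    using fub unfolding inz inx by simp
  also have "\<dots> = (LBINT z. indicator {-1..1} z * (\<psi> z * G z) - G (-1) * \<psi>1 z)"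
    by (intro Bochner_Integration.integral_cong refl) (simp add: \<psi>1_def algebra_simps)
  also have "\<dots> = (LBINT z. indicator {-1..1} z * (\<psi> z * G z)) - G (-1) * (LBINT z. \<psi>1 z)"
    using int i\<psi> by simp
  also have "(LBINT z. \<psi>1 z) = \<Psi> 1" using \<Psi>[of "-1"] \<Psi>0 by (simp add: \<psi>1_def)
  also have "(LBINT x. g1 x) = G 1 - G (-1)" using G[of 1] by (simp add: g1_def)
  finally show ?thesis by (simp add: algebra_simps)
qed

lemma half_mean_continuous:
  assumes lam: "lam \<ge> 0" and f: "continuous_on UNIV f"
  shows "continuous_on UNIV (\<lambda>x. half_mean lam f x)"
proof -
  define \<nu> where "\<nu> = density lborel (\<lambda>s. ennreal (indicator {0..1} s * half_weight lam s))"
  interpret finite_interval_measure \<nu>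
  proof (intro finite_interval_measure.intro finite_interval_measure_axioms.intro finite_measureI)
    have "emeasure \<nu> (space \<nu>) = (\<integral>\<^sup>+ x. ennreal (indicator {0..1} x * half_weight lam x) \<partial>lborel)"
      by (simp add: \<nu>_def emeasure_density)
    also have "\<dots> = ennreal (LBINT x. indicator {0..1} x * half_weight lam x)"
      by (rule nn_integral_eq_integral[OF half_weight_integrable[OF lam]]) simp
    finally show "emeasure \<nu> (space \<nu>) \<noteq> \<infinity>" by simp
    show "sets \<nu> = sets borel" by (simp add: \<nu>_def)
    show "AE x in \<nu>. x \<in> {-1..1}" unfolding \<nu>_def by (subst AE_density) (auto simp: indicator_def)
  qed
  have c: "continuous_on UNIV (\<lambda>s. f (-1 + s * (1 + x)))" for x
    by (rule continuous_on_compose2[OF f]) (auto intro!: continuous_intros)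
  have "half_mean lam f x = (\<integral>s. f (-1 + s * (1 + x)) \<partial>\<nu>)" for x
    unfolding \<nu>_def half_mean_def using borel_measurable_continuous_onI[OF c[of x]]
    by (subst integral_real_density) auto
  moreover have "continuous_on UNIV (\<lambda>x. \<integral>s. f (-1 + s * (1 + x)) \<partial>\<nu>)"
    by (rule continuous_on_integral) (rule continuous_on_compose2[OF f], auto intro!: continuous_intros)
  ultimately show ?thesis by simp
qed

definition half_beta :: "real \<Rightarrow> nat \<Rightarrow> real" where
  "half_beta lam j = Beta (real j + lam + 1/2) (1/2)"

lemma half_mean_power:
  assumes lam: "lam \<ge> 0"
  shows "half_mean lam (\<lambda>u. (1 + u) ^ j) x = half_beta lam j * (1 + x) ^ j"
proof -
  have "(LBINT s. indicator {0..1} s * half_weight lam s * s ^ j) = half_beta lam j"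
  proof -
    have "(LBINT s. indicator {0..1} s * half_weight lam s * s ^ j) =
        (LBINT s:{0..1}. s powr ((real j + lam + 1/2) - 1) * (1 - s) powr (1/2 - 1))"
      unfolding set_lebesgue_integral_def
    proof (rule integral_cong_AE)
      have "AE s in lborel. s \<noteq> (0::real)" by (rule AE_lborel_singleton)
      then show "AE s in lborel. indicator {0..1} s * half_weight lam s * s ^ j =
          indicator {0..1} s *\<^sub>R (s powr ((real j + lam + 1/2) - 1) * (1 - s) powr (1/2 - 1))"
      proof (rule eventually_mono)
        fix s :: real assume "s \<noteq> 0"
        show "indicator {0..1} s * half_weight lam s * s ^ j =
          indicator {0..1} s *\<^sub>R (s powr ((real j + lam + 1/2) - 1) * (1 - s) powr (1/2 - 1))"
        proof (cases "s \<in> {0..1}")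
          case True
          then have "s > 0" using \<open>s \<noteq> 0\<close> by auto
          have "s powr ((real j + lam + 1/2) - 1) = s powr (lam - 1/2 + real j)"
            by (rule arg_cong2[where f = "(powr)"]) auto
          also have "\<dots> = s powr (lam - 1/2) * s ^ j"
            using \<open>s > 0\<close> by (simp add: powr_add powr_realpow)
          finally show ?thesis using True by (simp add: half_weight_def)
        qed simp
      qed
    qed measurable
    also have "\<dots> = integral {0..1} (\<lambda>s. s powr ((real j + lam + 1/2) - 1) * (1 - s) powr (1/2 - 1))"
      by (rule set_borel_integral_eq_integral(2)[OF integrable_Beta]) (use lam in auto)
    also have "\<dots> = Beta (real j + lam + 1/2) (1/2)"
      by (rule integral_unique[OF has_integral_Beta_real]) (use lam in auto)
    finally show ?thesis by (simp add: half_beta_def)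
  qed
  moreover have "half_mean lam (\<lambda>u. (1 + u) ^ j) x =
      (LBINT s. (1 + x) ^ j * (indicator {0..1} s * half_weight lam s * s ^ j))"
    unfolding half_mean_def by (simp add: power_mult_distrib mult_ac)
  ultimately show ?thesis by (simp add: mult.commute)
qed

definition half_step_factor :: "real \<Rightarrow> real" where
  "half_step_factor lam = 2 * Gamma (1/2) * Gamma (lam + 1) / Gamma (lam + 1/2)"

lemma half_step_factor_pos: "lam \<ge> 0 \<Longrightarrow> half_step_factor lam > 0"
  unfolding half_step_factor_def by (intro divide_pos_pos mult_pos_pos Gamma_real_pos) auto

text \<open>
On powers of \<open>1 + x\<close>, the coefficient of \<open>(1 + x) D J\<close>, where \<open>J\<close> is the half-order mean, is a
combination of two adjacent coefficients of index \<open>lam\<close>. After cancelling the Gamma factors this is the identity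
\<open>n (j + n + 2 lam + 1) + (n + 2 lam + 1) (j - n) = j (2 n + 2 lam + 1)\<close>.
\<close>

lemma half_step_moment:
  assumes lam: "lam \<ge> 0"
  shows "real j * half_beta lam j * (\<integral>x. (1 + x) ^ j * gegenbauer (lam + 1/2) n x \<partial>gegenbauer_measure (lam +
      1/2)) =
    half_step_factor lam * real n / (2 * real n + 2 * lam + 1) * (\<integral>x. (1 + x) ^ j *
        gegenbauer lam n x \<partial>gegenbauer_measure lam) +
    half_step_factor lam * (real n + 2 * lam + 1) / (2 * real n + 2 * lam + 1) * (\<integral>x. (1 + x) ^ j *
        gegenbauer lam (Suc n) x \<partial>gegenbauer_measure lam)"
proof -
  define D where "D = 2 * real n + 2 * lam + 1"
  define p where "p = real j + real n + 2 * lam + 1"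
  define A where "A = Gamma (real j + lam + 1/2)"
  define E where "E = Gamma (real j + lam + 1)"
  define R where "R = Gamma p"
  define g1 where "g1 = Gamma (lam + 1/2)"
  define g2 where "g2 = Gamma (lam + 1)"
  define T where "T = 2 powr (2 * lam)"
  define Q where "Q = (2::real) ^ j * falling j n"
  have D: "D > 0" and p: "p > 0" using lam by (simp_all add: D_def p_def)
  have pos: "E > 0" "R > 0" "g1 > 0" using lam p unfolding E_def R_def g1_def by (auto intro!: Gamma_real_pos)
  have Rp: "Gamma (p + 1) = p * R"
  proof -
    have "p \<notin> \<int>\<^sub>\<le>\<^sub>0" using p by (auto elim!: nonpos_Ints_cases)
    then show ?thesis unfolding R_def by (rule Gamma_plus1)
  qed
  have m1: "(\<integral>x. (1 + x) ^ j * gegenbauer (lam + 1/2) n x \<partial>gegenbauer_measure (lam + 1/2)) =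
      2 * T * g2 * Q * E / (p * R)"
  proof -
    have "2 powr (2 * (lam + 1/2)) = 2 * T" by (simp add: T_def powr_add distrib_left)
    moreover have "lam + 1/2 + 1/2 = lam + 1" "real j + (lam + 1/2) + 1/2 = real j + lam + 1"
      "real j + real n + 2 * (lam + 1/2) + 1 = p + 1" by (simp_all add: p_def)
    ultimately show ?thesis using gegenbauer_moment[of "lam + 1/2" j n] lam
      by (simp only: Rp E_def[symmetric] g2_def[symmetric] Q_def mult.assoc)
  qed
  have m2: "(\<integral>x. (1 + x) ^ j * gegenbauer lam n x \<partial>gegenbauer_measure lam) = T * g1 * Q * A / R"
    unfolding gegenbauer_moment[OF lam] T_def g1_def Q_def A_def R_def p_def by simp
  have m3: "(\<integral>x. (1 + x) ^ j * gegenbauer lam (Suc n) x \<partial>gegenbauer_measure lam) =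
      T * g1 * Q * (real j - real n) * A / (p * R)"
  proof -
    have "real j + real (Suc n) + 2 * lam + 1 = p + 1" by (simp add: p_def)
    moreover have "falling j (Suc n) = falling j n * (real j - real n)" by (simp add: falling_def)
    ultimately show ?thesis unfolding gegenbauer_moment[OF lam] T_def g1_def Q_def A_def
      by (simp only: Rp mult.assoc)
  qed
  have b: "half_beta lam j = A * Gamma (1/2) / E"
    unfolding half_beta_def Beta_def A_def E_def by (simp add: add_ac)
  have k: "half_step_factor lam = 2 * Gamma (1/2) * g2 / g1" by (simp add: half_step_factor_def g1_def g2_def)
  have "real n * p + (real n + 2 * lam + 1) * (real j - real n) = real j * D"
    unfolding p_def D_def by algebra
  then have key: "(real n * p + (real n + 2 * lam + 1) * (real j - real n)) / D = real j" using D by simp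
  have "half_step_factor lam * real n / D * (T * g1 * Q * A / R) + half_step_factor lam * (real n + 2 * lam +
      1) / D * (T * g1 * Q * (real j - real n) * A / (p * R))
     = half_step_factor lam * (T * g1 * Q * A / (p * R)) * ((real n * p + (real n + 2 * lam + 1) * (real j -
         real n)) / D)"
    using p pos D by (simp add: field_simps)
  also have "\<dots> = real j * (A * Gamma (1/2) / E) * (2 * T * g2 * Q * E / (p * R))"
    unfolding key k using p pos by (simp add: field_simps)
  finally show ?thesis unfolding m1 m2 m3 b D_def[symmetric] by simp
qed

section \<open>Gegenbauer coefficients of the half-step operators\<close>

lemma integrable_weight_times_continuous:
  fixes w h :: "real \<Rightarrow> real"
  assumes w: "integrable lborel w" "\<And>x. x \<notin> {-1..1} \<Longrightarrow> w x = 0" and h: "continuous_on UNIV h"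
  shows "integrable lborel (\<lambda>x. w x * h x)"
proof -
  have "compact (h ` {-1..1})"
    by (intro compact_continuous_image continuous_on_subset[OF h]) auto
  then obtain B where B: "\<And>x. x \<in> {-1..1} \<Longrightarrow> \<bar>h x\<bar> \<le> B"
    using compact_imp_bounded bounded_iff by (metis imageI real_norm_def)
  have [measurable]: "h \<in> borel_measurable borel" by (rule borel_measurable_continuous_onI[OF h])
  have [measurable]: "w \<in> borel_measurable borel" using borel_measurable_integrable[OF w(1)] by simp
  show ?thesis
  proof (rule Bochner_Integration.integrable_bound[OF integrable_mult_right[OF w(1), of B]])
    show "AE x in lborel. norm (w x * h x) \<le> norm (B * w x)"
    proof (rule AE_I2)
      fix x
      show "norm (w x * h x) \<le> norm (B * w x)"
      proof (cases "x \<in> {-1..1}")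
        case True
        have "\<bar>w x\<bar> * \<bar>h x\<bar> \<le> \<bar>w x\<bar> * \<bar>B\<bar>" using B[OF True] by (intro mult_left_mono) auto
        then show ?thesis by (simp add: abs_mult mult.commute)
      qed (simp add: w(2))
    qed
  qed measurable
qed

text \<open>
Weierstrass for bounded linear functionals, with powers of \<open>1 + x\<close> in place of powers of \<open>x\<close>.
\<close>

lemma linear_functional_eq_0:
  fixes T :: "(real \<Rightarrow> real) \<Rightarrow> real"
  assumes add: "\<And>f g. continuous_on UNIV f \<Longrightarrow> continuous_on UNIV g \<Longrightarrow> T (\<lambda>x. f x + g x) = T f + T g"
    and scale: "\<And>c f. continuous_on UNIV f \<Longrightarrow> T (\<lambda>x. c * f x) = c * T f"
    and bound: "\<And>f e. continuous_on UNIV f \<Longrightarrow> (\<And>x. x \<in> {-1..1} \<Longrightarrow> \<bar>f x\<bar> \<le> e) \<Longrightarrow> \<bar>T f\<bar> \<le> C * e"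
    and pw: "\<And>j. T (\<lambda>x. (1 + x) ^ j) = 0"
    and f: "continuous_on UNIV f"
  shows "T f = 0"
proof (rule functional_eq_if_eq_on_polynomials[where L = T and R = "\<lambda>_. 0" and C = C and D = 0, OF _ _ _ f])
  fix f g :: "real \<Rightarrow> real" and e
  assume f: "continuous_on UNIV f" and g: "continuous_on UNIV g" and e: "\<And>x. x \<in> {-1..1} \<Longrightarrow> \<bar>f x - g x\<bar> \<le> e"
  have "T (\<lambda>x. f x + (-1) * g x) = T f + (-1) * T g"
    using add[of f "\<lambda>x. (-1) * g x"] scale[of g "-1"] f g by (simp add: continuous_intros)
  moreover have "\<bar>T (\<lambda>x. f x + (-1) * g x)\<bar> \<le> C * e"
    by (rule bound) (use f g e in \<open>auto intro!: continuous_intros\<close>)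
  ultimately show "\<bar>T f - T g\<bar> \<le> C * e" by simp
next
  fix a :: "nat \<Rightarrow> real" and N
  have 0: "T (\<lambda>x. 0) = 0" using scale[of "\<lambda>x. 0" 0] by simp
  have sum: "T (\<lambda>x. \<Sum>i\<in>I. h i x) = (\<Sum>i\<in>I. T (h i))" if "finite I" "\<And>i. continuous_on UNIV (h i)" for I :: "nat set"
      and h
    using that(1) by (induction I rule: finite_induct) (simp_all add: 0 add that(2) continuous_intros)
  have xi: "x ^ i = (\<Sum>j\<le>i. (real (i choose j) * (-1) ^ (i - j)) * (1 + x) ^ j)" for x :: real and i
    using binomial_ring[of "1 + x" "-1" i] by (simp add: mult_ac)
  have xi': "(\<lambda>x. x ^ i) = (\<lambda>x. \<Sum>j\<le>i. (real (i choose j) * (-1) ^ (i - j)) * (1 + x) ^ j)" for i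
    by (rule ext) (rule xi)
  have Txi: "T (\<lambda>x. x ^ i) = 0" for i
  proof -
    have "T (\<lambda>x. x ^ i) = T (\<lambda>x. \<Sum>j\<le>i. (real (i choose j) * (-1) ^ (i - j)) * (1 + x) ^ j)"
      by (rule arg_cong[where f = T]) (rule xi')
    also have "\<dots> = (\<Sum>j\<le>i. T (\<lambda>x. (real (i choose j) * (-1) ^ (i - j)) * (1 + x) ^ j))"
      by (rule sum) (auto intro!: continuous_intros)
    also have "\<dots> = 0"
    proof (rule sum.neutral, rule ballI)
      fix j
      have "T (\<lambda>x. (real (i choose j) * (-1) ^ (i - j)) * (1 + x) ^ j) =
          (real (i choose j) * (-1) ^ (i - j)) * T (\<lambda>x. (1 + x) ^ j)"
        by (rule scale) (intro continuous_intros)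
      then show "T (\<lambda>x. (real (i choose j) * (-1) ^ (i - j)) * (1 + x) ^ j) = 0" by (simp only: pw mult_zero_right)
    qed
    finally show ?thesis .
  qed
  have "T (\<lambda>x. \<Sum>i\<le>N. a i * x ^ i) = (\<Sum>i\<le>N. a i * T (\<lambda>x. x ^ i))"
    by (subst sum) (auto intro!: continuous_intros sum.cong scale)
  then show "T (\<lambda>x. \<Sum>i\<le>N. a i * x ^ i) = 0" by (simp add: Txi)
qed simp

lemma half_mean_add:
  assumes "lam \<ge> 0" "continuous_on UNIV f" "continuous_on UNIV g" "x \<in> {-1..1}"
  shows "half_mean lam (\<lambda>u. f u + g u) x = half_mean lam f x + half_mean lam g x"
proof -
  have "half_mean lam (\<lambda>u. f u + g u) x =
      (LBINT s. indicator {0..1} s * half_weight lam s * f (-1 + s * (1 + x)) + indicator {0..1} s *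
          half_weight lam s * g (-1 + s * (1 + x)))"
    unfolding half_mean_def by (rule Bochner_Integration.integral_cong) (simp_all only: distrib_left)
  then show ?thesis unfolding half_mean_def
    by (subst (asm) Bochner_Integration.integral_add) (intro half_mean_integrand_integrable assms)+
qed

lemma half_mean_scale: "half_mean lam (\<lambda>u. c * f u) x = c * half_mean lam f x"
proof -
  have "half_mean lam (\<lambda>u. c * f u) x = (LBINT s. c * (indicator {0..1} s * half_weight lam s * f (-1 + s * (1 +
      x))))"
    unfolding half_mean_def by (rule Bochner_Integration.integral_cong) auto
  then show ?thesis unfolding half_mean_def by (simp only: integral_mult_right_zero)
qed

lemma half_mean_bound:
  assumes lam: "lam \<ge> 0" and f: "continuous_on UNIV f" and e: "\<And>u. u \<in> {-1..1} \<Longrightarrow> \<bar>f u\<bar> \<le> e" and x: "x \<in> {-1..1}"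
  shows "\<bar>half_mean lam f x\<bar> \<le> half_beta lam 0 * e"
proof -
  have "\<bar>half_mean lam f x\<bar> \<le> (LBINT s. \<bar>indicator {0..1} s * half_weight lam s * f (-1 + s * (1 + x))\<bar>)"
    unfolding half_mean_def by (rule integral_abs_bound)
  also have "\<dots> \<le> (LBINT s. indicator {0..1} s * half_weight lam s * e)"
  proof (rule integral_mono)
    show "integrable lborel (\<lambda>s. \<bar>indicator {0..1} s * half_weight lam s * f (-1 + s * (1 + x))\<bar>)"
      by (intro integrable_abs half_mean_integrand_integrable assms)
    show "integrable lborel (\<lambda>s. indicator {0..1} s * half_weight lam s * e)"
      by (intro integrable_mult_left half_weight_integrable lam)
    fix s :: real
    show "\<bar>indicator {0..1} s * half_weight lam s * f (-1 + s * (1 + x))\<bar> \<le>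
        indicator {0..1} s * half_weight lam s * e"
    proof (cases "s \<in> {0..1}")
      case True
      then have "-1 + s * (1 + x) \<in> {-1..1}" using x mult_mono[of s 1 "1 + x" 2] by auto
      from e[OF this] show ?thesis using True by (simp add: abs_mult mult_left_mono)
    qed simp
  qed
  also have "\<dots> = half_mean lam (\<lambda>u. (1 + u) ^ 0) x * e"
    unfolding half_mean_def by simp
  also have "\<dots> = half_beta lam 0 * e" unfolding half_mean_power[OF lam] by simp
  finally show ?thesis .
qed

text \<open>
Let \<open>\<Psi> x = (1 + x) * (1 - x\<^sup>2) powr lam * gegenbauer (lam + 1/2) n x\<close>. Integration by parts turns the
left-hand side into a functional of the half-order mean of \<open>f\<close>, and thereby of \<open>f\<close>, that is bounded in the uniform
norm. The right-hand side is bounded too, so it is enough to compare both for powers of \<open>1 + x\<close>,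
which is \<open>half_step_moment\<close>.
\<close>

lemma half_step_coefficient:
  assumes lam: "lam \<ge> 0" and f: "continuous_on UNIV f"
    and g: "integrable lborel (\<lambda>x. indicator {-1..1} x * g x)"
    and fg: "\<And>x. x \<in> {-1..1} \<Longrightarrow> half_mean lam f x = half_mean lam f (-1) + (LBINT z. indicator {-1..x} z * g z)"
  shows "(LBINT x. gegenbauer_weight (lam + 1/2) x * ((1 + x) * gegenbauer (lam + 1/2) n x) *
      (indicator {-1..1} x * g x)) =
    half_step_factor lam * real n / (2 * real n + 2 * lam + 1) * (\<integral>x. f x *
        gegenbauer lam n x \<partial>gegenbauer_measure lam) +
    half_step_factor lam * (real n + 2 * lam + 1) / (2 * real n + 2 * lam + 1) * (\<integral>x. f x *
        gegenbauer lam (Suc n) x \<partial>gegenbauer_measure lam)"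
proof -
  define mu where "mu = lam + 1/2"
  have mu: "mu \<ge> 0" using lam by (simp add: mu_def)
  interpret gl: finite_interval_measure "gegenbauer_measure lam"
      by (rule finite_interval_measure_gegenbauer[OF lam])
  \<comment> \<open>the case distinction makes the factor continuous at the endpoints for \<open>lam = 0\<close>, where \<open>0 powr 0 = 0\<close>\<close>
  define Pw where "Pw = (\<lambda>x::real. if lam = 0 then 1 else (1 - x\<^sup>2) powr lam)"
  define dV where "dV = (\<lambda>x. real n * (real n + 2 * mu) / (2 * mu + 1) * gegenbauer (mu + 1) (n - 1) x)"
  define \<Psi> where "\<Psi> = (\<lambda>x. (1 + x) * Pw x * gegenbauer mu n x)"
  define \<psi> where "\<psi> = (\<lambda>x. Pw x * (gegenbauer mu n x + (1 + x) * dV x) + (lam * gegenbauer_weight (lam - 1/2) x) *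
      (- 2 * x * (1 + x) * gegenbauer mu n x))"
  have cPw: "continuous_on {-1..1} Pw"
  proof (cases "lam = 0")
    case False
    then show ?thesis unfolding Pw_def using lam
      by (auto intro!: continuous_intros continuous_on_powr' simp: abs_square_le_1 abs_le_iff)
  qed (simp add: Pw_def)
  have c\<Psi>: "continuous_on {-1..1} \<Psi>"
    unfolding \<Psi>_def by (intro continuous_intros cPw continuous_on_gegenbauer)
  have cg': "continuous_on UNIV dV"
    unfolding dV_def by (intro continuous_intros continuous_on_gegenbauer')
  have iPw: "integrable lborel (\<lambda>x. indicator {-1..1} x * Pw x)"
    using borel_integrable_compact[OF compact_Icc cPw] by simp
  have iw: "integrable lborel (\<lambda>x. lam * gegenbauer_weight (lam - 1/2) x)"
  proof (cases "lam = 0")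
    case False
    then have "integrable lborel (gegenbauer_weight (lam - 1/2))"
      using Beta_integral_symmetric(1)[of lam lam] lam by (simp add: gegenbauer_weight_eq_product[abs_def])
    then show ?thesis by simp
  qed simp
  have i\<psi>h: "integrable lborel (\<lambda>x. indicator {-1..1} x * (\<psi> x * h x))" if h: "continuous_on UNIV h" for h
  proof -
    have "integrable lborel (\<lambda>x. (indicator {-1..1} x * Pw x) * ((gegenbauer mu n x + (1 + x) * dV x) * h x))"
      by (rule integrable_weight_times_continuous[OF iPw]) (auto
          intro!: continuous_intros continuous_on_gegenbauer' cg' h)
    moreover have "integrable lborel (\<lambda>x. (lam * gegenbauer_weight (lam - 1/2) x) * ((- 2 * x * (1 + x) *
        gegenbauer mu n x) * h x))"
      by (rule integrable_weight_times_continuous[OF iw]) (auto simp: gegenbauer_weight_def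
          intro!: continuous_intros continuous_on_gegenbauer' h)
    ultimately have "integrable lborel (\<lambda>x. (indicator {-1..1} x * Pw x) * ((gegenbauer mu n x + (1 + x) * dV x) *
        h x) +
        (lam * gegenbauer_weight (lam - 1/2) x) * ((- 2 * x * (1 + x) * gegenbauer mu n x) * h x))" by simp
    moreover have "(\<lambda>x. (indicator {-1..1} x * Pw x) * ((gegenbauer mu n x + (1 + x) * dV x) * h x) +
        (lam * gegenbauer_weight (lam - 1/2) x) * ((- 2 * x * (1 + x) * gegenbauer mu n x) * h x)) =
            (\<lambda>x. indicator {-1..1} x * (\<psi> x * h x))"
      by (rule ext) (simp add: \<psi>_def gegenbauer_weight_def indicator_def algebra_simps)
    ultimately show ?thesis by simp
  qed
  have i\<psi>: "integrable lborel (\<lambda>x. indicator {-1..1} x * \<psi> x)" using i\<psi>h[of "\<lambda>_. 1"] by simp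
  have d\<Psi>: "(\<Psi> has_real_derivative \<psi> x) (at x)" if x: "x \<in> {-1<..<1}" for x
  proof -
    have pos: "1 - x\<^sup>2 > 0" using x by (simp add: abs_square_less_1 abs_less_iff)
    have dg: "(gegenbauer mu n has_real_derivative dV x) (at x)"
      unfolding dV_def by (rule gegenbauer_has_derivative[OF mu])
    have dP: "(Pw has_real_derivative lam * gegenbauer_weight (lam - 1/2) x * (- 2 * x)) (at x)"
    proof (cases "lam = 0")
      case True
      then have "Pw = (\<lambda>_. 1)" by (simp add: Pw_def)
      then show ?thesis using True by simp
    next
      case False
      have w: "gegenbauer_weight (lam - 1/2) x = (1 - x\<^sup>2) powr (lam - 1)" using x
          by (simp add: gegenbauer_weight_def)
      have "((\<lambda>x. (1 - x\<^sup>2) powr lam) has_real_derivative lam * (1 - x\<^sup>2) powr (lam - 1) * (- 2 * x)) (at x)"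
        using pos by (auto intro!: derivative_eq_intros simp: field_simps)
      then show ?thesis using False unfolding w by (simp add: Pw_def)
    qed
    have "((\<lambda>x. (1 + x) * Pw x) has_real_derivative Pw x + lam * gegenbauer_weight (lam - 1/2) x * (- 2 * x) * (1 +
        x)) (at x)"
      by (rule DERIV_cong[OF DERIV_mult[OF DERIV_add[OF DERIV_const DERIV_ident] dP]]) simp
    from DERIV_mult[OF this dg] show ?thesis
      unfolding \<Psi>_def by (rule DERIV_cong) (simp add: \<psi>_def algebra_simps)
  qed
  have \<Psi>int: "\<Psi> x = \<Psi> 1 - (LBINT z. indicator {x..1} z * \<psi> z)" if x: "x \<in> {-1..1}" for x
  proof -
    have "(\<psi> has_integral (\<Psi> 1 - \<Psi> x)) {x..1}"
      using x by (intro fundamental_theorem_of_calculus_interior continuous_on_subset[OF c\<Psi>])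
        (auto simp: has_real_derivative_iff_has_vector_derivative[symmetric] intro!: d\<Psi>)
    moreover have "set_integrable lborel {x..1} \<psi>"
    proof -
      have "integrable lborel (\<lambda>z. indicator {x..1} z *\<^sub>R (indicator {-1..1} z * \<psi> z))"
        by (intro integrable_mult_indicator i\<psi>) auto
      moreover have "(\<lambda>z. indicator {x..1} z *\<^sub>R (indicator {-1..1} z * \<psi> z)) = (\<lambda>z. indicator {x..1} z *\<^sub>R \<psi> z)"
        using x by (auto simp: indicator_def fun_eq_iff)
      ultimately show ?thesis by (simp add: set_integrable_def)
    qed
    ultimately have "(LBINT z:{x..1}. \<psi> z) = \<Psi> 1 - \<Psi> x"
      using set_borel_integral_eq_integral(2) by (metis integral_unique)
    then show ?thesis by (simp add: set_lebesgue_integral_def)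
  qed
  have \<Psi>0: "\<Psi> (-1) = 0" by (simp add: \<Psi>_def)
  define I where "I = (\<lambda>g. LBINT x. gegenbauer_weight mu x * ((1 + x) * gegenbauer mu n x) * (indicator {-1..1} x *
      g x))"
  define L where "L = (\<lambda>f. \<Psi> 1 * half_mean lam f 1 - (LBINT x. indicator {-1..1} x * (\<psi> x * half_mean lam f x)))"
  have parts: "I g = L f"
    if f: "continuous_on UNIV f" and g: "integrable lborel (\<lambda>x. indicator {-1..1} x * g x)"
      and fg: "\<And>x. x \<in> {-1..1} \<Longrightarrow> half_mean lam f x =
          half_mean lam f (-1) + (LBINT z. indicator {-1..x} z * g z)" for f g
  proof -
    have "I g = (LBINT x. indicator {-1..1} x * (\<Psi> x * g x))"
    proof -
      have [measurable]: "(\<lambda>x. indicator {-1..1} x * g x) \<in> borel_measurable borel"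
        using borel_measurable_integrable[OF g] by simp
      have [measurable]: "gegenbauer mu n \<in> borel_measurable borel"
        by (rule borel_measurable_continuous_onI[OF continuous_on_gegenbauer'])
      have [measurable]: "Pw \<in> borel_measurable borel" unfolding Pw_def by measurable
      have "I g = (LBINT x. \<Psi> x * (indicator {-1..1} x * g x))"
        unfolding I_def
      proof (rule integral_cong_AE)
        have "AE x in lborel. x \<noteq> (1::real) \<and> x \<noteq> -1"
          by (intro AE_conjI AE_lborel_singleton)
        then show "AE x in lborel. gegenbauer_weight mu x * ((1 + x) * gegenbauer mu n x) * (indicator {-1..1} x *
            g x) = \<Psi> x * (indicator {-1..1} x * g x)"
        proof (rule eventually_mono)
          fix x :: real assume "x \<noteq> 1 \<and> x \<noteq> -1"
          then show "gegenbauer_weight mu x * ((1 + x) * gegenbauer mu n x) * (indicator {-1..1} x * g x) =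
              \<Psi> x * (indicator {-1..1} x * g x)"
            by (auto simp: gegenbauer_weight_def \<Psi>_def Pw_def mu_def indicator_def power2_eq_1_iff)
        qed
        show "(\<lambda>x. gegenbauer_weight mu x * ((1 + x) * gegenbauer mu n x) * (indicator {-1..1} x *
            g x)) \<in> borel_measurable lborel"
          by measurable
        show "(\<lambda>x. \<Psi> x * (indicator {-1..1} x * g x)) \<in> borel_measurable lborel"
          unfolding \<Psi>_def by measurable
      qed
      then show ?thesis by (simp add: mult_ac)
    qed
    also have "\<dots> = L f"
      unfolding L_def
      by (rule integral_by_parts_density[OF g i\<psi> fg \<Psi>int \<Psi>0 i\<psi>h[OF half_mean_continuous[OF lam f]]])
    finally show ?thesis .
  qed
  define k1 k2 where "k1 = half_step_factor lam * real n / (2 * real n + 2 * lam + 1)"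
    and "k2 = half_step_factor lam * (real n + 2 * lam + 1) / (2 * real n + 2 * lam + 1)"
  define b where "b = (\<lambda>k f. \<integral>x. f x * gegenbauer lam k x \<partial>gegenbauer_measure lam)"
  define T where "T = (\<lambda>f. L f - (k1 * b n f + k2 * b (Suc n) f))"
  have one_in: "(1::real) \<in> {-1..1}" by simp
  have "T f = 0"
  proof (rule linear_functional_eq_0[OF _ _ _ _ f])
    fix f h :: "real \<Rightarrow> real" assume f: "continuous_on UNIV f" and h: "continuous_on UNIV h"
    have "(LBINT x. indicator {-1..1} x * (\<psi> x * half_mean lam (\<lambda>u. f u + h u) x)) =
        (LBINT x. indicator {-1..1} x * (\<psi> x * half_mean lam f x) + indicator {-1..1} x * (\<psi> x *
            half_mean lam h x))"
      by (intro Bochner_Integration.integral_cong refl)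
        (auto simp: indicator_def half_mean_add[OF lam f h] algebra_simps)
    also have "\<dots> = (LBINT x. indicator {-1..1} x * (\<psi> x * half_mean lam f x)) + (LBINT x. indicator {-1..1} x *
        (\<psi> x * half_mean lam h x))"
      by (intro Bochner_Integration.integral_add i\<psi>h half_mean_continuous lam f h)
    finally have "L (\<lambda>x. f x + h x) = L f + L h"
      unfolding L_def by (simp only: half_mean_add[OF lam f h one_in] distrib_left)
    moreover have "b k (\<lambda>x. f x + h x) = b k f + b k h" for k
      unfolding b_def distrib_right
      by (intro Bochner_Integration.integral_add gl.integrable_continuous continuous_intros f h
          continuous_on_gegenbauer')
    ultimately have "T (\<lambda>x. f x + h x) = L f + L h - (k1 * (b n f + b n h) + k2 * (b (Suc n) f + b (Suc n) h))"
      unfolding T_def by (simp only:)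
    also have "\<dots> = (L f - (k1 * b n f + k2 * b (Suc n) f)) + (L h - (k1 * b n h + k2 * b (Suc n) h))" by algebra
    finally show "T (\<lambda>x. f x + h x) = T f + T h" unfolding T_def .
  next
    fix c and f :: "real \<Rightarrow> real" assume f: "continuous_on UNIV f"
    have "(LBINT x. indicator {-1..1} x * (\<psi> x * (c * half_mean lam f x))) =
        (LBINT x. c * (indicator {-1..1} x * (\<psi> x * half_mean lam f x)))"
      by (rule Bochner_Integration.integral_cong) auto
    then have "L (\<lambda>x. c * f x) = c * L f"
      unfolding L_def half_mean_scale by (simp only: integral_mult_right_zero right_diff_distrib
          mult.left_commute[of "\<Psi> 1" c])
    moreover have "b k (\<lambda>x. c * f x) = c * b k f" for k
      unfolding b_def by (simp add: mult.assoc)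
    ultimately have "T (\<lambda>x. c * f x) = c * L f - (k1 * (c * b n f) + k2 * (c * b (Suc n) f))"
      unfolding T_def by (simp only:)
    also have "\<dots> = c * (L f - (k1 * b n f + k2 * b (Suc n) f))" by algebra
    finally show "T (\<lambda>x. c * f x) = c * T f" unfolding T_def .
  next
    fix f :: "real \<Rightarrow> real" and e assume f: "continuous_on UNIV f" and e: "\<And>x. x \<in> {-1..1} \<Longrightarrow> \<bar>f x\<bar> \<le> e"
    have e0: "e \<ge> 0" using e[of 0] by simp
    note hb = half_mean_bound[OF lam f e]
    define J where "J = (LBINT x. \<bar>indicator {-1..1} x * \<psi> x\<bar>)"
    have "\<bar>LBINT x. indicator {-1..1} x * (\<psi> x * half_mean lam f x)\<bar> \<le>
        (LBINT x. \<bar>indicator {-1..1} x * (\<psi> x * half_mean lam f x)\<bar>)"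
      by (rule integral_abs_bound)
    also have "\<dots> \<le> (LBINT x. \<bar>indicator {-1..1} x * \<psi> x\<bar> * (half_beta lam 0 * e))"
    proof (rule integral_mono)
      show "integrable lborel (\<lambda>x. \<bar>indicator {-1..1} x * (\<psi> x * half_mean lam f x)\<bar>)"
        by (intro integrable_abs i\<psi>h half_mean_continuous lam f)
      show "integrable lborel (\<lambda>x. \<bar>indicator {-1..1} x * \<psi> x\<bar> * (half_beta lam 0 * e))"
        by (intro integrable_mult_left integrable_abs i\<psi>)
      fix x :: real
      show "\<bar>indicator {-1..1} x * (\<psi> x * half_mean lam f x)\<bar> \<le>
          \<bar>indicator {-1..1} x * \<psi> x\<bar> * (half_beta lam 0 * e)"
        using hb[of x] by (cases "x \<in> {-1..1}") (auto simp: abs_mult intro!: mult_left_mono)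
    qed
    also have "\<dots> = J * (half_beta lam 0 * e)" by (simp add: J_def)
    finally have 1: "\<bar>LBINT x. indicator {-1..1} x * (\<psi> x * half_mean lam f x)\<bar> \<le> J * (half_beta lam 0 * e)" .
    have 2: "\<bar>\<Psi> 1 * half_mean lam f 1\<bar> \<le> \<bar>\<Psi> 1\<bar> * (half_beta lam 0 * e)"
      unfolding abs_mult using hb[of 1] by (intro mult_left_mono) auto
    have 3: "\<bar>k * b m f\<bar> \<le> \<bar>k\<bar> * (measure (gegenbauer_measure lam) UNIV * e)" for k m
      unfolding abs_mult
    proof (intro mult_left_mono)
      show "\<bar>b m f\<bar> \<le> measure (gegenbauer_measure lam) UNIV * e"
        unfolding b_def
      proof (rule gl.abs_integral_le)
        fix x :: real assume x: "x \<in> {-1..1}"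
        have "\<bar>f x\<bar> * \<bar>gegenbauer lam m x\<bar> \<le> e * 1"
          using e[OF x] x e0 by (intro mult_mono abs_gegenbauer_le_1[OF lam]) auto
        then show "\<bar>f x * gegenbauer lam m x\<bar> \<le> e" by (simp add: abs_mult)
      qed (intro continuous_intros f continuous_on_gegenbauer')
    qed simp
    have "\<bar>T f\<bar> \<le> \<bar>\<Psi> 1\<bar> * (half_beta lam 0 * e) + J * (half_beta lam 0 * e) +
        (\<bar>k1\<bar> * (measure (gegenbauer_measure lam) UNIV * e) + \<bar>k2\<bar> * (measure (gegenbauer_measure lam) UNIV * e))"
      unfolding T_def L_def using 1 2 3[of k1 n] 3[of k2 "Suc n"] by linarith
    then show "\<bar>T f\<bar> \<le> ((\<bar>\<Psi> 1\<bar> + J) * half_beta lam 0 + (\<bar>k1\<bar> + \<bar>k2\<bar>) * measure (gegenbauer_measure lam) UNIV) * e"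
      by (simp add: algebra_simps)
  next
    fix j
    \<comment> \<open>the density that belongs to \<open>(1 + x) ^ j\<close>, by \<open>half_mean_power\<close>\<close>
    define gj where "gj = (\<lambda>x::real. real j * half_beta lam j * (1 + x) ^ (j - 1))"
    have cgj: "continuous_on UNIV gj" unfolding gj_def by (intro continuous_intros)
    have igj: "integrable lborel (\<lambda>x. indicator {-1..1} x * gj x)"
      using borel_integrable_compact[OF compact_Icc continuous_on_subset[OF cgj]] by simp
    have "half_mean lam (\<lambda>u. (1 + u) ^ j) x = half_mean lam (\<lambda>u. (1 + u) ^ j) (-1) +
        (LBINT z. indicator {-1..x} z * gj z)"
      if x: "x \<in> {-1..1}" for x
    proof -
      have "(LBINT z. gj z * indicator {-1..x} z) =
          half_beta lam j * (1 + x) ^ j - half_beta lam j * (1 + (-1)) ^ j"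
      proof (rule integral_FTC_Icc_real)
        fix z :: real
        show "((\<lambda>z. half_beta lam j * (1 + z) ^ j) has_real_derivative gj z) (at z)"
          unfolding gj_def by (auto intro!: derivative_eq_intros)
        show "isCont gj z" using cgj by (simp add: continuous_on_eq_continuous_at)
      qed (use x in auto)
      then show ?thesis by (simp add: half_mean_power[OF lam] mult.commute)
    qed
    from parts[OF _ igj this] have "L (\<lambda>x. (1 + x) ^ j) = I gj"
      by (simp only: continuous_intros)
    also have "I gj = (LBINT x. (real j * half_beta lam j) * (gegenbauer_weight mu x * ((1 + x) ^ j *
        gegenbauer mu n x)))"
    proof (cases j)
      case (Suc i)
      have "gegenbauer_weight mu x * ((1 + x) * gegenbauer mu n x) * (indicator {-1..1} x * gj x) =
          (real j * half_beta lam j) * (gegenbauer_weight mu x * ((1 + x) ^ j * gegenbauer mu n x))" for x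
      proof (cases "x \<in> {-1..1}")
        case True
        then show ?thesis by (simp add: gj_def Suc)
      qed (simp add: gegenbauer_weight_def)
      then show ?thesis unfolding I_def by (simp only:)
    qed (simp add: I_def gj_def)
    also have "\<dots> = real j * half_beta lam j * (\<integral>x. (1 + x) ^ j * gegenbauer mu n x \<partial>gegenbauer_measure mu)"
    proof -
      have "continuous_on UNIV (\<lambda>x. (1 + x) ^ j * gegenbauer mu n x)"
          by (intro continuous_intros continuous_on_gegenbauer')
      from integral_gegenbauer_measure[OF borel_measurable_continuous_onI[OF this], of mu] show ?thesis
        by (simp only: integral_mult_right_zero)
    qed
    also have "\<dots> = k1 * b n (\<lambda>x. (1 + x) ^ j) + k2 * b (Suc n) (\<lambda>x. (1 + x) ^ j)"
      using half_step_moment[OF lam, of j n] by (simp only: mu_def k1_def k2_def b_def)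
    finally show "T (\<lambda>x. (1 + x) ^ j) = 0" by (simp add: T_def)
  qed
  then show ?thesis using parts[OF f g fg] by (simp add: T_def I_def k1_def k2_def b_def mu_def)
qed

section \<open>Positive definiteness of the half-step derivatives\<close>

lemma absolutely_continuous_reflect:
  assumes "absolutely_continuous_on_interval (-1) 1 f"
  shows "absolutely_continuous_on_interval (-1) 1 (\<lambda>x. f (- x))"
  unfolding absolutely_continuous_on_interval_def
proof (intro allI impI)
  fix \<epsilon> :: real assume "\<epsilon> > 0"
  then obtain \<delta> where \<delta>: "\<delta> > 0" and ac: "\<And>(n::nat) a b. (\<forall>i<n. -1 \<le> a i \<and> a i \<le> b i \<and> b i \<le> 1) \<Longrightarrow>
        disjoint_family_on (\<lambda>i. {a i<..<b i}) {..<n} \<Longrightarrow>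
        (\<Sum>i<n. b i - a i) < \<delta> \<Longrightarrow> (\<Sum>i<n. \<bar>f (b i) - f (a i)\<bar>) < \<epsilon>"
    using assms unfolding absolutely_continuous_on_interval_def by meson
  have "(\<Sum>i<n. \<bar>f (- b i) - f (- a i)\<bar>) < \<epsilon>"
    if 1: "\<forall>i<n. -1 \<le> a i \<and> a i \<le> b i \<and> b i \<le> 1" and 2: "disjoint_family_on (\<lambda>i. {a i<..<b i}) {..<n}"
      and 3: "(\<Sum>i<n. b i - a i) < \<delta>" for n :: nat and a b :: "nat \<Rightarrow> real"
  proof -
    have "(\<Sum>i<n. \<bar>f (- a i) - f (- b i)\<bar>) < \<epsilon>"
    proof (rule ac)
      have "{- b i<..<- a i} = uminus ` {a i<..<b i}" for i by simp
      then show "disjoint_family_on (\<lambda>i. {- b i<..<- a i}) {..<n}"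
        using 2 unfolding disjoint_family_on_def by (metis image_Int inj_uminus image_empty)
      show "\<forall>i<n. -1 \<le> - b i \<and> - b i \<le> - a i \<and> - a i \<le> 1" using 1 by auto
      show "(\<Sum>i<n. - a i - - b i) < \<delta>" using 3 by simp
    qed
    then show ?thesis by (simp add: abs_minus_commute)
  qed
  then show "\<exists>\<delta>>0. \<forall>(n::nat) a b. (\<forall>i<n. -1 \<le> a i \<and> a i \<le> b i \<and> b i \<le> 1) \<longrightarrow>
        disjoint_family_on (\<lambda>i. {a i<..<b i}) {..<n} \<longrightarrow>
        (\<Sum>i<n. b i - a i) < \<delta> \<longrightarrow> (\<Sum>i<n. \<bar>f (- b i) - f (- a i)\<bar>) < \<epsilon>"
    using \<delta> by blast
qed

lemma AE_lborel_reflect: "AE x in lborel. P x \<Longrightarrow> AE x in lborel. P (- x :: real)"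
proof -
  assume "AE x in lborel. P x"
  then have "AE x in distr lborel borel uminus. P x" unfolding lborel_distr_uminus .
  then show ?thesis by (rule AE_distrD[rotated]) simp
qed

lemma gegenbauer_weight_minus [simp]: "gegenbauer_weight l (- x) = gegenbauer_weight l x"
  by (auto simp: gegenbauer_weight_def indicator_def)

lemma gegenbauer_coefficient_reflect:
  assumes "continuous_on UNIV f"
  shows "(\<integral>x. f (- x) * gegenbauer l k x \<partial>gegenbauer_measure l) =
      (-1) ^ k * (\<integral>x. f x * gegenbauer l k x \<partial>gegenbauer_measure l)"
proof -
  have c: "continuous_on UNIV (\<lambda>x. f x * gegenbauer l k x)"
    by (intro continuous_intros assms continuous_on_gegenbauer')
  have c': "continuous_on UNIV (\<lambda>x. f (- x) * gegenbauer l k x)"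
    by (intro continuous_intros continuous_on_compose2[OF assms] continuous_on_gegenbauer') auto
  have "(\<integral>x. f (- x) * gegenbauer l k x \<partial>gegenbauer_measure l) =
      (LBINT x. gegenbauer_weight l x * (f (- x) * gegenbauer l k x))"
    by (rule integral_gegenbauer_measure[OF borel_measurable_continuous_onI[OF c']])
  also have "\<dots> = (LBINT x. gegenbauer_weight l (- x) * (f (- (- x)) * gegenbauer l k (- x)))"
    using lborel_integral_real_affine[of "-1" "\<lambda>x. gegenbauer_weight l x * (f (- x) * gegenbauer l k x)" 0] by simp
  also have "\<dots> = (LBINT x. (-1) ^ k * (gegenbauer_weight l x * (f x * gegenbauer l k x)))"
    by (rule Bochner_Integration.integral_cong) (simp_all add: gegenbauer_minus mult_ac)
  also have "\<dots> = (-1) ^ k * (\<integral>x. f x * gegenbauer l k x \<partial>gegenbauer_measure l)"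
    using integral_gegenbauer_measure[OF borel_measurable_continuous_onI[OF c], of l]
        by (simp only: integral_mult_right_zero)
  finally show ?thesis .
qed

text \<open>
The results on coefficients speak of functions that are continuous on the whole line; composition with
this function extends a continuous function on the interval to such a one.
\<close>

definition clamp1 :: "real \<Rightarrow> real" where
  "clamp1 x = max (-1) (min 1 x)"

lemma clamp1_in [simp]: "clamp1 x \<in> {-1..1}"
  by (auto simp: clamp1_def)

lemma clamp1_id [simp]: "x \<in> {-1..1} \<Longrightarrow> clamp1 x = x"
  by (auto simp: clamp1_def)

lemma continuous_on_clamp1: "continuous_on UNIV clamp1"
  unfolding clamp1_def by (intro continuous_intros)

lemma continuous_on_slice:
  assumes "continuous_on ({-1..1} \<times> UNIV) (\<lambda>(x, t). h x t)"
  shows "continuous_on UNIV (\<lambda>x. h (clamp1 x) t)"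
proof -
  have "continuous_on UNIV (\<lambda>x. (\<lambda>(x, t). h x t) (clamp1 x, t))"
    by (rule continuous_on_compose2[OF assms]) (auto
        intro!: continuous_intros continuous_on_clamp1 simp del: atLeastAtMost_iff)
  then show ?thesis by simp
qed

text \<open>
The operator with minus sign is the one with plus sign conjugated by the reflection \<open>x \<mapsto> - x\<close>, up to
a sign.
\<close>

lemma half_step_AE:
  assumes lam: "lam \<ge> 0" and f: "absolutely_continuous_on_interval (-1) 1 (\<lambda>x. f x t)"
  obtains g1 g2 where
    "integrable lborel (\<lambda>x. indicator {-1..1} x * g1 x)"
    "\<And>x. x \<in> {-1..1} \<Longrightarrow> half_mean lam (\<lambda>u. f u t) x =
        half_mean lam (\<lambda>u. f u t) (-1) + (LBINT z. indicator {-1..x} z * g1 z)"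
    "integrable lborel (\<lambda>x. indicator {-1..1} x * g2 x)"
    "\<And>x. x \<in> {-1..1} \<Longrightarrow> half_mean lam (\<lambda>u. f (- u) t) x =
        half_mean lam (\<lambda>u. f (- u) t) (-1) + (LBINT z. indicator {-1..x} z * g2 z)"
    "AE x in lborel. x \<in> {-1<..<1} \<longrightarrow> half_step \<sigma> lam f x t = (1 + x) * g1 x - \<sigma> * ((1 - x) * g2 (- x))"
proof -
  obtain g1 where g1: "integrable lborel (\<lambda>x. indicator {-1..1} x * g1 x)"
    "\<And>x. x \<in> {-1..1} \<Longrightarrow> half_mean lam (\<lambda>u. f u t) x =
        half_mean lam (\<lambda>u. f u t) (-1) + (LBINT z. indicator {-1..x} z * g1 z)"
    "AE x in lborel. x \<in> {-1<..<1} \<longrightarrow> (half_mean lam (\<lambda>u. f u t) has_real_derivative g1 x) (at x)"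
    using half_mean_absolutely_continuous[OF lam f] by blast
  obtain g2 where g2: "integrable lborel (\<lambda>x. indicator {-1..1} x * g2 x)"
    "\<And>x. x \<in> {-1..1} \<Longrightarrow> half_mean lam (\<lambda>u. f (- u) t) x =
        half_mean lam (\<lambda>u. f (- u) t) (-1) + (LBINT z. indicator {-1..x} z * g2 z)"
    "AE x in lborel. x \<in> {-1<..<1} \<longrightarrow> (half_mean lam (\<lambda>u. f (- u) t) has_real_derivative g2 x) (at x)"
    using half_mean_absolutely_continuous[OF lam absolutely_continuous_reflect[OF f]] by blast
  have "AE x in lborel. x \<in> {-1<..<1} \<longrightarrow> half_step \<sigma> lam f x t = (1 + x) * g1 x - \<sigma> * ((1 - x) * g2 (- x))"
    using g1(3) AE_lborel_reflect[OF g2(3)]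
  proof eventually_elim
    case (elim x)
    show ?case
    proof
      assume x: "x \<in> {-1<..<1}"
      have ev: "\<forall>\<^sub>F y in nhds x. y \<in> {-1<..<1}" by (rule eventually_nhds_in_open) (use x in auto)
      have "\<forall>\<^sub>F y in nhds x. half_int_plus lam f y t = half_mean lam (\<lambda>u. f u t) y"
        using ev by (rule eventually_mono) (intro half_int_plus_eq_half_mean, auto)
      then have p: "((\<lambda>y. half_int_plus lam f y t) has_real_derivative g1 x) (at x)"
        using elim x by (subst DERIV_cong_ev[OF refl _ refl]) auto
      have "(half_mean lam (\<lambda>u. f (- u) t) has_real_derivative g2 (- x)) (at (- x))" using elim x by auto
      then have "((\<lambda>y. half_mean lam (\<lambda>u. f (- u) t) (- y)) has_real_derivative g2 (- x) * (-1)) (at x)"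
        by (rule DERIV_chain2) (auto intro!: derivative_eq_intros)
      moreover have "\<forall>\<^sub>F y in nhds x. half_int_minus lam f y t = half_mean lam (\<lambda>u. f (- u) t) (- y)"
        using ev by (rule eventually_mono) (intro half_int_minus_eq_half_mean, auto)
      ultimately have m: "((\<lambda>y. half_int_minus lam f y t) has_real_derivative - g2 (- x)) (at x)"
        by (subst DERIV_cong_ev[OF refl _ refl]) auto
      have "x \<in> half_step_dom lam f t"
        using x p m by (auto simp: half_step_dom_def field_differentiable_def)
      then show "half_step \<sigma> lam f x t = (1 + x) * g1 x - \<sigma> * ((1 - x) * g2 (- x))"
        by (simp add: half_step_def half_step_plus_def half_step_minus_def DERIV_imp_deriv[OF p] DERIV_imp_deriv[OF
            m])
    qed
  qed
  then show ?thesis using that[OF g1(1,2) g2(1,2)] by blast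
qed

text \<open>
Reflection multiplies coefficients of degree \<open>k\<close> by \<open>(-1) ^ k\<close>. Therefore the two half-step operators
contribute the same amount to the coefficient of degree \<open>n + 1\<close> and opposite amounts to that of degree
\<open>n\<close>, and one of the two cancels when \<open>\<sigma>\<close> is \<open>1\<close> or \<open>-1\<close>.
\<close>

theorem half_step_gegenbauer_coefficient:
  assumes lam: "lam \<ge> 0" and cf: "continuous_on UNIV (\<lambda>x. f (clamp1 x) t)"
    and f: "absolutely_continuous_on_interval (-1) 1 (\<lambda>x. f x t)"
    and cH: "continuous_on UNIV (\<lambda>x. half_step \<sigma> lam f (clamp1 x) t)"
  shows "(\<integral>x. half_step \<sigma> lam f (clamp1 x) t * gegenbauer (lam + 1/2) n x \<partial>gegenbauer_measure (lam + 1/2)) =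
    half_step_factor lam * real n / (2 * real n + 2 * lam + 1) * (1 - \<sigma>) * (\<integral>x. f (clamp1 x) t *
        gegenbauer lam n x \<partial>gegenbauer_measure lam) +
    half_step_factor lam * (real n + 2 * lam + 1) / (2 * real n + 2 * lam + 1) * (1 + \<sigma>) * (\<integral>x. f (clamp1 x) t *
        gegenbauer lam (Suc n) x \<partial>gegenbauer_measure lam)"
proof -
  define mu where "mu = lam + 1/2"
  define fp where "fp = (\<lambda>x. f (clamp1 x) t)"
  have cfp: "continuous_on UNIV fp" unfolding fp_def by (rule cf)
  have cfm: "continuous_on UNIV (\<lambda>x. fp (- x))"
    by (rule continuous_on_compose2[OF cfp]) (auto intro!: continuous_intros)
  obtain g1 g2 where g1: "integrable lborel (\<lambda>x. indicator {-1..1} x * g1 x)"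
    "\<And>x. x \<in> {-1..1} \<Longrightarrow> half_mean lam (\<lambda>u. f u t) x =
        half_mean lam (\<lambda>u. f u t) (-1) + (LBINT z. indicator {-1..x} z * g1 z)"
    and g2: "integrable lborel (\<lambda>x. indicator {-1..1} x * g2 x)"
    "\<And>x. x \<in> {-1..1} \<Longrightarrow> half_mean lam (\<lambda>u. f (- u) t) x =
        half_mean lam (\<lambda>u. f (- u) t) (-1) + (LBINT z. indicator {-1..x} z * g2 z)"
    and AE: "AE x in lborel. x \<in> {-1<..<1} \<longrightarrow> half_step \<sigma> lam f x t = (1 + x) * g1 x - \<sigma> * ((1 - x) * g2 (- x))"
    using half_step_AE[where f = f and t = t and lam = lam and \<sigma> = \<sigma>, OF lam f] by blast
  have hp: "half_mean lam fp x = half_mean lam (\<lambda>u. f u t) x" 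
    and hm: "half_mean lam (\<lambda>u. fp (- u)) x = half_mean lam (\<lambda>u. f (- u) t) x" if "x \<in> {-1..1}" for x
    by (rule half_mean_cong[OF _ that]; simp add: fp_def)+
  have g1': "half_mean lam fp x = half_mean lam fp (-1) + (LBINT z. indicator {-1..x} z *
      g1 z)" if "x \<in> {-1..1}" for x
    using g1(2)[OF that] hp[OF that] hp[of "-1"] by simp
  have g2': "half_mean lam (\<lambda>u. fp (- u)) x = half_mean lam (\<lambda>u. fp (- u)) (-1) + (LBINT z. indicator {-1..x} z *
      g2 z)" if "x \<in> {-1..1}" for x
    using g2(2)[OF that] hm[OF that] hm[of "-1"] by simp
  define k1 k2 where "k1 = half_step_factor lam * real n / (2 * real n + 2 * lam + 1)"
    and "k2 = half_step_factor lam * (real n + 2 * lam + 1) / (2 * real n + 2 * lam + 1)"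
  define b where "b = (\<lambda>k f. \<integral>x. f x * gegenbauer lam k x \<partial>gegenbauer_measure lam)"
  define K where "K = (\<lambda>x. gegenbauer_weight mu x * ((1 + x) * gegenbauer mu n x))"
  define g1i g2i where "g1i = (\<lambda>x. indicator {-1..1} x * g1 x)" and "g2i = (\<lambda>x. indicator {-1..1} x * g2 x)"
  have I1: "(LBINT x. K x * g1i x) = k1 * b n fp + k2 * b (Suc n) fp"
    unfolding K_def g1i_def mu_def k1_def k2_def b_def by (rule half_step_coefficient[OF lam cfp g1(1) g1'])
  have I2: "(LBINT x. K x * g2i x) = k1 * b n (\<lambda>x. fp (- x)) + k2 * b (Suc n) (\<lambda>x. fp (- x))"
    unfolding K_def g2i_def mu_def k1_def k2_def b_def by (rule half_step_coefficient[OF lam cfm g2(1) g2'])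
  have b_refl: "b k (\<lambda>x. fp (- x)) = (-1) ^ k * b k fp" for k
    unfolding b_def by (rule gegenbauer_coefficient_reflect[OF cfp])
  have Kb: "\<bar>K x\<bar> \<le> 2" for x
  proof (cases "x \<in> {-1..1}")
    case True
    have x: "\<bar>x\<bar> \<le> 1" using True by auto
    have "0 \<le> 1 - x\<^sup>2" "1 - x\<^sup>2 \<le> 1" using x by (simp_all add: abs_square_le_1)
    then have "\<bar>gegenbauer_weight mu x\<bar> \<le> 1" using True lam by (simp add: gegenbauer_weight_def mu_def powr_le1)
    moreover have "\<bar>1 + x\<bar> \<le> 2" using True by auto
    moreover have "\<bar>gegenbauer mu n x\<bar> \<le> 1" by (rule abs_gegenbauer_le_1[OF _ x]) (use lam in \<open>simp add: mu_def\<close>)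
    ultimately have "\<bar>gegenbauer_weight mu x\<bar> * (\<bar>1 + x\<bar> * \<bar>gegenbauer mu n x\<bar>) \<le> 1 * (2 * 1)"
      by (intro mult_mono) auto
    then show ?thesis by (simp add: K_def abs_mult)
  qed (simp add: K_def gegenbauer_weight_def)
  have [measurable]: "gegenbauer mu n \<in> borel_measurable borel"
    by (rule borel_measurable_continuous_onI[OF continuous_on_gegenbauer'])
  have Km [measurable]: "K \<in> borel_measurable borel" unfolding K_def by measurable
  have iK: "integrable lborel (\<lambda>x. K x * h x)" if "integrable lborel h" for h
  proof (rule Bochner_Integration.integrable_bound[OF integrable_mult_right[OF that, of 2]])
    show "AE x in lborel. norm (K x * h x) \<le> norm (2 * h x)"
      by (rule AE_I2) (use Kb in \<open>simp add: abs_mult mult_right_mono\<close>)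
    show "(\<lambda>x. K x * h x) \<in> borel_measurable lborel" using that by measurable
  qed
  have i1: "integrable lborel (\<lambda>x. K x * g1i x)" and i2: "integrable lborel (\<lambda>x. K x * g2i x)"
    using iK g1(1) g2(1) by (simp_all add: g1i_def g2i_def)
  have i2': "integrable lborel (\<lambda>x. (-1) ^ n * (K (- x) * g2i (- x)))"
    using lborel_integrable_real_affine[OF i2, of "-1" 0] by simp
  have "(\<integral>x. half_step \<sigma> lam f (clamp1 x) t * gegenbauer mu n x \<partial>gegenbauer_measure mu) =
      (LBINT x. gegenbauer_weight mu x * (half_step \<sigma> lam f (clamp1 x) t * gegenbauer mu n x))"
    by (intro integral_gegenbauer_measure borel_measurable_continuous_onI continuous_intros cH
        continuous_on_gegenbauer')
  also have "\<dots> = (LBINT x. K x * g1i x - \<sigma> * ((-1) ^ n * (K (- x) * g2i (- x))))"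
  proof (rule integral_cong_AE)
    have "AE x in lborel. x \<noteq> (1::real) \<and> x \<noteq> -1"
      by (intro AE_conjI AE_lborel_singleton)
    then show "AE x in lborel. gegenbauer_weight mu x * (half_step \<sigma> lam f (clamp1 x) t * gegenbauer mu n x) =
        K x * g1i x - \<sigma> * ((-1) ^ n * (K (- x) * g2i (- x)))"
      using AE
    proof eventually_elim
      case (elim x)
      show ?case
      proof (cases "x \<in> {-1<..<1}")
        case True
        then have cl: "clamp1 x = x" by simp
        have H: "half_step \<sigma> lam f x t = (1 + x) * g1 x - \<sigma> * ((1 - x) * g2 (- x))" using elim True by blast
        have ind: "indicator {-1..1} x = (1::real)" "indicator {-1..1} (- x) = (1::real)" using True by auto
        have one: "(-1) ^ n * ((-1) ^ n * a) = (a::real)" for a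
          by (simp add: mult.assoc[symmetric] power_add[symmetric])
        have "(-1) ^ n * (K (- x) * g2i (- x)) = gegenbauer_weight mu x * ((1 - x) * gegenbauer mu n x) * g2 (- x)"
          using one[of "gegenbauer_weight mu x * ((1 - x) * gegenbauer mu n x) * g2 (- x)"]
              by (simp add: K_def g2i_def ind gegenbauer_minus mult_ac)
        note E = this
        show ?thesis unfolding cl H E by (simp add: K_def g1i_def ind algebra_simps)
      next
        case False
        then have "x \<notin> {-1..1}" "- x \<notin> {-1..1}" using elim by auto
        then show ?thesis by (simp add: gegenbauer_weight_def g1i_def g2i_def)
      qed
    qed
    show "(\<lambda>x. gegenbauer_weight mu x * (half_step \<sigma> lam f (clamp1 x) t *
        gegenbauer mu n x)) \<in> borel_measurable lborel"
      using borel_measurable_continuous_onI[OF cH] by measurable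
    show "(\<lambda>x. K x * g1i x - \<sigma> * ((-1) ^ n * (K (- x) * g2i (- x)))) \<in> borel_measurable lborel"
      using i1 i2' by measurable
  qed
  also have "\<dots> = (LBINT x. K x * g1i x) - \<sigma> * ((-1) ^ n * (LBINT x. K (- x) * g2i (- x)))"
    using i1 i2' by simp
  also have "(LBINT x. K (- x) * g2i (- x)) = (LBINT x. K x * g2i x)"
    using lborel_integral_real_affine[of "-1" "\<lambda>x. K x * g2i x" 0] by simp
  also have "(LBINT x. K x * g1i x) - \<sigma> * ((-1) ^ n * (LBINT x. K x * g2i x)) =
      k1 * (1 - \<sigma>) * b n fp + k2 * (1 + \<sigma>) * b (Suc n) fp"
  proof -
    define e where "e = ((-1) ^ n :: real)"
    have "e * e = 1" by (simp add: e_def power_add[symmetric])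
    then show ?thesis unfolding I1 I2 b_refl power_Suc e_def[symmetric] by algebra
  qed
  finally show ?thesis by (simp only: mu_def b_def k1_def k2_def fp_def)
qed

theorem theorem3p2:
  fixes d :: nat and f :: "real \<Rightarrow> real \<Rightarrow> real" and lam \<sigma> :: real
  assumes "d \<ge> 1"
    and "lam = (real d - 1) / 2"
    and "f \<in> sphere_line_pd d"
    and "\<And>t. absolutely_continuous_on_interval (-1) 1 (\<lambda>x. f x t)"
    and "\<sigma> \<in> {1, -1}"
    and "continuous_on ({-1..1} \<times> UNIV) (\<lambda>(x, t). half_step \<sigma> lam f x t)"
  shows "half_step \<sigma> lam f \<in> sphere_line_pd (d + 1)"
proof -
  obtain e where d: "d = Suc e" using assms(1) by (cases d) auto
  have lam_e: "lam = real e / 2" using assms(2) d by simp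
  have lam: "lam \<ge> 0" by (simp add: lam_e)
  define mu where "mu = lam + 1/2"
  have mu: "mu = (real (d + 1) - 1) / 2" by (simp add: mu_def lam_e d)
  have cf: "continuous_on ({-1..1} \<times> UNIV) (\<lambda>(x, t). f x t)"
    and pd: "positive_definite_on (topspace (nsphere d) \<times> UNIV) (\<lambda>(\<xi>, s) (\<eta>, t). f (cos (sphere_dist d \<xi> \<eta>)) (s -
        t))"
    using assms(3) by (auto simp: sphere_line_pd_def)
  have cfx: "continuous_on UNIV (\<lambda>x. f (clamp1 x) t)" for t by (rule continuous_on_slice[OF cf])
  have cHx: "continuous_on UNIV (\<lambda>x. half_step \<sigma> lam f (clamp1 x) t)" for t
      by (rule continuous_on_slice[OF assms(6)])
  have inner_in: "sphere_inner k \<xi> \<eta> \<in> {-1..1}" if "\<xi> \<in> topspace (nsphere k)" "\<eta> \<in> topspace (nsphere k)" for k \<xi> \<eta>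
    using abs_sphere_inner_le_1[OF that] by auto
  have psd: "real_psd (topspace (nsphere (Suc e)) \<times> UNIV) (sphere_kernel (Suc e) (\<lambda>x s t. f (clamp1 x) (s - t)))"
  proof (rule real_psd_comp[where h = "\<lambda>p. p"])
    show "real_psd (topspace (nsphere d) \<times> UNIV) (\<lambda>(\<xi>, s) (\<eta>, t). f (cos (sphere_dist d \<xi> \<eta>)) (s - t))"
      using pd by (simp add: positive_definite_on_iff)
    fix p q :: "(nat \<Rightarrow> real) \<times> real"
    assume "p \<in> topspace (nsphere (Suc e)) \<times> UNIV" "q \<in> topspace (nsphere (Suc e)) \<times> UNIV"
    then show "sphere_kernel (Suc e) (\<lambda>x s t. f (clamp1 x) (s - t)) p q =
        (\<lambda>(\<xi>, s) (\<eta>, t). f (cos (sphere_dist d \<xi> \<eta>)) (s - t)) p q"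
      using inner_in[of "fst p" "Suc e" "fst q"]
      by (auto simp: sphere_kernel_def split_def d cos_sphere_dist mem_Times_iff simp del: atLeastAtMost_iff)
  qed (simp add: d)
  define b where "b = (\<lambda>n t. \<integral>x. f (clamp1 x) t * gegenbauer lam n x \<partial>gegenbauer_measure lam)"
  have b_psd: "real_psd UNIV (\<lambda>s t. b n (s - t))" for n
    using coefficient_psd[OF cfx psd, of n] by (simp add: b_def lam_e)
  have f_sym: "f x (- t) = f x t" if x: "x \<in> {-1..1}" for x t
  proof -
    define \<zeta> where "\<zeta> = (\<lambda>n::nat. if n = 0 then 1 else 0 :: real)"
    have \<zeta>: "\<zeta> \<in> topspace (nsphere e)" unfolding \<zeta>_def by (rule in_topspace_nsphere)
    have x1: "\<bar>x\<bar> \<le> 1" using x by auto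
    \<comment> \<open>two points with inner product \<open>x\<close>\<close>
    let ?p = "sphere_embed e x \<zeta>" and ?q = "sphere_embed e 1 \<zeta>"
    have pq: "?p \<in> topspace (nsphere d)" "?q \<in> topspace (nsphere d)"
      unfolding d using x1 by (auto intro!: sphere_embed_mem \<zeta>)
    have "sphere_inner d ?p ?q = x" "sphere_inner d ?q ?p = x"
      unfolding d sphere_embed_inner by simp_all
    moreover have "f (cos (sphere_dist d ?p ?q)) (t - 0) = f (cos (sphere_dist d ?q ?p)) (0 - t)"
    proof -
      have "\<forall>u\<in>topspace (nsphere d) \<times> UNIV. \<forall>v\<in>topspace (nsphere d) \<times> UNIV.
          (\<lambda>(\<xi>, s) (\<eta>, t). f (cos (sphere_dist d \<xi> \<eta>)) (s - t)) u v =
              (\<lambda>(\<xi>, s) (\<eta>, t). f (cos (sphere_dist d \<xi> \<eta>)) (s - t)) v u"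
        using pd by (simp add: positive_definite_on_iff)
      from this[rule_format, of "(?p, t)" "(?q, 0)"] show ?thesis using pq by simp
    qed
    ultimately show ?thesis using pq by (simp add: cos_sphere_dist)
  qed
  have b_sym: "b n (- t) = b n t" for n t by (simp add: b_def f_sym[OF clamp1_in])
  define H where "H = (\<lambda>x t. half_step \<sigma> lam f (clamp1 x) t)"
  define B where "B = (\<lambda>n t. \<integral>x. H x t * gegenbauer mu n x \<partial>gegenbauer_measure mu)"
  define c where "c = (\<lambda>n. if \<sigma> = 1 then 2 * (half_step_factor lam * (real n + 2 * lam + 1) / (2 * real n + 2 *
      lam + 1))
    else 2 * (half_step_factor lam * real n / (2 * real n + 2 * lam + 1)))"
  \<comment> \<open>the degree of the coefficient of \<open>f\<close> that determines the coefficient of degree \<open>n\<close> of \<open>H\<close>\<close>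
  define m where "m = (\<lambda>n. if \<sigma> = 1 then Suc n else n)"
  have c: "c n \<ge> 0" for n
    using half_step_factor_pos[OF lam] lam by (auto simp: c_def intro!: divide_nonneg_nonneg mult_nonneg_nonneg)
  have B: "B n t = c n * b (m n) t" for n t
    using half_step_gegenbauer_coefficient[where f = f and lam = lam and \<sigma> = \<sigma> and t = t
        and n = n, OF lam cfx assms(4) cHx] assms(5)
    by (auto simp: B_def H_def b_def mu_def c_def m_def)
  have B_psd: "real_psd UNIV (\<lambda>s t. B n (s - t))" for n
    unfolding real_psd_def psd_form_def
  proof (intro allI impI)
    fix N and p a :: "nat \<Rightarrow> real"
    have "0 \<le> c n * (\<Sum>i<N. \<Sum>j<N. a i * a j * b (m n) (p i - p j))"
      using b_psd[of "m n"] by (intro mult_nonneg_nonneg c) (auto simp: real_psd_def psd_form_def)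
    also have "\<dots> = (\<Sum>i<N. \<Sum>j<N. a i * a j * B n (p i - p j))"
      by (simp add: B sum_distrib_left mult_ac)
    finally show "0 \<le> (\<Sum>i<N. \<Sum>j<N. a i * a j * B n (p i - p j))" .
  qed
  have inv: "real_psd (topspace (nsphere (d + 1)) \<times> UNIV) (sphere_kernel (d + 1) (\<lambda>x s t. H x (s - t)))"
    and H_sym: "\<And>x t. x \<in> {-1..1} \<Longrightarrow> H x (- t) = H x t"
  proof -
    have 1: "continuous_on UNIV (\<lambda>x. H x t)" for t unfolding H_def by (rule cHx)
    have 2: "real_psd UNIV (\<lambda>s t. \<integral>x. H x (s - t) * gegenbauer mu n x \<partial>gegenbauer_measure mu)" for n
      using B_psd[of n] by (simp only: B_def)
    have 3: "(\<integral>x. H x (- t) * gegenbauer mu n x \<partial>gegenbauer_measure mu) =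
        (\<integral>x. H x t * gegenbauer mu n x \<partial>gegenbauer_measure mu)" for n t
      using B[of n "- t"] B[of n t] b_sym by (simp add: B_def)
    show "real_psd (topspace (nsphere (d + 1)) \<times> UNIV) (sphere_kernel (d + 1) (\<lambda>x s t. H x (s - t)))"
      by (rule gegenbauer_inversion(1)[OF _ mu 1 2 3]) simp
    show "\<And>x t. x \<in> {-1..1} \<Longrightarrow> H x (- t) = H x t"
      by (rule gegenbauer_inversion(2)[OF _ mu 1 2 3]) simp_all
  qed
  have kernel_eq: "half_step \<sigma> lam f (cos (sphere_dist (d + 1) \<xi> \<eta>)) s = H (sphere_inner (d + 1) \<xi> \<eta>) s"
    if "\<xi> \<in> topspace (nsphere (d + 1))" "\<eta> \<in> topspace (nsphere (d + 1))" for \<xi> \<eta> s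
    unfolding H_def cos_sphere_dist[OF that] clamp1_id[OF inner_in[OF that]] ..
  have "positive_definite_on (topspace (nsphere (d + 1)) \<times> UNIV)
      (\<lambda>(\<xi>, s) (\<eta>, t). half_step \<sigma> lam f (cos (sphere_dist (d + 1) \<xi> \<eta>)) (s - t))"
    unfolding positive_definite_on_iff
  proof (intro conjI ballI)
    show "real_psd (topspace (nsphere (d + 1)) \<times> UNIV)
        (\<lambda>(\<xi>, s) (\<eta>, t). half_step \<sigma> lam f (cos (sphere_dist (d + 1) \<xi> \<eta>)) (s - t))"
      by (rule real_psd_comp[OF inv, where h = "\<lambda>p. p"])
        (auto simp: sphere_kernel_def split_def kernel_eq mem_Times_iff simp del: Suc_eq_plus1 add_Suc_right
            One_nat_def)
    fix p q assume pq: "p \<in> topspace (nsphere (d + 1)) \<times> (UNIV :: real set)" "q \<in> topspace (nsphere (d +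
        1)) \<times> (UNIV :: real set)"
    then have m: "fst p \<in> topspace (nsphere (d + 1))" "fst q \<in> topspace (nsphere (d + 1))"
        by (auto simp: mem_Times_iff)
    show "(\<lambda>(\<xi>, s) (\<eta>, t). half_step \<sigma> lam f (cos (sphere_dist (d + 1) \<xi> \<eta>)) (s - t)) p q =
        (\<lambda>(\<xi>, s) (\<eta>, t). half_step \<sigma> lam f (cos (sphere_dist (d + 1) \<xi> \<eta>)) (s - t)) q p"
      using H_sym[OF inner_in[OF m], of "snd q - snd p"]
      by (simp only: split_def kernel_eq[OF m] kernel_eq[OF m(2,1)] sphere_inner_commute[of _ "fst q"]
          minus_diff_eq)
  qed
  then show ?thesis using assms(6) by (simp add: sphere_line_pd_def)
qed

end
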